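(* Let $G$ be a finite group and $p$ a fixed prime divisor of $|G|$. Then every self-centralizing non-abelian subgroup of $G$ is a TI-subgroup of $G$ or subnormal in $G$ or has $p'$-order if and only if every non-abelian subgroup of $G$ is a TI-subgroup of $G$ or subnormal in $G$ or has $p'$-order.
   Context: All groups are finite. A subgroup $H$ of a group $G$ is a TI-subgroup of $G$ if for every $g\in G$, $H^g\cap H=1$ or $H^g\cap H=H$. A subgroup $H$ of $G$ is self-centralizing in $G$ if $C_G(H)\leq H$. A subgroup has $p'$-order if its order is not divisible by $p$. *)

theory Defs
  imports "HOL-Algebra.Algebra"
begin

definition conj_sub :: "('a, 'b) monoid_scheme \<Rightarrow> 'a set \<Rightarrow> 'a \<Rightarrow> 'a set" where
  "conj_sub G H g = {inv\<^bsub>G\<^esub> g \<otimes>\<^bsub>G\<^esub> h \<otimes>\<^bsub>G\<^esub> g | h. h \<in> H}"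

definition TI_subgroup :: "'a set \<Rightarrow> ('a, 'b) monoid_scheme \<Rightarrow> bool" where
  "TI_subgroup H G \<longleftrightarrow> subgroup H G \<and>
     (\<forall>g \<in> carrier G. conj_sub G H g \<inter> H = {\<one>\<^bsub>G\<^esub>} \<or> conj_sub G H g \<inter> H = H)"

definition centralizer :: "('a, 'b) monoid_scheme \<Rightarrow> 'a set \<Rightarrow> 'a set" where
  "centralizer G H = {x \<in> carrier G. \<forall>h \<in> H. x \<otimes>\<^bsub>G\<^esub> h = h \<otimes>\<^bsub>G\<^esub> x}"

definition self_centralizing :: "'a set \<Rightarrow> ('a, 'b) monoid_scheme \<Rightarrow> bool" where
  "self_centralizing H G \<longleftrightarrow> subgroup H G \<and> centralizer G H \<subseteq> H"

definition non_abelian :: "'a set \<Rightarrow> ('a, 'b) monoid_scheme \<Rightarrow> bool" where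
  "non_abelian H G \<longleftrightarrow> (\<exists>x \<in> H. \<exists>y \<in> H. x \<otimes>\<^bsub>G\<^esub> y \<noteq> y \<otimes>\<^bsub>G\<^esub> x)"

inductive subnormal :: "('a, 'b) monoid_scheme \<Rightarrow> 'a set \<Rightarrow> bool" for G where
  top: "subnormal G (carrier G)"
| step: "subnormal G K \<Longrightarrow> subgroup K G \<Longrightarrow> H \<lhd> (G\<lparr>carrier := K\<rparr>) \<Longrightarrow> subnormal G H"

definition p'_order :: "nat \<Rightarrow> 'a set \<Rightarrow> bool" where
  "p'_order p H \<longleftrightarrow> \<not> p dvd card H"

end

theory Submission
  imports Defs
begin

text \<open>
  Let \<open>H\<close> be non-abelian of order divisible by \<open>p\<close> and put $K = H C_G(H)$, which is self-centralizing.
  If \<open>K\<close> is subnormal, so is \<open>H\<close>. Otherwise \<open>K\<close> is TI, and so is its normalizer \<open>M\<close>, which is moreover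
  self-normalizing; thus \<open>M\<close> is malnormal in \<open>G\<close>, like a Frobenius complement. The key point is that
  \<open>G\<close> then has a nontrivial abelian normal subgroup \<open>A\<close>; this replaces Frobenius's theorem. If \<open>G\<close> is
  solvable, \<open>A\<close> comes from the derived series. Otherwise let \<open>D\<close> be the perfect term of the derived
  series. The transfer homomorphism shows that malnormal subgroups of perfect groups are perfect, while
  the hypothesis on \<open>G\<close>, applied to subgroups containing a Sylow \<open>p\<close>-subgroup \<open>P\<close>, yields a malnormal
  subgroup containing \<open>P\<close> that meets \<open>D\<close> trivially. Then \<open>P\<close> acts fixed-point-freely on \<open>D\<close> and
  normalizes a Sylow subgroup \<open>Q\<close> of \<open>D\<close>. The group $PQ$ is self-centralizing. It is not TI, because
  \<open>Q\<close> would then be malnormal in \<open>D\<close>, hence perfect; so it is subnormal, \<open>Q\<close> is normal in \<open>G\<close>, and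
  \<open>A\<close> comes from the derived series of \<open>Q\<close>.

  Now \<open>K\<close> acts fixed-point-freely on \<open>A\<close>, so it has no subgroup $C_r \times C_r$. This forces the central
  factor \<open>H\<close> of \<open>K\<close> to be invariant under the normalizer of \<open>K\<close>, and therefore \<open>H\<close> is TI.
\<close>

section \<open>Conjugation, normalizers and centralizers\<close>

locale finite_group = group G for G (structure) +
  assumes finite_carrier [simp]: "finite (carrier G)"

text \<open>The opposite of the convention for \<open>conj_sub\<close>, where $H^g = g^{-1} H g$.\<close>

definition conj_by :: "('a, 'b) monoid_scheme \<Rightarrow> 'a \<Rightarrow> 'a \<Rightarrow> 'a" where
  "conj_by G g x = g \<otimes>\<^bsub>G\<^esub> x \<otimes>\<^bsub>G\<^esub> inv\<^bsub>G\<^esub> g"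

context group
begin

lemma mult_inv_cancel [simp]:
  assumes "x \<in> carrier G" "y \<in> carrier G"
  shows "x \<otimes> (inv x \<otimes> y) = y" "inv x \<otimes> (x \<otimes> y) = y"
  using assms by (simp_all add: m_assoc[symmetric])

lemma conj_by_closed [simp, intro]:
  "g \<in> carrier G \<Longrightarrow> x \<in> carrier G \<Longrightarrow> conj_by G g x \<in> carrier G"
  by (simp add: conj_by_def)

lemma conj_by_mult:
  "g \<in> carrier G \<Longrightarrow> x \<in> carrier G \<Longrightarrow> y \<in> carrier G \<Longrightarrow>
    conj_by G g (x \<otimes> y) = conj_by G g x \<otimes> conj_by G g y"
  by (simp add: conj_by_def m_assoc)

lemma conj_by_conj_by:
  "g \<in> carrier G \<Longrightarrow> h \<in> carrier G \<Longrightarrow> x \<in> carrier G \<Longrightarrow>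
    conj_by G g (conj_by G h x) = conj_by G (g \<otimes> h) x"
  by (simp add: conj_by_def m_assoc inv_mult_group)

lemma conj_by_one_left [simp]: "x \<in> carrier G \<Longrightarrow> conj_by G \<one> x = x"
  by (simp add: conj_by_def)

lemma conj_by_one_right [simp]: "g \<in> carrier G \<Longrightarrow> conj_by G g \<one> = \<one>"
  by (simp add: conj_by_def)

lemma conj_by_inv:
  "g \<in> carrier G \<Longrightarrow> x \<in> carrier G \<Longrightarrow> conj_by G g (inv x) = inv (conj_by G g x)"
  by (simp add: conj_by_def m_assoc inv_mult_group)

lemma conj_by_inv_cancel [simp]:
  assumes "g \<in> carrier G" "x \<in> carrier G"
  shows "conj_by G g (conj_by G (inv g) x) = x" "conj_by G (inv g) (conj_by G g x) = x"
  using assms by (simp_all add: conj_by_conj_by)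

lemma conj_by_pow:
  "g \<in> carrier G \<Longrightarrow> x \<in> carrier G \<Longrightarrow> conj_by G g (x [^] (n::nat)) = conj_by G g x [^] n"
  by (induction n) (simp_all add: conj_by_mult)

lemma conj_by_eq_self_iff:
  "g \<in> carrier G \<Longrightarrow> x \<in> carrier G \<Longrightarrow> conj_by G g x = x \<longleftrightarrow> g \<otimes> x = x \<otimes> g"
  by (simp add: conj_by_def) (metis inv_solve_right' m_closed)

lemma inj_on_conj_by: "g \<in> carrier G \<Longrightarrow> inj_on (conj_by G g) (carrier G)"
  by (rule inj_on_inverseI[of _ "conj_by G (inv g)"]) simp

lemma conj_by_eq_one_iff [simp]:
  "g \<in> carrier G \<Longrightarrow> x \<in> carrier G \<Longrightarrow> conj_by G g x = \<one> \<longleftrightarrow> x = \<one>"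
  using inj_on_conj_by[of g] by (metis conj_by_one_right inj_on_contraD one_closed)

lemma card_conj_by_image:
  "H \<subseteq> carrier G \<Longrightarrow> g \<in> carrier G \<Longrightarrow> card (conj_by G g ` H) = card H"
  by (meson card_image inj_on_conj_by inj_on_subset)

lemma conj_by_image_conj_by_image:
  "g \<in> carrier G \<Longrightarrow> h \<in> carrier G \<Longrightarrow> H \<subseteq> carrier G \<Longrightarrow>
    conj_by G g ` conj_by G h ` H = conj_by G (g \<otimes> h) ` H"
  by (force simp: image_image conj_by_conj_by intro!: image_cong)

lemma conj_by_image_one [simp]: "H \<subseteq> carrier G \<Longrightarrow> conj_by G \<one> ` H = H"
  by (force simp: image_iff)

lemma mem_conj_by_image_iff:
  assumes "g \<in> carrier G" "x \<in> carrier G" "H \<subseteq> carrier G"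
  shows "x \<in> conj_by G g ` H \<longleftrightarrow> conj_by G (inv g) x \<in> H"
proof
  assume "conj_by G (inv g) x \<in> H"
  then show "x \<in> conj_by G g ` H"
    using assms by (intro image_eqI[of _ _ "conj_by G (inv g) x"]) auto
qed (use assms in auto)

lemma group_hom_conj_by: "g \<in> carrier G \<Longrightarrow> group_hom G G (conj_by G g)"
  by unfold_locales (simp add: hom_def conj_by_mult)

lemma subgroup_conj_by_image:
  "subgroup H G \<Longrightarrow> g \<in> carrier G \<Longrightarrow> subgroup (conj_by G g ` H) G"
  using group_hom.subgroup_img_is_subgroup[OF group_hom_conj_by] .

lemma subgroup_conj_by_closed: "subgroup H G \<Longrightarrow> g \<in> H \<Longrightarrow> x \<in> H \<Longrightarrow> conj_by G g x \<in> H"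
  by (simp add: conj_by_def subgroup.m_closed subgroup.m_inv_closed)

lemma conj_sub_eq_image: "g \<in> carrier G \<Longrightarrow> conj_sub G H g = conj_by G (inv g) ` H"
  by (auto simp: conj_sub_def conj_by_def)

lemma subgroup_pow_closed: "subgroup H G \<Longrightarrow> x \<in> H \<Longrightarrow> x [^] (n::nat) \<in> H"
  by (metis int_pow_int subgroup_int_pow_closed)

lemma normalizer_subset: "normalizer G H \<subseteq> carrier G"
  by (auto simp: normalizer_def stabilizer_def)

lemma mem_normalizer_iff:
  assumes "H \<subseteq> carrier G"
  shows "g \<in> normalizer G H \<longleftrightarrow> g \<in> carrier G \<and> conj_by G g ` H = H"
proof -
  have "g <# H #> inv g = conj_by G g ` H"
    by (auto simp: l_coset_def r_coset_def conj_by_def)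
  then show ?thesis using assms by (simp add: normalizer_def stabilizer_def)
qed

lemma normalizer_image_eq: "subgroup H G \<Longrightarrow> g \<in> normalizer G H \<Longrightarrow> conj_by G g ` H = H"
  by (simp add: mem_normalizer_iff subgroup.subset)

lemma normalizerD: "subgroup H G \<Longrightarrow> g \<in> normalizer G H \<Longrightarrow> h \<in> H \<Longrightarrow> conj_by G g h \<in> H"
  by (metis normalizer_image_eq imageI)

lemma subgroup_normalizer: "subgroup H G \<Longrightarrow> subgroup (normalizer G H) G"
  by (simp add: normalizer_imp_subgroup subgroup.subset)

lemma subset_normalizerI:
  assumes "subgroup K G" "H \<subseteq> carrier G"
    and closed: "\<And>k h. k \<in> K \<Longrightarrow> h \<in> H \<Longrightarrow> conj_by G k h \<in> H"
  shows "K \<subseteq> normalizer G H"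
proof
  fix k assume "k \<in> K"
  interpret K: subgroup K G by fact
  have "h \<in> conj_by G k ` H" if "h \<in> H" for h
    using \<open>k \<in> K\<close> \<open>h \<in> H\<close> \<open>H \<subseteq> carrier G\<close> closed[of "inv k" h]
    by (intro image_eqI[of _ _ "conj_by G (inv k) h"]) auto
  then have "conj_by G k ` H = H" using \<open>k \<in> K\<close> closed by blast
  then show "k \<in> normalizer G H"
    using \<open>k \<in> K\<close> by (simp add: mem_normalizer_iff[OF \<open>H \<subseteq> carrier G\<close>])
qed

lemma subgroup_subset_normalizer: "subgroup H G \<Longrightarrow> H \<subseteq> normalizer G H"
  by (intro subset_normalizerI) (auto simp: subgroup_conj_by_closed subgroup.subset)

lemma conj_by_image_normalizer_subset:
  assumes "subgroup H G" "s \<in> carrier G"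
  shows "conj_by G s ` normalizer G H \<subseteq> normalizer G (conj_by G s ` H)"
proof (rule subset_normalizerI)
  interpret H: subgroup H G by fact
  show "subgroup (conj_by G s ` normalizer G H) G"
    using assms by (simp add: subgroup_conj_by_image subgroup_normalizer)
  show "conj_by G s ` H \<subseteq> carrier G" using assms by auto
  fix x y assume "x \<in> conj_by G s ` normalizer G H" "y \<in> conj_by G s ` H"
  then obtain g h where "g \<in> normalizer G H" "h \<in> H" "x = conj_by G s g" "y = conj_by G s h"
    by blast
  moreover from this have "conj_by G x y = conj_by G s (conj_by G g h)"
    using assms normalizer_subset by (auto simp: conj_by_def m_assoc inv_mult_group subset_iff)
  ultimately show "conj_by G x y \<in> conj_by G s ` H" using normalizerD[OF assms(1)] by blast
qed

lemma normal_in_subgroup_iff: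
  assumes "subgroup K G"
  shows "H \<lhd> G\<lparr>carrier := K\<rparr> \<longleftrightarrow> subgroup H G \<and> H \<subseteq> K \<and> K \<subseteq> normalizer G H"
proof -
  interpret K: group "G\<lparr>carrier := K\<rparr>" using assms subgroup_imp_group by blast
  have subgroup_iff: "subgroup H (G\<lparr>carrier := K\<rparr>) \<longleftrightarrow> subgroup H G \<and> H \<subseteq> K"
    using incl_subgroup[OF assms, of H] subgroup_incl[OF _ assms, of H]
      subgroup.subset[of H "G\<lparr>carrier := K\<rparr>"]
    by auto
  have "(\<forall>k \<in> K. \<forall>h \<in> H. conj_by G k h \<in> H) \<longleftrightarrow> K \<subseteq> normalizer G H" if "subgroup H G"
    using that normalizerD[OF that] subset_normalizerI[OF assms subgroup.subset[OF that]]
    by (auto simp: subset_iff)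
  then show ?thesis
    unfolding K.normal_inv_iff subgroup_iff using assms by (auto simp: conj_by_def)
qed

lemma normal_iff_normalizer: "H \<lhd> G \<longleftrightarrow> subgroup H G \<and> carrier G \<subseteq> normalizer G H"
  using normal_in_subgroup_iff[OF subgroup_self, of H] subgroup.subset by auto

lemma centralizer_subset: "centralizer G S \<subseteq> carrier G"
  by (auto simp: centralizer_def)

lemma centralizerI: "x \<in> carrier G \<Longrightarrow> (\<And>s. s \<in> S \<Longrightarrow> x \<otimes> s = s \<otimes> x) \<Longrightarrow> x \<in> centralizer G S"
  by (simp add: centralizer_def)

lemma centralizerD: "x \<in> centralizer G S \<Longrightarrow> s \<in> S \<Longrightarrow> x \<otimes> s = s \<otimes> x"
  by (simp add: centralizer_def)

lemma centralizer_antimono: "S \<subseteq> T \<Longrightarrow> centralizer G T \<subseteq> centralizer G S"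
  by (auto simp: centralizer_def)

lemma subset_centralizer_commute:
  "S \<subseteq> carrier G \<Longrightarrow> S \<subseteq> centralizer G T \<Longrightarrow> T \<subseteq> carrier G \<Longrightarrow> T \<subseteq> centralizer G S"
  by (auto simp: centralizer_def subset_iff)

lemma centralizer_eq_fixed_by_conj:
  assumes "S \<subseteq> carrier G"
  shows "centralizer G S = {x \<in> carrier G. \<forall>s \<in> S. conj_by G s x = x}"
proof -
  have "conj_by G s x = x \<longleftrightarrow> x \<otimes> s = s \<otimes> x" if "x \<in> carrier G" "s \<in> S" for x s
    using that assms conj_by_eq_self_iff[of s x] by auto
  then show ?thesis by (auto simp: centralizer_def)
qed

lemma subgroup_centralizer:
  assumes "S \<subseteq> carrier G"
  shows "subgroup (centralizer G S) G"
  unfolding centralizer_eq_fixed_by_conj[OF assms]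
  using assms by unfold_locales (auto simp: conj_by_mult conj_by_inv subset_iff)

lemma centralizer_subset_normalizer:
  assumes "S \<subseteq> carrier G"
  shows "centralizer G S \<subseteq> normalizer G S"
proof (rule subset_normalizerI[OF subgroup_centralizer[OF assms] assms])
  fix x s assume "x \<in> centralizer G S" "s \<in> S"
  then have "conj_by G x s = s"
    using assms centralizer_subset by (subst conj_by_eq_self_iff) (auto simp: centralizer_def)
  then show "conj_by G x s \<in> S" using \<open>s \<in> S\<close> by simp
qed

lemma subgroup_subset_normalizer_centralizer:
  assumes "subgroup H G"
  shows "H \<subseteq> normalizer G (centralizer G H)"
  using assms centralizer_eq_fixed_by_conj[OF subgroup.subset[OF assms]]
  by (intro subset_normalizerI[OF assms centralizer_subset]) auto

lemma set_multI: "h \<in> H \<Longrightarrow> k \<in> K \<Longrightarrow> h \<otimes> k \<in> H <#> K"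
  by (auto simp: set_mult_def)

lemma set_multE:
  assumes "x \<in> H <#> K"
  obtains h k where "h \<in> H" "k \<in> K" "x = h \<otimes> k"
  using assms by (auto simp: set_mult_def)

lemma subgroup_set_mult:
  assumes "subgroup H G" "subgroup K G" "H \<subseteq> normalizer G K"
  shows "subgroup (H <#> K) G"
proof
  interpret H: subgroup H G by fact
  interpret K: subgroup K G by fact
  note K_invariant = normalizerD[OF assms(2) subsetD[OF assms(3)]]
  show "H <#> K \<subseteq> carrier G" by (auto simp: set_mult_def)
  show "\<one> \<in> H <#> K" using set_multI[OF H.one_closed K.one_closed] by simp
  fix x assume "x \<in> H <#> K"
  then obtain h k where x_factors: "h \<in> H" "k \<in> K" "x = h \<otimes> k" by (rule set_multE)
  have "inv x = inv h \<otimes> conj_by G h (inv k)"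
    using x_factors by (simp add: conj_by_def inv_mult_group m_assoc)
  then show "inv x \<in> H <#> K" using x_factors K_invariant by (simp add: set_multI)
  fix y assume "y \<in> H <#> K"
  then obtain h' k' where y_factors: "h' \<in> H" "k' \<in> K" "y = h' \<otimes> k'" by (rule set_multE)
  have "x \<otimes> y = (h \<otimes> h') \<otimes> (conj_by G (inv h') k \<otimes> k')"
    using x_factors y_factors by (simp add: conj_by_def m_assoc)
  then show "x \<otimes> y \<in> H <#> K" using x_factors y_factors K_invariant by (simp add: set_multI)
qed

lemma subset_set_mult_left: "subgroup H G \<Longrightarrow> subgroup K G \<Longrightarrow> H \<subseteq> H <#> K"
  by (metis r_one set_multI subgroup.mem_carrier subgroup.one_closed subsetI)

lemma subset_set_mult_right: "subgroup H G \<Longrightarrow> subgroup K G \<Longrightarrow> K \<subseteq> H <#> K"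
  by (metis l_one set_multI subgroup.mem_carrier subgroup.one_closed subsetI)

lemma set_mult_least: "subgroup L G \<Longrightarrow> H \<subseteq> L \<Longrightarrow> K \<subseteq> L \<Longrightarrow> H <#> K \<subseteq> L"
  by (auto simp: set_mult_def subgroup.m_closed subset_iff)

lemma set_mult_commute:
  assumes "subgroup H G" "subgroup K G" "H \<subseteq> normalizer G K"
  shows "H <#> K = K <#> H"
proof -
  interpret H: subgroup H G by fact
  interpret K: subgroup K G by fact
  note K_invariant = normalizerD[OF assms(2) subsetD[OF assms(3)]]
  have "h \<otimes> k \<in> K <#> H" if "h \<in> H" "k \<in> K" for h k
  proof -
    have "h \<otimes> k = conj_by G h k \<otimes> h" using that by (simp add: conj_by_def m_assoc)
    then show ?thesis using that K_invariant by (simp add: set_multI)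
  qed
  moreover have "k \<otimes> h \<in> H <#> K" if "h \<in> H" "k \<in> K" for h k
  proof -
    have "k \<otimes> h = h \<otimes> conj_by G (inv h) k" using that by (simp add: conj_by_def m_assoc)
    then show ?thesis using that K_invariant by (simp add: set_multI)
  qed
  ultimately show ?thesis by (fastforce elim!: set_multE)
qed

lemma non_abelian_mono: "non_abelian H G \<Longrightarrow> H \<subseteq> K \<Longrightarrow> non_abelian K G"
  by (auto simp: non_abelian_def)

lemma subset_centralizer_if_abelian:
  "H \<subseteq> carrier G \<Longrightarrow> \<not> non_abelian H G \<Longrightarrow> H \<subseteq> centralizer G H"
  by (auto simp: centralizer_def non_abelian_def)

lemma comm_group_if_abelian:
  assumes "subgroup H G" "\<not> non_abelian H G"
  shows "comm_group (G\<lparr>carrier := H\<rparr>)"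
proof (rule group.group_comm_groupI)
  show "group (G\<lparr>carrier := H\<rparr>)" using assms subgroup_imp_group by blast
qed (use assms in \<open>auto simp: non_abelian_def\<close>)

abbreviation cyc :: "'a \<Rightarrow> 'a set" where "cyc x \<equiv> generate G {x}"

lemma subgroup_cyc: "x \<in> carrier G \<Longrightarrow> subgroup (cyc x) G"
  by (simp add: generate_is_subgroup)

lemma mem_cyc: "x \<in> cyc x"
  by (simp add: generate.incl)

lemma cyc_subset: "subgroup H G \<Longrightarrow> x \<in> H \<Longrightarrow> cyc x \<subseteq> H"
  by (simp add: generate_subgroup_incl)

lemma cyc_abelian:
  assumes "x \<in> carrier G"
  shows "\<not> non_abelian (cyc x) G"
proof -
  have "cyc x \<subseteq> centralizer G {x}"
    using assms by (intro cyc_subset subgroup_centralizer) (auto simp: centralizer_def)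
  then have "{x} \<subseteq> centralizer G (cyc x)"
    using subset_centralizer_commute[OF subgroup.subset[OF subgroup_cyc[OF assms]]] assms by blast
  then have "cyc x \<subseteq> centralizer G (cyc x)"
    using assms by (intro cyc_subset subgroup_centralizer subgroup.subset subgroup_cyc) auto
  then show ?thesis by (auto simp: non_abelian_def centralizer_def)
qed

lemma subset_normalizer_cyc_if_centralizing:
  assumes "L \<subseteq> carrier G" "y \<in> centralizer G L"
  shows "L \<subseteq> normalizer G (cyc y)"
proof -
  have cyc_y: "subgroup (cyc y) G" using assms(2) centralizer_subset subgroup_cyc by blast
  have "cyc y \<subseteq> centralizer G L" using cyc_subset[OF subgroup_centralizer[OF assms(1)] assms(2)] .
  then show ?thesis
    using subset_centralizer_commute[OF subgroup.subset[OF cyc_y] _ assms(1)]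
      centralizer_subset_normalizer[OF subgroup.subset[OF cyc_y]] by blast
qed

lemma nontrivial_subgroupE:
  assumes "subgroup H G" "H \<noteq> {\<one>}"
  obtains x where "x \<in> H" "x \<noteq> \<one>"
  using assms subgroup.one_closed by blast

end

context finite_group
begin

lemma finite_subgroup: "subgroup H G \<Longrightarrow> finite H"
  using finite_subset subgroup.subset finite_carrier by blast

lemma card_subgroup_pos: "subgroup H G \<Longrightarrow> card H > 0"
  using finite_subgroup subgroup.one_closed by (metis card_gt_0_iff empty_iff)

lemma card_subgroup_eq_one_iff:
  assumes "subgroup H G"
  shows "card H = 1 \<longleftrightarrow> H = {\<one>}"
  using subgroup.one_closed[OF assms]
  by (metis card_1_singletonE is_singletonI is_singleton_altdef singletonD)

lemma card_subgroup_dvd: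
  assumes "subgroup H G" "subgroup K G" "H \<subseteq> K"
  shows "card H dvd card K"
proof -
  interpret K: group "G\<lparr>carrier := K\<rparr>" using assms subgroup_imp_group by blast
  have "card (rcosets\<^bsub>G\<lparr>carrier := K\<rparr>\<^esub> H) * card H = card K"
    using K.lagrange[OF subgroup_incl[OF assms]] by (simp add: order_def)
  then show ?thesis by (metis dvd_triv_right)
qed

lemma subgroup_eqI:
  "subgroup H G \<Longrightarrow> subgroup K G \<Longrightarrow> H \<subseteq> K \<Longrightarrow> card K dvd card H \<Longrightarrow> H = K"
  by (metis card_subgroup_dvd card_subset_eq dvd_antisym finite_subgroup)

lemma index_dvd_index:
  assumes "subgroup H G" "subgroup K G" "subgroup L G" "H \<subseteq> K" "K \<subseteq> L"
  shows "card L div card K dvd card L div card H"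
proof -
  obtain i where i: "card K = card H * i" using card_subgroup_dvd[OF assms(1,2,4)] by blast
  obtain j where j: "card L = card K * j" using card_subgroup_dvd[OF assms(2,3,5)] by blast
  have "card L div card K = j" "card L div card H = i * j"
    using i j card_subgroup_pos[OF assms(1)] card_subgroup_pos[OF assms(2)] by auto
  then show ?thesis by simp
qed

lemma subgroup_if_mult_closed:
  assumes "S \<subseteq> carrier G" "\<one> \<in> S" "\<And>x y. x \<in> S \<Longrightarrow> y \<in> S \<Longrightarrow> x \<otimes> y \<in> S"
  shows "subgroup S G"
proof
  fix a assume "a \<in> S"
  then have a: "a \<in> carrier G" using assms by blast
  have "cyc a = {a [^] k | k. k \<in> (UNIV :: nat set)}"
    using generate_pow_on_finite_carrier[OF finite_carrier a] .
  moreover have "a [^] n \<in> S" for n :: nat using \<open>a \<in> S\<close> assms by (induction n) auto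
  moreover have "inv a \<in> cyc a" by (simp add: generate.inv)
  ultimately show "inv a \<in> S" by auto
qed (use assms in auto)

lemma mem_normalizerI:
  assumes "g \<in> carrier G" "H \<subseteq> carrier G" "\<And>h. h \<in> H \<Longrightarrow> conj_by G g h \<in> H"
  shows "g \<in> normalizer G H"
proof -
  have "conj_by G g ` H = H"
    using assms by (intro card_subset_eq) (auto simp: card_conj_by_image finite_subset)
  then show ?thesis using assms by (simp add: mem_normalizer_iff)
qed

lemma maximal_subset_exists:
  assumes "Q S" "\<And>T. Q T \<Longrightarrow> T \<subseteq> carrier G"
  obtains M where "Q M" "S \<subseteq> M" "\<forall>T. Q T \<longrightarrow> M \<subseteq> T \<longrightarrow> M = T"
proof -
  have "finite {T. Q T}" by (rule finite_subset[of _ "Pow (carrier G)"]) (use assms(2) in auto)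
  then obtain M where "M \<in> {T. Q T}" "S \<subseteq> M" "\<And>T. T \<in> {T. Q T} \<Longrightarrow> M \<subseteq> T \<Longrightarrow> M = T"
    using finite_has_maximal2[of "{T. Q T}" S] assms(1) by (metis mem_Collect_eq)
  then show thesis using that by simp
qed

end

section \<open>Commutators\<close>

definition commutator :: "('a, 'b) monoid_scheme \<Rightarrow> 'a \<Rightarrow> 'a \<Rightarrow> 'a" where
  "commutator G x y = x \<otimes>\<^bsub>G\<^esub> y \<otimes>\<^bsub>G\<^esub> inv\<^bsub>G\<^esub> x \<otimes>\<^bsub>G\<^esub> inv\<^bsub>G\<^esub> y"

context group
begin

lemma commutator_closed [simp]:
  "x \<in> carrier G \<Longrightarrow> y \<in> carrier G \<Longrightarrow> commutator G x y \<in> carrier G"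
  by (simp add: commutator_def)

lemma commutator_eq_one_iff:
  assumes "x \<in> carrier G" "y \<in> carrier G"
  shows "commutator G x y = \<one> \<longleftrightarrow> x \<otimes> y = y \<otimes> x"
proof -
  have "commutator G x y = x \<otimes> y \<otimes> inv (y \<otimes> x)"
    using assms by (simp add: commutator_def inv_mult_group m_assoc)
  then show ?thesis using assms inv_solve_right'[of \<one> "x \<otimes> y" "y \<otimes> x"] by simp
qed

lemma inv_commutator:
  "x \<in> carrier G \<Longrightarrow> y \<in> carrier G \<Longrightarrow> inv (commutator G x y) = commutator G y x"
  by (simp add: commutator_def inv_mult_group m_assoc)

lemma conj_by_commutator:
  "g \<in> carrier G \<Longrightarrow> x \<in> carrier G \<Longrightarrow> y \<in> carrier G \<Longrightarrow>
    conj_by G g (commutator G x y) = commutator G (conj_by G g x) (conj_by G g y)"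
  by (simp add: commutator_def conj_by_mult conj_by_inv)

lemma commutator_mult_left:
  "x \<in> carrier G \<Longrightarrow> y \<in> carrier G \<Longrightarrow> z \<in> carrier G \<Longrightarrow>
    commutator G (x \<otimes> y) z = conj_by G x (commutator G y z) \<otimes> commutator G x z"
  by (simp add: commutator_def conj_by_def m_assoc inv_mult_group)

lemma commutator_mult_right:
  "x \<in> carrier G \<Longrightarrow> y \<in> carrier G \<Longrightarrow> z \<in> carrier G \<Longrightarrow>
    commutator G x (y \<otimes> z) = commutator G x y \<otimes> conj_by G y (commutator G x z)"
  by (simp add: commutator_def conj_by_def m_assoc inv_mult_group)

lemma commutator_mem_right:
  assumes "subgroup H G" "x \<in> normalizer G H" "y \<in> H"
  shows "commutator G x y \<in> H"
proof -
  interpret H: subgroup H G by fact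
  have "commutator G x y = conj_by G x y \<otimes> inv y" by (simp add: commutator_def conj_by_def)
  then show ?thesis using assms normalizerD by auto
qed

lemma commutator_mem_left:
  assumes "subgroup H G" "x \<in> H" "y \<in> normalizer G H"
  shows "commutator G x y \<in> H"
  using commutator_mem_right[OF assms(1,3,2)] assms normalizer_subset[of H]
  by (metis inv_commutator subgroup.m_inv_closed subgroup.mem_carrier subsetD)

lemma normalizing_disjoint_commute:
  assumes "subgroup A G" "subgroup B G" "A \<subseteq> normalizer G B" "B \<subseteq> normalizer G A" "A \<inter> B = {\<one>}"
  shows "A \<subseteq> centralizer G B"
proof
  interpret A: subgroup A G by fact
  interpret B: subgroup B G by fact
  fix a assume "a \<in> A"
  show "a \<in> centralizer G B"
  proof (rule centralizerI)
    fix b assume "b \<in> B"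
    have "commutator G a b \<in> A \<inter> B"
      using \<open>a \<in> A\<close> \<open>b \<in> B\<close> assms commutator_mem_left commutator_mem_right by (metis IntI subsetD)
    then show "a \<otimes> b = b \<otimes> a"
      using \<open>a \<in> A\<close> \<open>b \<in> B\<close> assms(5) by (simp add: commutator_eq_one_iff)
  qed (use \<open>a \<in> A\<close> in simp)
qed

lemma commutator_mem_derived: "x \<in> H \<Longrightarrow> y \<in> H \<Longrightarrow> commutator G x y \<in> derived G H"
  unfolding derived_def commutator_def by (rule generate.incl) blast

lemma derived_subsetI:
  assumes "subgroup R G" "\<And>x y. x \<in> H \<Longrightarrow> y \<in> H \<Longrightarrow> commutator G x y \<in> R"
  shows "derived G H \<subseteq> R"
  unfolding derived_def
  by (rule generate_subgroup_incl[OF _ assms(1)]) (use assms(2) in \<open>auto simp: commutator_def\<close>)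

lemma subgroup_derived: "subgroup H G \<Longrightarrow> subgroup (derived G H) G"
  by (simp add: derived_is_subgroup subgroup.subset)

lemma derived_subset: "subgroup H G \<Longrightarrow> derived G H \<subseteq> H"
  by (simp add: derived_incl)

end

section \<open>Fixed points of \<open>p\<close>-groups\<close>

lemma (in group) group_actionI:
  assumes closed: "\<And>g x. g \<in> carrier G \<Longrightarrow> x \<in> E \<Longrightarrow> f g x \<in> E"
    and one: "\<And>x. x \<in> E \<Longrightarrow> f \<one> x = x"
    and mult: "\<And>g h x. g \<in> carrier G \<Longrightarrow> h \<in> carrier G \<Longrightarrow> x \<in> E \<Longrightarrow> f (g \<otimes> h) x = f g (f h x)"
  shows "group_action G E (\<lambda>g. restrict (f g) E)"
proof (intro group_action.intro group_hom.intro group_hom_axioms.intro homI)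
  have bij: "restrict (f g) E \<in> Bij E" if "g \<in> carrier G" for g
  proof -
    have "f (inv g) (f g x) = x" "f g (f (inv g) x) = x" if "x \<in> E" for x
      using \<open>g \<in> carrier G\<close> that one mult[of "inv g" g x] mult[of g "inv g" x] by auto
    then have "bij_betw (f g) E E"
      using that closed by (intro bij_betw_byWitness[where f' = "f (inv g)"]) auto
    then show ?thesis by (simp add: Bij_def)
  qed
  then show "restrict (f g) E \<in> carrier (BijGroup E)" if "g \<in> carrier G" for g
    using that by (simp add: BijGroup_def)
  show "restrict (f (g \<otimes> h)) E = restrict (f g) E \<otimes>\<^bsub>BijGroup E\<^esub> restrict (f h) E"
    if "g \<in> carrier G" "h \<in> carrier G" for g h
    using that bij closed mult by (auto simp: BijGroup_def compose_def fun_eq_iff)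
qed (auto simp: group_BijGroup)

lemma (in group_action) card_mod_eq_card_fixed_points_mod:
  fixes p k :: nat
  assumes p: "Factorial_Ring.prime p" and order: "order G = p ^ k" and finite: "finite E"
  shows "card E mod p = card {x \<in> E. \<forall>g \<in> carrier G. \<phi> g x = x} mod p"
proof -
  let ?orbits = "orbits G E \<phi>" and ?fixed = "{x \<in> E. \<forall>g \<in> carrier G. \<phi> g x = x}"
  have finite_orbits: "finite ?orbits"
    using orbits_coverture finite by (metis finite_UnionD)
  have card_orbit_mod: "card R mod p = (if card R = 1 then 1 else 0)" if orbit: "R \<in> ?orbits" for R
  proof -
    obtain x where "x \<in> E" "R = orbit G \<phi> x" using orbit by (auto simp: orbits_def)
    then have "card R dvd p ^ k" using orbit_stabilizer_theorem order by (metis dvd_triv_left)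
    then obtain i where "card R = p ^ i" using divides_primepow_nat[OF p] by blast
    then show ?thesis using prime_gt_1_nat[OF p] by (cases i) auto
  qed
  have orbit_eq_singleton_iff: "orbit G \<phi> x = {x} \<longleftrightarrow> x \<in> ?fixed" if "x \<in> E" for x
    using that orbit_refl[OF that] by (auto simp: orbit_def)
  have singleton_orbits: "{R \<in> ?orbits. card R = 1} = (\<lambda>x. {x}) ` ?fixed"
  proof (intro equalityI subsetI)
    fix R assume "R \<in> {R \<in> ?orbits. card R = 1}"
    then obtain x where "x \<in> E" "R = orbit G \<phi> x" "card R = 1" by (auto simp: orbits_def)
    moreover from this have "R = {x}" using orbit_refl by (metis card_1_singletonE singletonD)
    ultimately show "R \<in> (\<lambda>x. {x}) ` ?fixed" using orbit_eq_singleton_iff by blast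
  next
    fix R assume "R \<in> (\<lambda>x. {x}) ` ?fixed"
    then obtain x where "x \<in> ?fixed" "R = {x}" by blast
    moreover from this have "R = orbit G \<phi> x" using orbit_eq_singleton_iff by blast
    ultimately show "R \<in> {R \<in> ?orbits. card R = 1}" by (auto simp: orbits_def)
  qed
  have "card E mod p = (\<Sum>R \<in> ?orbits. card R mod p) mod p"
    using disjoint_sum[OF finite, of "\<lambda>_. 1 :: nat"] by (simp add: mod_sum_eq)
  also have "(\<Sum>R \<in> ?orbits. card R mod p) = card {R \<in> ?orbits. card R = 1}"
    using finite_orbits by (simp add: card_orbit_mod sum.If_cases Int_def)
  also have "\<dots> = card ?fixed"
    unfolding singleton_orbits by (simp add: card_image)
  finally show ?thesis .
qed

definition p_subgroup :: "('a, 'b) monoid_scheme \<Rightarrow> nat \<Rightarrow> 'a set \<Rightarrow> bool" where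
  "p_subgroup G p P \<longleftrightarrow> subgroup P G \<and> (\<exists>k. card P = p ^ k)"

context group
begin

lemma p_subgroup_imp_subgroup: "p_subgroup G p P \<Longrightarrow> subgroup P G"
  by (simp add: p_subgroup_def)

lemma l_coset_eq_iff:
  assumes "subgroup H G" "x \<in> carrier G" "y \<in> carrier G"
  shows "x <# H = y <# H \<longleftrightarrow> inv x \<otimes> y \<in> H"
proof
  interpret H: subgroup H G by fact
  assume "x <# H = y <# H"
  then have "y \<in> x <# H" using assms by (simp add: lcos_self)
  then show "inv x \<otimes> y \<in> H" using assms by (auto simp: l_coset_def)
next
  assume "inv x \<otimes> y \<in> H"
  moreover have "y = x \<otimes> (inv x \<otimes> y)" using assms by simp
  ultimately have "y \<in> x <# H" unfolding l_coset_def by blast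
  then show "x <# H = y <# H" using assms l_repr_independence by blast
qed

abbreviation l_cosets_from :: "'a set \<Rightarrow> 'a set \<Rightarrow> 'a set set" where
  "l_cosets_from S N \<equiv> (\<lambda>s. s <# N) ` S"

end

context finite_group
begin

lemma p_subgroup_subset:
  assumes "p_subgroup G p P" "subgroup Q G" "Q \<subseteq> P" "Factorial_Ring.prime p"
  shows "p_subgroup G p Q"
proof -
  obtain k where "card P = p ^ k" using assms(1) by (auto simp: p_subgroup_def)
  then have "card Q dvd p ^ k" using card_subgroup_dvd assms p_subgroup_imp_subgroup by metis
  then show ?thesis using assms divides_primepow_nat by (auto simp: p_subgroup_def)
qed

lemma p_subgroup_card_mod_eq_card_fixed_mod:
  assumes P: "p_subgroup G p P" and p: "Factorial_Ring.prime p" and finite: "finite E"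
    and closed: "\<And>g x. g \<in> P \<Longrightarrow> x \<in> E \<Longrightarrow> f g x \<in> E"
    and one: "\<And>x. x \<in> E \<Longrightarrow> f \<one> x = x"
    and mult: "\<And>g h x. g \<in> P \<Longrightarrow> h \<in> P \<Longrightarrow> x \<in> E \<Longrightarrow> f (g \<otimes> h) x = f g (f h x)"
  shows "card E mod p = card {x \<in> E. \<forall>g \<in> P. f g x = x} mod p"
proof -
  let ?P = "G\<lparr>carrier := P\<rparr>"
  obtain k where "card P = p ^ k" using P by (auto simp: p_subgroup_def)
  interpret P: group ?P using subgroup_imp_group P p_subgroup_imp_subgroup by blast
  interpret group_action ?P E "\<lambda>g. restrict (f g) E"
    using closed one mult by (intro P.group_actionI) auto
  have "card E mod p = card {x \<in> E. \<forall>g \<in> P. restrict (f g) E x = x} mod p"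
    using card_mod_eq_card_fixed_points_mod[OF p _ finite] \<open>card P = p ^ k\<close> by (simp add: order_def)
  then show ?thesis by (simp cong: conj_cong)
qed

lemma card_l_cosets:
  assumes N: "subgroup N G" and W: "subgroup W G"
  shows "card (l_cosets_from W N) * card (W \<inter> N) = card W"
proof -
  interpret N: subgroup N G by fact
  interpret W: subgroup W G by fact
  interpret group_W: group "G\<lparr>carrier := W\<rparr>" using W subgroup_imp_group by blast
  have trace: "W \<inter> (w <# N) = w <# (W \<inter> N)" if "w \<in> W" for w
  proof -
    have "n \<in> W" if "n \<in> N" "w \<otimes> n \<in> W" for n
      using that \<open>w \<in> W\<close> W.m_closed[of "inv w" "w \<otimes> n"] by simp
    then show ?thesis using \<open>w \<in> W\<close> by (auto simp: l_coset_def)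
  qed
  have "inj_on ((\<inter>) W) (l_cosets_from W N)"
  proof (rule inj_onI)
    fix U V assume "U \<in> l_cosets_from W N" "V \<in> l_cosets_from W N" "W \<inter> U = W \<inter> V"
    then obtain x y where "x \<in> W" "U = x <# N" "y \<in> W" "V = y <# N" by blast
    moreover from this have "x \<in> y <# N" using \<open>W \<inter> U = W \<inter> V\<close> lcos_self[OF _ N, of x] by auto
    ultimately show "U = V" using l_repr_independence[OF _ _ N, of x y] by simp
  qed
  then have "card (l_cosets_from W N) = card (l_cosets_from W (W \<inter> N))"
    by (simp add: card_image[symmetric] image_image trace)
  also have "l_cosets_from W (W \<inter> N) = lcosets\<^bsub>G\<lparr>carrier := W\<rparr>\<^esub> (W \<inter> N)"
    by (auto simp: LCOSETS_def)
  finally show ?thesis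
    using group_W.l_lagrange[of "W \<inter> N"] subgroup_incl[OF subgroups_Inter_pair[OF W N] W]
    by (simp add: finite_subgroup[OF W] order_def)
qed

lemma card_fixed_l_cosets_mod:
  assumes P: "p_subgroup G p P" and p: "Factorial_Ring.prime p" and N: "subgroup N G"
    and S: "S \<subseteq> carrier G"
    and closed: "\<And>g s. g \<in> P \<Longrightarrow> s \<in> S \<Longrightarrow> (g \<otimes> s) <# N \<in> l_cosets_from S N"
  shows "card (l_cosets_from S N) mod p = card (l_cosets_from {s \<in> S. P \<subseteq> conj_by G s ` N} N) mod p"
proof -
  let ?cosets = "l_cosets_from S N"
  interpret P: subgroup P G using P by (rule p_subgroup_imp_subgroup)
  interpret N: subgroup N G by fact
  have translate: "g <# (s <# N) = (g \<otimes> s) <# N" if "g \<in> carrier G" "s \<in> S" for g s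
    using that S by (simp add: lcos_m_assoc N.subset subset_iff)
  have "card ?cosets mod p = card {U \<in> ?cosets. \<forall>g \<in> P. g <# U = U} mod p"
  proof (rule p_subgroup_card_mod_eq_card_fixed_mod[OF P p])
    show "finite ?cosets" using S finite_carrier finite_subset by blast
    show "g <# U \<in> ?cosets" if "g \<in> P" "U \<in> ?cosets" for g U
      using that closed translate by auto
    show "\<one> <# U = U" if "U \<in> ?cosets" for U
      using that translate S by auto
    show "(g \<otimes> h) <# U = g <# (h <# U)" if "g \<in> P" "h \<in> P" "U \<in> ?cosets" for g h U
    proof -
      have "U \<subseteq> carrier G" using that S by (auto simp: l_coset_def)
      then show ?thesis using that by (simp add: lcos_m_assoc)
    qed
  qed
  also have "{U \<in> ?cosets. \<forall>g \<in> P. g <# U = U} = l_cosets_from {s \<in> S. P \<subseteq> conj_by G s ` N} N"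
  proof -
    have fixed_iff: "g <# (s <# N) = s <# N \<longleftrightarrow> g \<in> conj_by G s ` N" if "g \<in> P" "s \<in> S" for g s
    proof -
      have s: "s \<in> carrier G" using \<open>s \<in> S\<close> S by blast
      have "g <# (s <# N) = s <# N \<longleftrightarrow> inv s \<otimes> (g \<otimes> s) \<in> N"
        using that s l_coset_eq_iff[OF N s, of "g \<otimes> s"] by (auto simp: translate)
      also have "inv s \<otimes> (g \<otimes> s) = conj_by G (inv s) g"
        using that s by (simp add: conj_by_def m_assoc)
      finally show ?thesis using that s by (simp add: mem_conj_by_image_iff N.subset)
    qed
    have "(\<forall>g \<in> P. g <# (s <# N) = s <# N) \<longleftrightarrow> P \<subseteq> conj_by G s ` N" if "s \<in> S" for s
      using that by (simp add: fixed_iff subset_eq)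
    then show ?thesis by (simp add: Compr_image_eq cong: conj_cong)
  qed
  finally show ?thesis .
qed

lemma p_subgroup_subset_conjugate:
  assumes "p_subgroup G p P" "Factorial_Ring.prime p" "subgroup N G" "S \<subseteq> carrier G"
    and "\<And>g s. g \<in> P \<Longrightarrow> s \<in> S \<Longrightarrow> (g \<otimes> s) <# N \<in> l_cosets_from S N"
    and "\<not> p dvd card (l_cosets_from S N)"
  shows "\<exists>s \<in> S. P \<subseteq> conj_by G s ` N"
proof (rule ccontr)
  assume "\<not> ?thesis"
  then have "{s \<in> S. P \<subseteq> conj_by G s ` N} = {}" by simp
  then show False
    using card_fixed_l_cosets_mod[OF assms(1-5)] assms(6)
    by (simp only: image_empty card.empty mod_0 dvd_eq_mod_eq_0)
qed

lemma p_subgroup_normalizer_grows: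
  assumes P: "p_subgroup G p P" and p: "Factorial_Ring.prime p" and Q: "subgroup Q G" "Q \<subset> P"
  obtains g where "g \<in> P" "g \<notin> Q" "g \<in> normalizer G Q"
proof -
  interpret P: subgroup P G using P by (rule p_subgroup_imp_subgroup)
  interpret Q: subgroup Q G by fact
  let ?fixed = "l_cosets_from {s \<in> P. Q \<subseteq> conj_by G s ` Q} Q"
  have index: "card (l_cosets_from P Q) * card Q = card P"
    using card_l_cosets[OF Q(1) P.subgroup_axioms] Q(2)
    by (simp add: inf.absorb2 psubset_imp_subset)
  obtain k where "card P = p ^ k" using P by (auto simp: p_subgroup_def)
  then obtain i where i: "card (l_cosets_from P Q) = p ^ i"
    using index divides_primepow_nat[OF p] by (metis dvd_triv_left)
  have "card Q < card P" using psubset_card_mono Q(2) finite_subgroup P.subgroup_axioms by blast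
  then have "i \<noteq> 0" using index i by (cases i) auto
  then have "p dvd card (l_cosets_from P Q)" using i by simp
  moreover have "card (l_cosets_from P Q) mod p = card ?fixed mod p"
    using Q P.m_closed
    by (intro card_fixed_l_cosets_mod[OF p_subgroup_subset[OF P Q(1) _ p] p Q(1) P.subset]) auto
  ultimately have "p dvd card ?fixed" by (simp add: dvd_eq_mod_eq_0)
  then have "?fixed \<noteq> {Q}" using prime_gt_1_nat[OF p] by auto
  moreover have "Q \<in> ?fixed"
    using Q.subset by (intro image_eqI[of _ _ \<one>]) (auto simp: lcos_mult_one mem_conj_by_image_iff)
  ultimately obtain s where s: "s \<in> P" "Q \<subseteq> conj_by G s ` Q" "s <# Q \<noteq> Q" by blast
  have "conj_by G s ` Q = Q"
    using s by (intro card_subset_eq[symmetric])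
      (auto simp: card_conj_by_image Q.subset finite_subgroup[OF Q(1)])
  moreover have "s \<notin> Q" using s coset_join3[OF _ Q(1)] by auto
  ultimately show thesis using that s(1) by (simp add: mem_normalizer_iff Q.subset)
qed

end

section \<open>Sylow subgroups\<close>

definition sylow_subgroup :: "('a, 'b) monoid_scheme \<Rightarrow> nat \<Rightarrow> 'a set \<Rightarrow> 'a set \<Rightarrow> bool" where
  "sylow_subgroup G p P S \<longleftrightarrow> p_subgroup G p P \<and> P \<subseteq> S \<and> \<not> p dvd card S div card P"

context group
begin

lemma sylow_subgroupD:
  assumes "sylow_subgroup G p P S"
  shows "subgroup P G" "p_subgroup G p P" "P \<subseteq> S"
  using assms by (simp_all add: sylow_subgroup_def p_subgroup_def)

lemma sylow_subgroup_nontrivial: "sylow_subgroup G p P S \<Longrightarrow> p dvd card S \<Longrightarrow> P \<noteq> {\<one>}"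
  by (auto simp: sylow_subgroup_def)

end

context finite_group
begin

lemma sylow_subgroup_exists:
  assumes S: "subgroup S G" and p: "Factorial_Ring.prime p"
  obtains P where "sylow_subgroup G p P S"
proof -
  let ?n = "multiplicity p (card S)"
  have "card S \<noteq> 0" using card_subgroup_pos[OF S] by simp
  moreover have "\<not> is_unit p" using p by auto
  ultimately obtain m where m: "card S = p ^ ?n * m" "\<not> p dvd m"
    using multiplicity_decompose'[of "card S" p] by blast
  interpret S: group "G\<lparr>carrier := S\<rparr>" using S subgroup_imp_group by blast
  obtain P where P: "subgroup P (G\<lparr>carrier := S\<rparr>)" "card P = p ^ ?n"
    using sylow_thm[OF p S.is_group, of ?n m] m finite_subgroup[OF S] by (auto simp: order_def)
  have "subgroup P G" using incl_subgroup[OF S P(1)] .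
  moreover have "card S = card P * m" using m(1) P(2) by metis
  moreover from this have "card S div card P = m"
    using card_subgroup_pos[OF \<open>subgroup P G\<close>] by (metis less_not_refl nonzero_mult_div_cancel_left)
  ultimately have "sylow_subgroup G p P S"
    using P m(2) subgroup.subset[OF P(1)] by (auto simp: sylow_subgroup_def p_subgroup_def)
  then show thesis by (rule that)
qed

lemma p_subgroup_subset_sylow_conjugate:
  assumes P: "sylow_subgroup G p P S" and Q: "p_subgroup G p Q" "Q \<subseteq> S" and S: "subgroup S G"
    and p: "Factorial_Ring.prime p"
  shows "\<exists>s \<in> S. Q \<subseteq> conj_by G s ` P"
proof (rule p_subgroup_subset_conjugate[OF Q(1) p])
  interpret S: subgroup S G by fact
  show "subgroup P G" using P by (rule sylow_subgroupD)
  show "S \<subseteq> carrier G" by (rule S.subset)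
  show "(g \<otimes> s) <# P \<in> l_cosets_from S P" if "g \<in> Q" "s \<in> S" for g s using that Q(2) by blast
  have "card (l_cosets_from S P) * card P = card S"
    using card_l_cosets[OF \<open>subgroup P G\<close> S] sylow_subgroupD[OF P] by (simp add: inf.absorb2)
  then have "card (l_cosets_from S P) = card S div card P"
    using card_subgroup_pos[OF \<open>subgroup P G\<close>]
    by (metis less_not_refl nonzero_mult_div_cancel_right)
  then show "\<not> p dvd card (l_cosets_from S P)" using P by (simp add: sylow_subgroup_def)
qed

lemma card_p_subgroup_le_sylow:
  assumes "sylow_subgroup G p P S" "p_subgroup G p Q" "Q \<subseteq> S" "subgroup S G"
    "Factorial_Ring.prime p"
  shows "card Q \<le> card P"
proof -
  obtain s where s: "s \<in> S" "Q \<subseteq> conj_by G s ` P"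
    using p_subgroup_subset_sylow_conjugate[OF assms] by blast
  have P: "subgroup P G" using assms(1) by (rule sylow_subgroupD)
  have "card Q \<le> card (conj_by G s ` P)" using s(2) finite_subgroup[OF P] by (simp add: card_mono)
  also have "\<dots> = card P"
    using card_conj_by_image[OF subgroup.subset[OF P]] subgroup.mem_carrier[OF assms(4) s(1)] .
  finally show ?thesis .
qed

lemma sylow_subgroup_conj_by_image:
  assumes P: "sylow_subgroup G p P S" and S: "subgroup S G" and g: "g \<in> normalizer G S"
  shows "sylow_subgroup G p (conj_by G g ` P) S"
proof -
  have "g \<in> carrier G" using g normalizer_subset by blast
  moreover have "conj_by G g ` P \<subseteq> S" using normalizerD[OF S g] sylow_subgroupD(3)[OF P] by blast
  ultimately show ?thesis
    using P sylow_subgroupD(1)[OF P] subgroup.subset[OF sylow_subgroupD(1)[OF P]]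
    by (simp add: sylow_subgroup_def p_subgroup_def subgroup_conj_by_image card_conj_by_image)
qed

lemma sylow_subgroups_conjugate:
  assumes P: "sylow_subgroup G p P S" and Q: "sylow_subgroup G p Q S" and S: "subgroup S G"
    and p: "Factorial_Ring.prime p"
  obtains s where "s \<in> S" "Q = conj_by G s ` P"
proof -
  note subgroup_P = sylow_subgroupD(1)[OF P]
  obtain s where s: "s \<in> S" "Q \<subseteq> conj_by G s ` P"
    using p_subgroup_subset_sylow_conjugate[OF P sylow_subgroupD(2,3)[OF Q] S p] by blast
  have "card P \<le> card Q" using card_p_subgroup_le_sylow[OF Q sylow_subgroupD(2,3)[OF P] S p] .
  then have "card (conj_by G s ` P) \<le> card Q"
    using card_conj_by_image[OF subgroup.subset[OF subgroup_P]] subgroup.mem_carrier[OF S s(1)]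
    by simp
  then have "Q = conj_by G s ` P"
    using s(2) finite_subgroup[OF subgroup_P] by (simp add: card_seteq)
  then show thesis using that s(1) by simp
qed

lemma sylow_subgroup_intermediate:
  assumes P: "sylow_subgroup G p P S" and S: "subgroup S G" and L: "subgroup L G" "P \<subseteq> L" "L \<subseteq> S"
  shows "sylow_subgroup G p P L"
proof -
  obtain i where i: "card L = card P * i"
    using card_subgroup_dvd[OF sylow_subgroupD(1)[OF P] L(1,2)] by blast
  obtain j where j: "card S = card L * j" using card_subgroup_dvd[OF L(1) S L(3)] by blast
  have "card P > 0" using card_subgroup_pos[OF sylow_subgroupD(1)[OF P]] .
  then have "card S div card P = i * j" "card L div card P = i" using i j by auto
  then show ?thesis using P L(2) by (auto simp: sylow_subgroup_def)
qed

lemma sylow_subgroup_inter_normal: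
  assumes P: "sylow_subgroup G p P L" and L: "subgroup L G"
    and W: "subgroup W G" "W \<subseteq> L" "L \<subseteq> normalizer G W" and p: "Factorial_Ring.prime p"
  shows "sylow_subgroup G p (W \<inter> P) W"
proof -
  interpret L: subgroup L G by fact
  note subgroup_P = sylow_subgroupD(1)[OF P]
  have subgroup_inter: "subgroup (W \<inter> P) G" using W(1) subgroup_P by (rule subgroups_Inter_pair)
  obtain Q where Q: "sylow_subgroup G p Q W" using sylow_subgroup_exists[OF W(1) p] .
  obtain l where l: "l \<in> L" "Q \<subseteq> conj_by G l ` P"
    using p_subgroup_subset_sylow_conjugate[OF P sylow_subgroupD(2)[OF Q] _ L p]
      sylow_subgroupD(3)[OF Q] W(2)
    by blast
  let ?Q = "conj_by G (inv l) ` Q"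
  have sylow: "sylow_subgroup G p ?Q W"
    using sylow_subgroup_conj_by_image[OF Q W(1)] l(1) W(3) by auto
  have "?Q \<subseteq> conj_by G (inv l) ` conj_by G l ` P" using l(2) by (rule image_mono)
  also have "\<dots> = P"
    using l(1) subgroup.subset[OF subgroup_P] by (simp add: conj_by_image_conj_by_image)
  finally have "?Q \<subseteq> W \<inter> P" using sylow_subgroupD(3)[OF sylow] by simp
  moreover have "card (W \<inter> P) \<le> card ?Q"
    using card_p_subgroup_le_sylow[OF sylow
      p_subgroup_subset[OF sylow_subgroupD(2)[OF P] subgroup_inter _ p] _ W(1) p]
    by simp
  ultimately have "?Q = W \<inter> P" using finite_subgroup[OF subgroup_inter] by (simp add: card_seteq)
  then show ?thesis using sylow by simp
qed

lemma card_sylow_subgroup: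
  assumes P: "sylow_subgroup G p P S" and S: "subgroup S G" and p: "Factorial_Ring.prime p"
  shows "card P = p ^ multiplicity p (card S)"
proof -
  obtain k where k: "card P = p ^ k" using sylow_subgroupD(2)[OF P] by (auto simp: p_subgroup_def)
  have "card S = p ^ k * (card S div card P)"
    using card_subgroup_dvd[OF _ S] sylow_subgroupD[OF P] k by (metis dvd_mult_div_cancel)
  moreover have "\<not> p dvd card S div card P" using P by (simp add: sylow_subgroup_def)
  ultimately have "multiplicity p (card S) = k" using p by (intro multiplicity_decomposeI) auto
  then show ?thesis using k by simp
qed

lemma subgroup_eq_if_contains_sylows:
  assumes S: "subgroup S G" and T: "subgroup T G" "T \<subseteq> S"
    and sylow: "\<And>r. Factorial_Ring.prime r \<Longrightarrow> r dvd card S \<Longrightarrow> \<exists>R. sylow_subgroup G r R S \<and> R \<subseteq> T"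
  shows "T = S"
proof (rule subgroup_eqI[OF T(1) S T(2)], rule multiplicity_le_imp_dvd)
  show "card S \<noteq> 0" using card_subgroup_pos[OF S] by simp
  fix r :: nat assume r: "Factorial_Ring.prime r"
  show "multiplicity r (card S) \<le> multiplicity r (card T)"
  proof (cases "r dvd card S")
    case True
    then obtain R where R: "sylow_subgroup G r R S" "R \<subseteq> T" using sylow[OF r] by blast
    then have "r ^ multiplicity r (card S) dvd card T"
      using card_sylow_subgroup[OF R(1) S r] card_subgroup_dvd[OF sylow_subgroupD(1)[OF R(1)] T(1)]
      by simp
    then show ?thesis using r card_subgroup_pos[OF T(1)] by (intro multiplicity_geI) auto
  qed (simp add: not_dvd_imp_multiplicity_0)
qed

lemma frattini_argument:
  assumes K: "subgroup K G" and P: "sylow_subgroup G p P K" and p: "Factorial_Ring.prime p"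
  shows "normalizer G K \<subseteq> K <#> normalizer G P"
proof
  interpret K: subgroup K G by fact
  interpret P: subgroup P G using P by (rule sylow_subgroupD)
  fix g assume g: "g \<in> normalizer G K"
  then have g_carrier: "g \<in> carrier G" using normalizer_subset by blast
  obtain k where k: "k \<in> K" "conj_by G g ` P = conj_by G k ` P"
    using sylow_subgroups_conjugate[OF P sylow_subgroup_conj_by_image[OF P K g] K p] .
  have "conj_by G (inv k \<otimes> g) ` P = conj_by G (inv k) ` conj_by G g ` P"
    using k(1) g_carrier P.subset by (simp add: conj_by_image_conj_by_image)
  also have "\<dots> = P"
    unfolding k(2) using k(1) P.subset by (simp add: conj_by_image_conj_by_image)
  finally have "inv k \<otimes> g \<in> normalizer G P"
    using k(1) g_carrier P.subset by (simp add: mem_normalizer_iff)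
  then have "k \<otimes> (inv k \<otimes> g) \<in> K <#> normalizer G P" using k(1) by (intro set_multI)
  then show "g \<in> K <#> normalizer G P" using k(1) g_carrier by simp
qed

text \<open>By the Frattini argument, \<open>P\<close> permutes the cosets of the normalizer of \<open>Q\<close> that meet \<open>W\<close>.\<close>
lemma sylow_subgroup_invariant_exists:
  assumes P: "p_subgroup G p P" "P \<subseteq> normalizer G W" and p: "Factorial_Ring.prime p"
    and W: "subgroup W G" and Q: "sylow_subgroup G q Q W" and q: "Factorial_Ring.prime q"
    and index: "\<not> p dvd card W div card (W \<inter> normalizer G Q)"
  obtains R where "sylow_subgroup G q R W" "P \<subseteq> normalizer G R"
proof -
  interpret W: subgroup W G by fact
  let ?N = "normalizer G Q"
  note subgroup_Q = sylow_subgroupD(1)[OF Q]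
  note subgroup_N = subgroup_normalizer[OF subgroup_Q]
  have "\<exists>w \<in> W. P \<subseteq> conj_by G w ` ?N"
  proof (rule p_subgroup_subset_conjugate[OF P(1) p subgroup_N W.subset])
    fix g w assume "g \<in> P" "w \<in> W"
    then have "g \<otimes> w \<in> normalizer G W"
      using P(2) subgroup_subset_normalizer[OF W] subgroup.m_closed[OF subgroup_normalizer[OF W]]
      by blast
    then obtain v n where "v \<in> W" "n \<in> ?N" "g \<otimes> w = v \<otimes> n"
      using frattini_argument[OF W Q q] set_multE by blast
    then have "(g \<otimes> w) <# ?N = v <# ?N"
      using coset_join3[OF _ subgroup_N] subgroup.mem_carrier[OF subgroup_N]
      by (metis W.mem_carrier lcos_m_assoc normalizer_subset)
    then show "(g \<otimes> w) <# ?N \<in> l_cosets_from W ?N" using \<open>v \<in> W\<close> by blast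
  next
    have "card (l_cosets_from W ?N) = card W div card (W \<inter> ?N)"
      using card_l_cosets[OF subgroup_N W]
        card_subgroup_pos[OF subgroups_Inter_pair[OF W subgroup_N]]
      by (metis less_not_refl nonzero_mult_div_cancel_right)
    then show "\<not> p dvd card (l_cosets_from W ?N)" using index by simp
  qed
  then obtain w where w: "w \<in> W" "P \<subseteq> conj_by G w ` ?N" by blast
  have "P \<subseteq> normalizer G (conj_by G w ` Q)"
    using w conj_by_image_normalizer_subset[OF subgroup_Q W.mem_carrier] by blast
  moreover have "sylow_subgroup G q (conj_by G w ` Q) W"
    using sylow_subgroup_conj_by_image[OF Q W] w(1) subgroup_subset_normalizer[OF W] by blast
  ultimately show thesis using that by blast
qed

lemma sylow_subgroup_invariant_exists_coprime:
  assumes P: "p_subgroup G p P" "P \<subseteq> normalizer G W" and p: "Factorial_Ring.prime p"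
    and W: "subgroup W G" "\<not> p dvd card W" and q: "Factorial_Ring.prime q"
  obtains R where "sylow_subgroup G q R W" "P \<subseteq> normalizer G R"
proof -
  obtain Q where Q: "sylow_subgroup G q Q W" using sylow_subgroup_exists[OF W(1) q] .
  have subgroup_inter: "subgroup (W \<inter> normalizer G Q) G"
    using W(1) subgroup_normalizer[OF sylow_subgroupD(1)[OF Q]] by (rule subgroups_Inter_pair)
  have "card W div card (W \<inter> normalizer G Q) dvd card W"
    using index_dvd_index[OF triv_subgroup subgroup_inter W(1)]
      subgroup.one_closed[OF subgroup_inter] by simp
  then have "\<not> p dvd card W div card (W \<inter> normalizer G Q)" using W(2) by (metis dvd_trans)
  then show thesis using sylow_subgroup_invariant_exists[OF P p W(1) Q q] that by blast
qed

end

section \<open>Perfect and solvable subgroups\<close>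

definition perfect_subgroup :: "('a, 'b) monoid_scheme \<Rightarrow> 'a set \<Rightarrow> bool" where
  "perfect_subgroup G W \<longleftrightarrow> subgroup W G \<and> derived G W = W"

context group
begin

lemma perfect_subgroupD: "perfect_subgroup G W \<Longrightarrow> subgroup W G"
  by (simp add: perfect_subgroup_def)

lemma perfect_subgroup_subset:
  assumes "perfect_subgroup G W" "subgroup R G" "\<And>x y. x \<in> W \<Longrightarrow> y \<in> W \<Longrightarrow> commutator G x y \<in> R"
  shows "W \<subseteq> R"
  using assms derived_subsetI[OF assms(2)] by (metis perfect_subgroup_def)

lemma exp_of_derived_subset: "subgroup S G \<Longrightarrow> (derived G ^^ n) S \<subseteq> S"
proof (induction n)
  case (Suc n)
  then show ?case using derived_subset[OF exp_of_derived_is_subgroup, of S n] by auto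
qed simp

lemma normalizer_subset_normalizer_exp_of_derived:
  assumes "subgroup S G"
  shows "normalizer G S \<subseteq> normalizer G ((derived G ^^ n) S)"
proof
  fix g assume g: "g \<in> normalizer G S"
  then have "g \<in> carrier G" using normalizer_subset by blast
  interpret conj: group_hom G G "conj_by G g" using \<open>g \<in> carrier G\<close> by (rule group_hom_conj_by)
  have "conj_by G g ` (derived G ^^ n) S = (derived G ^^ n) S"
    using conj.exp_of_derived_img[OF subgroup.subset[OF assms], of n]
      normalizer_image_eq[OF assms g] by simp
  then show "g \<in> normalizer G ((derived G ^^ n) S)"
    using \<open>g \<in> carrier G\<close> assms
    by (simp add: mem_normalizer_iff exp_of_derived_in_carrier subgroup.subset)
qed

lemma derived_set_mult_subset:
  assumes S: "subgroup S G" and E: "subgroup E G" and SE: "S \<subseteq> normalizer G E"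
  shows "derived G (S <#> E) \<subseteq> derived G S <#> E"
proof (rule derived_subsetI)
  interpret S: subgroup S G by fact
  interpret E: subgroup E G by fact
  have derived_S: "subgroup (derived G S) G" using S by (rule subgroup_derived)
  have "derived G S \<subseteq> normalizer G E" using derived_subset[OF S] SE by blast
  then show product: "subgroup (derived G S <#> E) G"
    using subgroup_set_mult[OF derived_S E] by blast
  have E_subset: "E \<subseteq> derived G S <#> E" using subset_set_mult_right[OF derived_S E] .
  have product_normalizes: "S <#> E \<subseteq> normalizer G E"
    using set_mult_least[OF subgroup_normalizer[OF E] SE subgroup_subset_normalizer[OF E]] .
  fix x y assume "x \<in> S <#> E" "y \<in> S <#> E"
  then obtain s e t f where x: "s \<in> S" "e \<in> E" "x = s \<otimes> e" and y: "t \<in> S" "f \<in> E" "y = t \<otimes> f"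
    by (metis set_multE)
  have "commutator G x y = conj_by G s (commutator G e y) \<otimes> commutator G s y"
    using x y by (simp add: commutator_mult_left)
  also have "commutator G s y = commutator G s t \<otimes> conj_by G t (commutator G s f)"
    using x y by (simp add: commutator_mult_right)
  finally have "commutator G x y = conj_by G s (commutator G e y) \<otimes>
      (commutator G s t \<otimes> conj_by G t (commutator G s f))" .
  moreover have "conj_by G s (commutator G e y) \<in> E"
    using x commutator_mem_left[OF E] \<open>y \<in> S <#> E\<close> product_normalizes normalizerD[OF E] SE by blast
  moreover have "commutator G s t \<otimes> conj_by G t (commutator G s f) \<in> derived G S <#> E"
    using x y commutator_mem_derived commutator_mem_right[OF E subsetD[OF SE]]
      normalizerD[OF E subsetD[OF SE]]
    by (simp add: set_multI)
  ultimately show "commutator G x y \<in> derived G S <#> E"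
    using E_subset subgroup.m_closed[OF product] by auto
qed

lemma perfect_subset_if_solvable_mod:
  assumes W: "perfect_subgroup G W" and S: "solvable_seq G S" and E: "subgroup E G"
    and SE: "S \<subseteq> normalizer G E" and W_subset: "W \<subseteq> S <#> E"
  shows "W \<subseteq> E"
proof -
  have subgroup_S: "subgroup S G" using S by (rule solvable_imp_subgroup)
  have "W \<subseteq> (derived G ^^ n) S <#> E" for n
  proof (induction n)
    case (Suc n)
    let ?T = "(derived G ^^ n) S"
    have T: "subgroup ?T G" "?T \<subseteq> normalizer G E"
      using exp_of_derived_is_subgroup[OF subgroup_S] exp_of_derived_subset[OF subgroup_S] SE
      by blast+
    have "W = derived G W" using W by (simp add: perfect_subgroup_def)
    also have "\<dots> \<subseteq> derived G (?T <#> E)"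
      using Suc subgroup.subset[OF subgroup_set_mult[OF T(1) E T(2)]] by (intro mono_derived)
    also have "\<dots> \<subseteq> derived G ?T <#> E" using T(1) E T(2) by (rule derived_set_mult_subset)
    finally show ?case by simp
  qed (use W_subset in simp)
  moreover obtain n where "(derived G ^^ n) S = {\<one>}"
    using solvable_imp_trivial_derived_seq[OF S] by blast
  ultimately have "W \<subseteq> {\<one>} <#> E" by metis
  then show ?thesis using subgroup.mem_carrier[OF E] by (auto simp: set_mult_def)
qed

lemma perfect_subset_solvable_trivial:
  assumes "perfect_subgroup G W" "solvable_seq G S" "W \<subseteq> S"
  shows "W = {\<one>}"
proof -
  have subgroup_S: "subgroup S G" using assms(2) by (rule solvable_imp_subgroup)
  interpret S: subgroup S G by fact
  interpret W: subgroup W G using assms(1) by (rule perfect_subgroupD)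
  have "S \<subseteq> normalizer G {\<one>}" by (auto simp: mem_normalizer_iff)
  moreover have "S \<subseteq> S <#> {\<one>}" using subset_set_mult_left[OF subgroup_S triv_subgroup] .
  ultimately have "W \<subseteq> {\<one>}"
    using perfect_subset_if_solvable_mod[OF assms(1,2) triv_subgroup] assms(3) by blast
  then show ?thesis using W.one_closed by blast
qed

lemma abelian_imp_solvable:
  assumes "subgroup S G" "\<not> non_abelian S G"
  shows "solvable_seq G S"
proof (rule trivial_derived_seq_imp_solvable[OF assms(1)])
  have "derived G S \<subseteq> {\<one>}"
    using assms subgroup.mem_carrier[OF assms(1)]
    by (intro derived_subsetI) (auto simp: commutator_eq_one_iff non_abelian_def triv_subgroup)
  then show "(derived G ^^ 1) S = {\<one>}"
    using subgroup.one_closed[OF subgroup_derived[OF assms(1)]] by auto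
qed

lemma perfect_abelian_trivial:
  "perfect_subgroup G W \<Longrightarrow> \<not> non_abelian W G \<Longrightarrow> W = {\<one>}"
  using abelian_imp_solvable perfect_subset_solvable_trivial perfect_subgroupD by blast

lemma solvable_abelian_subgroup_exists:
  assumes S: "solvable_seq G S" "S \<noteq> {\<one>}"
  obtains A where "subgroup A G" "A \<subseteq> S" "A \<noteq> {\<one>}" "\<not> non_abelian A G"
    "normalizer G S \<subseteq> normalizer G A"
proof -
  have subgroup_S: "subgroup S G" using S(1) by (rule solvable_imp_subgroup)
  let ?trivial = "\<lambda>n. (derived G ^^ n) S = {\<one>}"
  obtain m where "?trivial m" using solvable_imp_trivial_derived_seq[OF S(1)] by blast
  moreover have "\<not> ?trivial 0" using S(2) by simp
  ultimately obtain n where n: "\<not> ?trivial n" "?trivial (Suc n)"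
    using ex_least_nat_less[of ?trivial m] by blast
  define A where "A = (derived G ^^ n) S"
  have A: "subgroup A G" unfolding A_def using subgroup_S by (rule exp_of_derived_is_subgroup)
  have "derived G A = {\<one>}" using n(2) by (simp add: A_def)
  then have "commutator G x y = \<one>" if "x \<in> A" "y \<in> A" for x y
    using commutator_mem_derived[OF that] by simp
  then have "\<not> non_abelian A G"
    using subgroup.mem_carrier[OF A] by (simp add: non_abelian_def commutator_eq_one_iff)
  then show thesis
    using that[OF A] exp_of_derived_subset[OF subgroup_S] n(1)
      normalizer_subset_normalizer_exp_of_derived[OF subgroup_S] by (simp add: A_def)
qed

end

definition maximal_subgroup :: "('a, 'b) monoid_scheme \<Rightarrow> 'a set \<Rightarrow> 'a set \<Rightarrow> bool" where
  "maximal_subgroup G T L \<longleftrightarrow> subgroup T G \<and> T \<subset> L \<and>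
    (\<forall>K. subgroup K G \<longrightarrow> T \<subseteq> K \<longrightarrow> K \<subseteq> L \<longrightarrow> K = T \<or> K = L)"

definition centralizer_mod :: "('a, 'b) monoid_scheme \<Rightarrow> 'a set \<Rightarrow> 'a set \<Rightarrow> 'a set \<Rightarrow> 'a set" where
  "centralizer_mod G W N S = {y \<in> W. \<forall>s \<in> S. commutator G s y \<in> N}"

context group
begin

lemma perfect_subset_normal_maximal_subgroup:
  assumes L: "subgroup L G" and T: "maximal_subgroup G T L" "L \<subseteq> normalizer G T"
    and W: "perfect_subgroup G W" "W \<subseteq> L"
  shows "W \<subseteq> T"
proof -
  interpret L: subgroup L G by fact
  have subgroup_T: "subgroup T G" and "T \<subset> L"
    using T(1) by (simp_all add: maximal_subgroup_def)
  then obtain l where l: "l \<in> L" "l \<notin> T" by blast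
  have cyc_l: "subgroup (cyc l) G" "cyc l \<subseteq> L" using l(1) subgroup_cyc cyc_subset[OF L] by auto
  have cyc_normalizes: "cyc l \<subseteq> normalizer G T" using cyc_l(2) T(2) by blast
  have "l \<in> cyc l <#> T" using subset_set_mult_left[OF cyc_l(1) subgroup_T] mem_cyc by blast
  moreover have "cyc l <#> T \<subseteq> L" using L cyc_l(2) \<open>T \<subset> L\<close> by (simp add: set_mult_least)
  ultimately have "cyc l <#> T = L"
    using T(1) l(2) subgroup_set_mult[OF cyc_l(1) subgroup_T cyc_normalizes]
      subset_set_mult_right[OF cyc_l(1) subgroup_T]
    unfolding maximal_subgroup_def by blast
  moreover have "solvable_seq G (cyc l)"
    using l(1) cyc_l(1) by (simp add: abelian_imp_solvable cyc_abelian)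
  ultimately show ?thesis
    using perfect_subset_if_solvable_mod[OF W(1) _ subgroup_T cyc_normalizes] W(2) by simp
qed

end

context finite_group
begin

lemma perfect_term_of_derived_series:
  assumes "subgroup S G"
  obtains n where "perfect_subgroup G ((derived G ^^ n) S)"
proof -
  have "\<exists>n. perfect_subgroup G ((derived G ^^ n) S)"
    using assms
  proof (induction "card S" arbitrary: S rule: less_induct)
    case less
    show ?case
    proof (cases "derived G S = S")
      case True
      then show ?thesis using less.prems by (intro exI[of _ 0]) (simp add: perfect_subgroup_def)
    next
      case False
      then have "card (derived G S) < card S"
        using derived_subset[OF less.prems] finite_subgroup[OF less.prems]
        by (simp add: psubset_card_mono psubsetI)
      then obtain n where "perfect_subgroup G ((derived G ^^ n) (derived G S))"
        using less.hyps subgroup_derived[OF less.prems] by blast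
      then show ?thesis by (intro exI[of _ "Suc n"]) (simp add: funpow_swap1)
    qed
  qed
  then show thesis using that by blast
qed

lemma solvable_or_perfect_subgroup:
  assumes S: "subgroup S G"
  obtains (solvable) "solvable_seq G S"
    | (perfect) W where "perfect_subgroup G W" "W \<subseteq> S" "W \<noteq> {\<one>}" "normalizer G S \<subseteq> normalizer G W"
proof -
  obtain n where "perfect_subgroup G ((derived G ^^ n) S)"
    using perfect_term_of_derived_series[OF S] .
  then show thesis
    using solvable[OF trivial_derived_seq_imp_solvable[OF S]]
      perfect[OF _ exp_of_derived_subset[OF S] _ normalizer_subset_normalizer_exp_of_derived[OF S]]
    by metis
qed

lemma maximal_subgroup_exists:
  assumes "subgroup S G" "S \<subset> L" "L \<subseteq> carrier G"
  obtains T where "maximal_subgroup G T L" "S \<subseteq> T"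
proof -
  obtain T where "subgroup T G \<and> T \<subset> L" "S \<subseteq> T"
      "\<forall>K. subgroup K G \<and> K \<subset> L \<longrightarrow> T \<subseteq> K \<longrightarrow> T = K"
    using maximal_subset_exists[of "\<lambda>T. subgroup T G \<and> T \<subset> L" S] assms by blast
  then have "maximal_subgroup G T L" unfolding maximal_subgroup_def by blast
  then show thesis using that \<open>S \<subseteq> T\<close> by blast
qed

lemma p_subgroup_solvable:
  assumes P: "p_subgroup G p P" and p: "Factorial_Ring.prime p"
  shows "solvable_seq G P"
proof (rule solvable_or_perfect_subgroup[OF p_subgroup_imp_subgroup[OF P]])
  fix W assume W: "perfect_subgroup G W" "W \<subseteq> P" "W \<noteq> {\<one>}"
  have subgroup_W: "subgroup W G" using W(1) by (rule perfect_subgroupD)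
  interpret W: subgroup W G by fact
  have "{\<one>} \<subset> W" using W(3) W.one_closed by blast
  then obtain T where T: "maximal_subgroup G T W"
    by (rule maximal_subgroup_exists[OF triv_subgroup _ W.subset])
  then have subgroup_T: "subgroup T G" and "T \<subset> W" by (simp_all add: maximal_subgroup_def)
  then obtain g where g: "g \<in> W" "g \<notin> T" "g \<in> normalizer G T"
    using p_subgroup_normalizer_grows[OF p_subgroup_subset[OF P subgroup_W W(2) p] p] by blast
  have "subgroup (normalizer G T \<inter> W) G"
    using subgroup_normalizer[OF subgroup_T] subgroup_W by (rule subgroups_Inter_pair)
  then have "normalizer G T \<inter> W = W"
    using T g \<open>T \<subset> W\<close> subgroup_subset_normalizer[OF subgroup_T]
    unfolding maximal_subgroup_def by blast
  then have "W \<subseteq> T" using perfect_subset_normal_maximal_subgroup[OF subgroup_W T _ W(1)] by blast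
  then show ?thesis using \<open>T \<subset> W\<close> by blast
qed

lemma subgroup_centralizer_mod:
  assumes W: "subgroup W G" and N: "subgroup N G" "N \<subseteq> W" "W \<subseteq> normalizer G N" and S: "S \<subseteq> W"
    and S_invariant: "\<And>g s. g \<in> W \<Longrightarrow> s \<in> S \<Longrightarrow> conj_by G g s \<in> S"
  shows "subgroup (centralizer_mod G W N S) G" "N \<subseteq> centralizer_mod G W N S"
    "W \<subseteq> normalizer G (centralizer_mod G W N S)"
proof -
  interpret W: subgroup W G by fact
  interpret N: subgroup N G by fact
  have S_carrier: "s \<in> carrier G" if "s \<in> S" for s using that S by auto
  have N_invariant: "conj_by G g n \<in> N" if "g \<in> W" "n \<in> N" for g n
    using that N normalizerD by blast
  show "subgroup (centralizer_mod G W N S) G"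
  proof (rule subgroup_if_mult_closed)
    show "x \<otimes> y \<in> centralizer_mod G W N S"
      if "x \<in> centralizer_mod G W N S" "y \<in> centralizer_mod G W N S" for x y
      using that S_carrier N_invariant by (auto simp: centralizer_mod_def commutator_mult_right)
  qed (use S_carrier in \<open>auto simp: centralizer_mod_def commutator_def\<close>)
  show "N \<subseteq> centralizer_mod G W N S"
    using N S commutator_mem_right[OF N(1)] by (auto simp: centralizer_mod_def)
  show "W \<subseteq> normalizer G (centralizer_mod G W N S)"
  proof (rule subset_normalizerI[OF W])
    show "centralizer_mod G W N S \<subseteq> carrier G" by (auto simp: centralizer_mod_def)
    fix g y assume g: "g \<in> W" and y: "y \<in> centralizer_mod G W N S"
    have "commutator G s (conj_by G g y) \<in> N" if "s \<in> S" for s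
    proof -
      have "commutator G s (conj_by G g y) = conj_by G g (commutator G (conj_by G (inv g) s) y)"
        using g y that S_carrier by (simp add: conj_by_commutator centralizer_mod_def)
      moreover have "commutator G (conj_by G (inv g) s) y \<in> N"
        using y S_invariant[of "inv g" s] g that by (auto simp: centralizer_mod_def)
      ultimately show ?thesis using N_invariant[OF g] by simp
    qed
    then show "conj_by G g y \<in> centralizer_mod G W N S"
      using g y subgroup_conj_by_closed[OF W] by (simp add: centralizer_mod_def)
  qed
qed

text \<open>If \<open>x\<close> were not in \<open>N\<close>, maximality would let the whole of \<open>W\<close> centralize the class of \<open>x\<close> modulo
  \<open>N\<close>; then \<open>x\<close> would centralize \<open>W\<close>, and by maximality again \<open>W\<close> would be abelian modulo \<open>N\<close>.\<close>
lemma mem_maximal_normal_if_commuting_conjugates: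
  assumes W: "perfect_subgroup G W" and N: "subgroup N G" "N \<subset> W" "W \<subseteq> normalizer G N"
    and maximal: "\<And>M. subgroup M G \<Longrightarrow> N \<subseteq> M \<Longrightarrow> M \<subset> W \<Longrightarrow> W \<subseteq> normalizer G M \<Longrightarrow> M = N"
    and x: "x \<in> W" and commuting: "\<And>g. g \<in> W \<Longrightarrow> commutator G (conj_by G g x) x \<in> N"
  shows "x \<in> N"
proof (rule ccontr)
  assume "x \<notin> N"
  have subgroup_W: "subgroup W G" using W by (rule perfect_subgroupD)
  interpret W: subgroup W G by fact
  have centralizer_mod_eq: "centralizer_mod G W N S = W"
    if "x \<in> centralizer_mod G W N S" "S \<subseteq> W" "\<And>g s. g \<in> W \<Longrightarrow> s \<in> S \<Longrightarrow> conj_by G g s \<in> S" for S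
  proof (rule ccontr)
    assume "centralizer_mod G W N S \<noteq> W"
    then have "centralizer_mod G W N S \<subset> W" by (auto simp: centralizer_mod_def)
    then have "centralizer_mod G W N S = N"
      using subgroup_centralizer_mod[OF subgroup_W N(1) _ N(3) that(2,3)] N(2)
      by (intro maximal) auto
    then show False using that(1) \<open>x \<notin> N\<close> by simp
  qed
  let ?class = "(\<lambda>g. conj_by G g x) ` W"
  have "centralizer_mod G W N ?class = W"
    using x commuting subgroup_conj_by_closed[OF subgroup_W]
    by (intro centralizer_mod_eq) (auto simp: centralizer_mod_def conj_by_conj_by)
  moreover have "x \<in> ?class" using x by (intro image_eqI[of _ _ \<one>]) auto
  ultimately have x_central: "commutator G x y \<in> N" if "y \<in> W" for y
    using that unfolding centralizer_mod_def by blast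
  have "commutator G y x \<in> N" if "y \<in> W" for y
    using subgroup.m_inv_closed[OF N(1) x_central[OF that]] x that by (simp add: inv_commutator)
  then have "centralizer_mod G W N W = W"
    using x subgroup_conj_by_closed[OF subgroup_W]
    by (intro centralizer_mod_eq) (auto simp: centralizer_mod_def)
  then have "W \<subseteq> N"
    unfolding centralizer_mod_def by (intro perfect_subgroup_subset[OF W N(1)]) blast
  then show False using N(2) by blast
qed

lemma perfect_subset_if_commuting_conjugates:
  assumes W: "perfect_subgroup G W" and J: "subgroup J G" "W \<subseteq> normalizer G J"
    and commuting: "\<And>x g. x \<in> W \<Longrightarrow> g \<in> W \<Longrightarrow> commutator G x (conj_by G g x) \<in> J"
  shows "W \<subseteq> J"
proof (rule ccontr)
  assume "\<not> W \<subseteq> J"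
  have subgroup_W: "subgroup W G" using W by (rule perfect_subgroupD)
  interpret W: subgroup W G by fact
  have subgroup_inter: "subgroup (W \<inter> J) G" using subgroup_W J(1) by (rule subgroups_Inter_pair)
  let ?normal = "\<lambda>N. subgroup N G \<and> W \<inter> J \<subseteq> N \<and> N \<subset> W \<and> W \<subseteq> normalizer G N"
  have "W \<subseteq> normalizer G (W \<inter> J)"
    using J normalizerD[OF J(1)] subgroup_conj_by_closed[OF subgroup_W]
    by (intro subset_normalizerI[OF subgroup_W]) (auto simp: subset_iff)
  then have "?normal (W \<inter> J)" using subgroup_inter \<open>\<not> W \<subseteq> J\<close> by blast
  moreover have "N \<subseteq> carrier G" if "?normal N" for N using that by (simp add: subgroup.subset)
  ultimately obtain N where N: "?normal N" "W \<inter> J \<subseteq> N" "\<forall>M. ?normal M \<longrightarrow> N \<subseteq> M \<longrightarrow> N = M"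
    by (rule maximal_subset_exists[of ?normal])
  have "x \<in> N" if "x \<in> W" for x
  proof (rule mem_maximal_normal_if_commuting_conjugates[OF W _ _ _ _ that])
    fix M assume "subgroup M G" "N \<subseteq> M" "M \<subset> W" "W \<subseteq> normalizer G M"
    then show "M = N" using N(2,3) by (metis subset_trans)
  next
    fix g assume "g \<in> W"
    have "inv (commutator G x (conj_by G g x)) \<in> W \<inter> J"
      using commuting[OF that \<open>g \<in> W\<close>] that \<open>g \<in> W\<close> subgroup_conj_by_closed[OF subgroup_W]
        subgroup.m_inv_closed[OF subgroup_inter] by (simp add: commutator_def)
    then show "commutator G (conj_by G g x) x \<in> N"
      using N(2) that \<open>g \<in> W\<close> by (auto simp: inv_commutator)
  qed (use N(1) in auto)
  then show False using N(1) by blast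
qed

end

section \<open>Transfer\<close>

locale transfer = finite_group +
  fixes D B R :: "'a set" and r :: "'a set \<Rightarrow> 'a"
  assumes subgroup_D: "subgroup D G" and subgroup_B: "subgroup B G" and B_subset_D: "B \<subseteq> D"
    and normal_R: "R \<lhd> G\<lparr>carrier := B\<rparr>" and comm_quotient: "comm_group (G\<lparr>carrier := B\<rparr> Mod R)"
    and transversal_mem: "\<And>U. U \<in> l_cosets_from D B \<Longrightarrow> r U \<in> D"
    and transversal_coset: "\<And>U. U \<in> l_cosets_from D B \<Longrightarrow> r U <# B = U"
begin

abbreviation quotient :: "'a set monoid" where
  "quotient \<equiv> G\<lparr>carrier := B\<rparr> Mod R"

definition cocycle :: "'a \<Rightarrow> 'a set \<Rightarrow> 'a" where
  "cocycle g U = inv (r (g <# U)) \<otimes> (g \<otimes> r U)"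

definition transfer_map :: "'a \<Rightarrow> 'a set" where
  "transfer_map g = finprod quotient (\<lambda>U. R #> cocycle g U) (l_cosets_from D B)"

sublocale D: subgroup D G by (rule subgroup_D)
sublocale B: subgroup B G by (rule subgroup_B)
sublocale group_B: group "G\<lparr>carrier := B\<rparr>" using subgroup_B by (rule subgroup_imp_group)
sublocale R: normal R "G\<lparr>carrier := B\<rparr>" by (rule normal_R)
sublocale quotient: comm_group quotient by (rule comm_quotient)

lemma class_closed: "b \<in> B \<Longrightarrow> R #> b \<in> carrier quotient"
  using hom_in_carrier[OF R.r_coset_hom_Mod] by simp

lemma class_mult: "a \<in> B \<Longrightarrow> b \<in> B \<Longrightarrow> R #> (a \<otimes> b) = (R #> a) \<otimes>\<^bsub>quotient\<^esub> (R #> b)"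
  using hom_mult[OF R.r_coset_hom_Mod] by simp

lemma class_eq_one_iff: "b \<in> B \<Longrightarrow> R #> b = \<one>\<^bsub>quotient\<^esub> \<longleftrightarrow> b \<in> R"
  using group_B.coset_join1[OF _ _ R.subgroup_axioms] group_B.coset_join2[OF _ R.subgroup_axioms]
  by auto

lemma l_coset_subset: "U \<in> l_cosets_from D B \<Longrightarrow> U \<subseteq> carrier G"
  by (auto simp: l_coset_def)

lemma translate_translate:
  "g \<in> D \<Longrightarrow> h \<in> D \<Longrightarrow> U \<in> l_cosets_from D B \<Longrightarrow> g <# (h <# U) = (g \<otimes> h) <# U"
  by (simp add: lcos_m_assoc[OF l_coset_subset])

lemma translate_closed: "g \<in> D \<Longrightarrow> U \<in> l_cosets_from D B \<Longrightarrow> g <# U \<in> l_cosets_from D B"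
  by (auto simp: lcos_m_assoc B.subset)

lemma translate_inv_cancel:
  assumes "g \<in> D" "U \<in> l_cosets_from D B"
  shows "inv g <# (g <# U) = U" "g <# (inv g <# U) = U"
  using assms by (simp_all add: translate_translate lcos_mult_one[OF l_coset_subset])

lemma bij_betw_translate:
  assumes "g \<in> D"
  shows "bij_betw (\<lambda>U. g <# U) (l_cosets_from D B) (l_cosets_from D B)"
  by (rule bij_betwI[where g = "\<lambda>U. inv g <# U"])
    (use assms in \<open>simp_all add: Pi_I translate_closed translate_inv_cancel del: image_iff\<close>)

lemma cocycle_mem:
  assumes "g \<in> D" "U \<in> l_cosets_from D B"
  shows "cocycle g U \<in> B"
proof -
  have r: "r U \<in> D" "r (g <# U) \<in> D" using assms transversal_mem translate_closed by auto
  then have "(g \<otimes> r U) <# B = g <# (r U <# B)" using assms by (simp add: lcos_m_assoc B.subset)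
  also have "\<dots> = r (g <# U) <# B" using assms by (simp add: transversal_coset translate_closed)
  finally show ?thesis
    using assms r l_coset_eq_iff[OF subgroup_B, of "r (g <# U)" "g \<otimes> r U"]
    by (simp add: cocycle_def)
qed

lemma cocycle_mult:
  assumes "g \<in> D" "h \<in> D" "U \<in> l_cosets_from D B"
  shows "cocycle (g \<otimes> h) U = cocycle g (h <# U) \<otimes> cocycle h U"
  using assms transversal_mem translate_closed
  by (simp add: cocycle_def translate_translate[symmetric] m_assoc)

lemma transfer_map_closed: "g \<in> D \<Longrightarrow> transfer_map g \<in> carrier quotient"
  unfolding transfer_map_def by (intro quotient.finprod_closed Pi_I class_closed cocycle_mem)

lemma transfer_map_mult:
  assumes "g \<in> D" "h \<in> D"
  shows "transfer_map (g \<otimes> h) = transfer_map g \<otimes>\<^bsub>quotient\<^esub> transfer_map h"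
proof -
  let ?cosets = "l_cosets_from D B"
  have classes: "(\<lambda>U. R #> cocycle x U) \<in> ?cosets \<rightarrow> carrier quotient" if "x \<in> D" for x
    using that by (intro Pi_I class_closed cocycle_mem)
  have "finprod quotient (\<lambda>U. R #> cocycle g (h <# U)) ?cosets = transfer_map g"
    unfolding transfer_map_def
    using quotient.finprod_reindex[of "\<lambda>U. R #> cocycle g U" "\<lambda>U. h <# U" ?cosets]
      bij_betw_translate[OF assms(2)] classes[OF assms(1)] by (simp add: bij_betw_def)
  moreover have "transfer_map (g \<otimes> h) =
      finprod quotient (\<lambda>U. (R #> cocycle g (h <# U)) \<otimes>\<^bsub>quotient\<^esub> (R #> cocycle h U)) ?cosets"
    unfolding transfer_map_def
  proof (rule quotient.finprod_cong')
    show "(\<lambda>U. (R #> cocycle g (h <# U)) \<otimes>\<^bsub>quotient\<^esub> (R #> cocycle h U)) \<in> ?cosets \<rightarrow> carrier quotient"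
      using assms by (intro Pi_I quotient.m_closed class_closed cocycle_mem translate_closed)
    fix U assume "U \<in> ?cosets"
    then show "R #> cocycle (g \<otimes> h) U = (R #> cocycle g (h <# U)) \<otimes>\<^bsub>quotient\<^esub> (R #> cocycle h U)"
      using assms class_mult[OF cocycle_mem cocycle_mem]
      by (simp add: cocycle_mult translate_closed)
  qed simp
  moreover have "(\<lambda>U. R #> cocycle g (h <# U)) \<in> ?cosets \<rightarrow> carrier quotient"
    using assms by (intro Pi_I class_closed cocycle_mem translate_closed)
  ultimately show ?thesis
    using quotient.finprod_multf[OF _ classes[OF assms(2)]] by (simp add: transfer_map_def)
qed

lemma transfer_map_derived:
  assumes "g \<in> derived G D"
  shows "transfer_map g = \<one>\<^bsub>quotient\<^esub>"
proof -
  have derived_in_D: "derived (G\<lparr>carrier := D\<rparr>) D = derived G D"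
    using derived_consistent subgroup_D by simp
  interpret group_hom "G\<lparr>carrier := D\<rparr>" quotient transfer_map
    using subgroup_imp_group[OF subgroup_D]
    by (intro group_hom.intro group_hom_axioms.intro homI)
      (simp_all add: transfer_map_closed transfer_map_mult quotient.is_group del: mult_FactGroup)
  have "transfer_map ` derived G D = derived quotient (transfer_map ` D)"
    using derived_img[of D] derived_in_D by simp
  also have "\<dots> = {\<one>\<^bsub>quotient\<^esub>}"
    using transfer_map_closed by (intro quotient.derived_eq_singleton) blast
  finally show ?thesis using assms by blast
qed

lemma derived_inter_subset_if_cocycle_mem:
  assumes "r B = \<one>"
    and other_cosets: "\<And>b U. b \<in> B \<Longrightarrow> U \<in> l_cosets_from D B \<Longrightarrow> U \<noteq> B \<Longrightarrow> cocycle b U \<in> R"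
  shows "derived G D \<inter> B \<subseteq> R"
proof
  let ?cosets = "l_cosets_from D B"
  have B_coset: "B \<in> ?cosets" by (intro image_eqI[of _ _ \<one>]) (auto simp: lcos_mult_one B.subset)
  fix b assume b: "b \<in> derived G D \<inter> B"
  then have "b \<in> D" using B_subset_D by blast
  have "b <# B = B" using b coset_join3[OF _ subgroup_B] by simp
  then have "cocycle b B = b" using b \<open>r B = \<one>\<close> by (simp add: cocycle_def)
  have trivial: "R #> cocycle b U = \<one>\<^bsub>quotient\<^esub>" if "U \<in> ?cosets" "U \<noteq> B" for U
    using other_cosets[OF _ that] class_eq_one_iff[OF cocycle_mem[OF \<open>b \<in> D\<close> that(1)]] b by blast
  have classes: "(\<lambda>U. R #> cocycle b U) \<in> ?cosets \<rightarrow> carrier quotient"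
    using \<open>b \<in> D\<close> by (intro Pi_I class_closed cocycle_mem)
  then have "transfer_map b =
      finprod quotient (\<lambda>U. if U = B then R #> cocycle b U else \<one>\<^bsub>quotient\<^esub>) ?cosets"
    unfolding transfer_map_def using trivial quotient.one_closed
    by (intro quotient.finprod_cong') (auto simp: Pi_iff)
  also have "\<dots> = R #> b"
    using quotient.finprod_singleton_swap[OF B_coset _ classes] finite_subgroup[OF subgroup_D]
    by (simp add: \<open>cocycle b B = b\<close>)
  finally have "R #> b = \<one>\<^bsub>quotient\<^esub>" using b transfer_map_derived[of b] by simp
  then show "b \<in> R" using b class_eq_one_iff by blast
qed

end

context group
begin

lemma double_coset_representatives_exist:
  assumes D: "subgroup D G" and B: "subgroup B G" "B \<subseteq> D"
  obtains s t where "\<forall>U \<in> l_cosets_from D B. s U \<in> B \<and> t U \<in> D \<and> (s U \<otimes> t U) <# B = U"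
    "\<forall>U \<in> l_cosets_from D B. \<forall>b \<in> B. t (b <# U) = t U"
proof -
  interpret D: subgroup D G by fact
  interpret B: subgroup B G by fact
  define t where "t U = (SOME t. t \<in> B <#> U)" for U
  define s where "s U = (SOME s. s \<in> B \<and> (s \<otimes> t U) <# B = U)" for U
  have representatives: "t U \<in> D" "s U \<in> B \<and> (s U \<otimes> t U) <# B = U"
    if coset: "U \<in> l_cosets_from D B" for U
  proof -
    obtain d where d: "d \<in> D" "U = d <# B" using coset by blast
    then have "\<one> \<otimes> d \<in> B <#> U" using lcos_self[OF _ B(1)] by (intro set_multI) auto
    then have "t U \<in> B <#> U" unfolding t_def by (rule someI)
    then obtain b u where tU_factors: "b \<in> B" "u \<in> U" "t U = b \<otimes> u" by (rule set_multE)
    have "u \<in> D" using tU_factors(2) d B(2) by (auto simp: l_coset_def)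
    then show "t U \<in> D" using tU_factors B(2) by auto
    have "(inv b \<otimes> t U) <# B = u <# B" using tU_factors \<open>u \<in> D\<close> by simp
    also have "\<dots> = U" using l_repr_independence[OF _ _ B(1), of u d] tU_factors(2) d by simp
    finally have "inv b \<in> B \<and> (inv b \<otimes> t U) <# B = U" using tU_factors(1) by simp
    then show "s U \<in> B \<and> (s U \<otimes> t U) <# B = U" unfolding s_def by (rule someI)
  qed
  have "t (b <# U) = t U" if "b \<in> B" "U \<in> l_cosets_from D B" for b U
  proof -
    have "U \<subseteq> carrier G" using that(2) by (auto simp: l_coset_def)
    then have "B <#> (b <# U) = (B #> b) <#> U"
      using that(1) by (simp add: rcos_assoc_lcos B.subset)
    also have "B #> b = B" using that(1) by (simp add: coset_join2[OF _ B(1)])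
    finally show ?thesis by (simp add: t_def)
  qed
  then show thesis using representatives by (intro that[of s t] ballI) auto
qed

text \<open>For \<open>b \<in> B\<close> the cosets \<open>U\<close> and \<open>b <# U\<close> lie in the same double coset of \<open>B\<close>. Their representatives
  are chosen with the same factor \<open>t\<close>, which depends on the double coset only.\<close>
lemma double_coset_transversal_exists:
  assumes D: "subgroup D G" and B: "subgroup B G" "B \<subseteq> D"
  obtains r where "r B = \<one>" "\<And>U. U \<in> l_cosets_from D B \<Longrightarrow> r U \<in> D"
    "\<And>U. U \<in> l_cosets_from D B \<Longrightarrow> r U <# B = U"
    "\<And>b U. b \<in> B \<Longrightarrow> U \<in> l_cosets_from D B \<Longrightarrow> U \<noteq> B \<Longrightarrow>
      \<exists>s \<in> B. \<exists>s' \<in> B. \<exists>t \<in> D - B. r U = s \<otimes> t \<and> r (b <# U) = s' \<otimes> t"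
proof -
  interpret D: subgroup D G by fact
  interpret B: subgroup B G by fact
  obtain s t where factors: "\<forall>U \<in> l_cosets_from D B. s U \<in> B \<and> t U \<in> D \<and> (s U \<otimes> t U) <# B = U"
    and t_translate: "\<forall>U \<in> l_cosets_from D B. \<forall>b \<in> B. t (b <# U) = t U"
    using D B by (rule double_coset_representatives_exist)
  define r where "r U = (if U = B then \<one> else s U \<otimes> t U)" for U
  show thesis
  proof (rule that[of r])
    show "r B = \<one>" by (simp add: r_def)
    fix U assume U: "U \<in> l_cosets_from D B"
    then have rep: "s U \<in> B" "t U \<in> D" "(s U \<otimes> t U) <# B = U" using factors by blast+
    show "r U \<in> D" using rep(1,2) B(2) by (auto simp: r_def)
    show "r U <# B = U" using rep(3) by (simp add: r_def lcos_mult_one B.subset)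
    fix b assume b: "b \<in> B" and "U \<noteq> B"
    have "U \<subseteq> carrier G" using U by (auto simp: l_coset_def)
    have translate: "b <# U \<in> l_cosets_from D B"
      using U b B(2) by (auto simp: lcos_m_assoc B.subset subset_iff)
    have "t U \<notin> B"
      using rep(1,3) \<open>U \<noteq> B\<close> coset_join3[OF _ B(1), of "s U \<otimes> t U"] by auto
    moreover have "b <# U \<noteq> B"
    proof
      assume "b <# U = B"
      then have "U = inv b <# B"
        using b \<open>U \<subseteq> carrier G\<close> lcos_m_assoc[of U "inv b" b] lcos_mult_one by simp
      then show False using \<open>U \<noteq> B\<close> b coset_join3[OF _ B(1)] by simp
    qed
    ultimately show "\<exists>s \<in> B. \<exists>s' \<in> B. \<exists>t \<in> D - B. r U = s \<otimes> t \<and> r (b <# U) = s' \<otimes> t"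
      using \<open>U \<noteq> B\<close> rep(1,2) bspec[OF factors translate] bspec[OF bspec[OF t_translate U] b]
      by (auto simp: r_def)
  qed
qed

end

context finite_group
begin

theorem derived_inter_subset_if_fusion_trivial:
  assumes D: "subgroup D G" and B: "subgroup B G" "B \<subseteq> D"
    and R: "R \<lhd> G\<lparr>carrier := B\<rparr>" "comm_group (G\<lparr>carrier := B\<rparr> Mod R)"
    and fusion: "\<And>t b. t \<in> D - B \<Longrightarrow> b \<in> B \<Longrightarrow> conj_by G t b \<in> B \<Longrightarrow> b \<in> R"
  shows "derived G D \<inter> B \<subseteq> R"
proof -
  obtain r where r: "r B = \<one>"
    "\<And>U. U \<in> l_cosets_from D B \<Longrightarrow> r U \<in> D" "\<And>U. U \<in> l_cosets_from D B \<Longrightarrow> r U <# B = U"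
    "\<And>b U. b \<in> B \<Longrightarrow> U \<in> l_cosets_from D B \<Longrightarrow> U \<noteq> B \<Longrightarrow>
      \<exists>s \<in> B. \<exists>s' \<in> B. \<exists>t \<in> D - B. r U = s \<otimes> t \<and> r (b <# U) = s' \<otimes> t"
    by (rule double_coset_transversal_exists[OF D B]) simp
  interpret transfer G D B R r
    by (intro transfer.intro transfer_axioms.intro finite_group_axioms D B R r)
  show ?thesis
  proof (rule derived_inter_subset_if_cocycle_mem[OF r(1)])
    fix b U assume bU: "b \<in> B" "U \<in> l_cosets_from D B" "U \<noteq> B"
    then obtain s s' t
      where factors: "s \<in> B" "s' \<in> B" "t \<in> D - B" "r U = s \<otimes> t" "r (b <# U) = s' \<otimes> t"
      using r(4)[OF bU] by auto
    have "b \<in> D" using bU(1) B(2) by blast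
    then have "cocycle b U \<in> B" using bU(2) by (rule cocycle_mem)
    moreover have "conj_by G t (cocycle b U) = inv s' \<otimes> b \<otimes> s"
      using factors bU(1) by (simp add: cocycle_def conj_by_def inv_mult_group m_assoc)
    ultimately show "cocycle b U \<in> R" using fusion[OF factors(3)] bU(1) factors(1,2) by simp
  qed
qed

end

section \<open>Malnormal subgroups\<close>

definition malnormal_in :: "('a, 'b) monoid_scheme \<Rightarrow> 'a set \<Rightarrow> 'a set \<Rightarrow> bool" where
  "malnormal_in G B D \<longleftrightarrow> (\<forall>t \<in> D. \<forall>b \<in> B. b \<noteq> \<one>\<^bsub>G\<^esub> \<longrightarrow> conj_by G t b \<in> B \<longrightarrow> t \<in> B)"

context group
begin

lemma malnormal_inD:
  "malnormal_in G B D \<Longrightarrow> t \<in> D \<Longrightarrow> b \<in> B \<Longrightarrow> b \<noteq> \<one> \<Longrightarrow> conj_by G t b \<in> B \<Longrightarrow> t \<in> B"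
  by (auto simp: malnormal_in_def)

lemma malnormal_in_inter: "malnormal_in G B E \<Longrightarrow> D \<subseteq> E \<Longrightarrow> malnormal_in G (D \<inter> B) D"
  by (auto simp: malnormal_in_def)

lemma malnormal_commuting_mem:
  assumes "malnormal_in G B (carrier G)" "B \<subseteq> carrier G" "b \<in> B" "b \<noteq> \<one>"
    "x \<in> carrier G" "x \<otimes> b = b \<otimes> x"
  shows "x \<in> B"
proof -
  have "conj_by G x b = b" using assms by (subst conj_by_eq_self_iff) auto
  then show ?thesis using malnormal_inD[OF assms(1,5,3,4)] assms(3) by simp
qed

end

context finite_group
begin

lemma perfect_subgroup_if_malnormal:
  assumes D: "perfect_subgroup G D" and B: "subgroup B G" "B \<subseteq> D" "malnormal_in G B D"
  shows "perfect_subgroup G B"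
proof -
  have "derived G D \<inter> B \<subseteq> derived G B"
  proof (rule derived_inter_subset_if_fusion_trivial[OF perfect_subgroupD[OF D] B(1,2)])
    show "derived G B \<lhd> G\<lparr>carrier := B\<rparr>" using B(1) by (rule derived_subgroup_is_normal)
    show "comm_group (G\<lparr>carrier := B\<rparr> Mod derived G B)"
      using B(1) by (rule derived_quot_of_subgroup_is_comm_group)
    fix t b assume "t \<in> D - B" "b \<in> B" "conj_by G t b \<in> B"
    then have "b = \<one>" using malnormal_inD[OF B(3)] by blast
    then show "b \<in> derived G B" using subgroup.one_closed[OF subgroup_derived[OF B(1)]] by simp
  qed
  then show ?thesis using D B derived_subset[OF B(1)] by (auto simp: perfect_subgroup_def)
qed

end

section \<open>Minimal non-abelian overgroups of a Sylow subgroup\<close>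

context group
begin

lemma normalizer_inter_maximal_subgroup:
  assumes "subgroup L G" "maximal_subgroup G T L" "\<not> L \<subseteq> normalizer G T"
  shows "normalizer G T \<inter> L = T"
proof -
  have T: "subgroup T G" "T \<subset> L" using assms(2) by (simp_all add: maximal_subgroup_def)
  have "subgroup (normalizer G T \<inter> L) G"
    using subgroup_normalizer[OF T(1)] assms(1) by (rule subgroups_Inter_pair)
  then have "normalizer G T \<inter> L = T \<or> normalizer G T \<inter> L = L"
    using assms(2) subgroup_subset_normalizer[OF T(1)] T(2) unfolding maximal_subgroup_def
    by (metis inf_le2 le_inf_iff psubset_imp_subset)
  then show ?thesis using assms(3) by blast
qed

end

context finite_group
begin

text \<open>Both \<open>T\<close> and its conjugate by the inverse of \<open>t\<close> centralize \<open>b\<close>, and they generate \<open>L\<close>.\<close>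
lemma abelian_maximal_subgroup_fusion_central:
  assumes L: "subgroup L G"
    and T: "maximal_subgroup G T L" "\<not> non_abelian T G" "\<not> L \<subseteq> normalizer G T"
    and t: "t \<in> L - T" and b: "b \<in> T" "conj_by G t b \<in> T"
  shows "b \<in> centralizer G L"
proof -
  have "subgroup T G" and "T \<subset> L" using T(1) by (simp_all add: maximal_subgroup_def)
  interpret L: subgroup L G by fact
  interpret T: subgroup T G by fact
  have commute: "x \<otimes> y = y \<otimes> x" if "x \<in> T" "y \<in> T" for x y
    using that T(2) by (auto simp: non_abelian_def)
  let ?C = "L \<inter> centralizer G {b}"
  have "subgroup ?C G" using L b(1) by (intro subgroups_Inter_pair subgroup_centralizer) auto
  moreover have "T \<subseteq> ?C" using \<open>T \<subset> L\<close> commute b(1) by (auto intro: centralizerI)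
  ultimately consider (self) "?C = T" | (whole) "?C = L"
    using T(1) unfolding maximal_subgroup_def by blast
  then show ?thesis
  proof cases
    case self
    have "conj_by G (inv t) x \<in> ?C" if "x \<in> T" for x
    proof -
      have x: "x \<in> L" "x \<in> carrier G" using that \<open>T \<subset> L\<close> by auto
      have "conj_by G (inv t) x \<otimes> b = conj_by G (inv t) (x \<otimes> conj_by G t b)"
        using x t b by (simp add: conj_by_mult)
      also have "x \<otimes> conj_by G t b = conj_by G t b \<otimes> x" using that b(2) by (rule commute)
      also have "conj_by G (inv t) \<dots> = b \<otimes> conj_by G (inv t) x"
        using x t b by (simp add: conj_by_mult)
      finally show ?thesis
        using x t subgroup_conj_by_closed[OF L] by (auto intro: centralizerI)
    qed
    then have "inv t \<in> normalizer G T \<inter> L"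
      using self t mem_normalizerI[OF _ T.subset, of "inv t"] by auto
    then have "inv t \<in> T" using normalizer_inter_maximal_subgroup[OF L T(1,3)] by simp
    then have "inv (inv t) \<in> T" by (rule T.m_inv_closed)
    then show ?thesis using t by simp
  next
    case whole
    then have "L \<subseteq> centralizer G {b}" by blast
    then show ?thesis using b(1) by (auto simp: centralizer_def)
  qed
qed

lemma perfect_inter_abelian_maximal_subgroup_central:
  assumes L: "subgroup L G" and T: "maximal_subgroup G T L" "\<not> non_abelian T G"
    and W: "perfect_subgroup G W" "W \<subseteq> L"
  shows "W \<inter> T \<subseteq> centralizer G L"
proof (cases "L \<subseteq> normalizer G T")
  case True
  then have "W \<subseteq> T" using perfect_subset_normal_maximal_subgroup[OF L T(1) _ W] by simp
  then have "W = {\<one>}" using perfect_abelian_trivial[OF W(1)] T(2) non_abelian_mono by blast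
  then show ?thesis
    using subgroup.one_closed[OF subgroup_centralizer[OF subgroup.subset[OF L]]] by auto
next
  case False
  let ?R = "T \<inter> centralizer G L"
  have subgroup_T: "subgroup T G" and "T \<subseteq> L" using T(1) by (auto simp: maximal_subgroup_def)
  interpret T: comm_group "G\<lparr>carrier := T\<rparr>" using subgroup_T T(2) by (rule comm_group_if_abelian)
  have "subgroup ?R (G\<lparr>carrier := T\<rparr>)"
    using subgroup_T subgroup_centralizer[OF subgroup.subset[OF L]]
    by (intro subgroup_incl subgroups_Inter_pair) auto
  then have "derived G L \<inter> T \<subseteq> ?R"
    using abelian_maximal_subgroup_fusion_central[OF L T False]
    by (intro derived_inter_subset_if_fusion_trivial[OF L subgroup_T \<open>T \<subseteq> L\<close>]
        T.subgroup_imp_normal T.abelian_FactGroup) auto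
  moreover have "W \<subseteq> derived G L"
    using mono_derived[OF W(2)] W(1) by (simp add: perfect_subgroup_def)
  ultimately show ?thesis by blast
qed

end

locale minimal_non_abelian_over_sylow = finite_group +
  fixes p :: nat and L P :: "'a set"
  assumes prime_p: "Factorial_Ring.prime p" and subgroup_L: "subgroup L G"
    and sylow_P: "sylow_subgroup G p P L"
    and minimal: "\<And>K. subgroup K G \<Longrightarrow> P \<subseteq> K \<Longrightarrow> K \<subset> L \<Longrightarrow> \<not> non_abelian K G"
begin

sublocale L: subgroup L G by (rule subgroup_L)
sublocale P: subgroup P G using sylow_P by (rule sylow_subgroupD)

lemma solvable_P: "solvable_seq G P"
  using sylow_subgroupD(2)[OF sylow_P] prime_p by (rule p_subgroup_solvable)

lemma perfect_inter_proper_overgroup_central: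
  assumes W: "perfect_subgroup G W" "W \<subseteq> L" and K: "subgroup K G" "P \<subseteq> K" "K \<subset> L"
  shows "W \<inter> K \<subseteq> centralizer G L"
proof -
  obtain T where T: "maximal_subgroup G T L" "K \<subseteq> T"
    by (rule maximal_subgroup_exists[OF K(1,3) L.subset])
  then have "\<not> non_abelian T G" using minimal K(2) by (auto simp: maximal_subgroup_def)
  then show ?thesis
    using perfect_inter_abelian_maximal_subgroup_central[OF subgroup_L T(1) _ W] T(2) by blast
qed

lemma proper_product_commutes:
  assumes Q: "subgroup Q G" "Q \<subseteq> L" "P \<subseteq> normalizer G Q" and "P <#> Q \<noteq> L"
  shows "Q \<subseteq> centralizer G P"
proof -
  have "P <#> Q \<subset> L"
    using set_mult_least[OF subgroup_L sylow_subgroupD(3)[OF sylow_P] Q(2)] assms(4) by blast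
  then have "\<not> non_abelian (P <#> Q) G"
    using subgroup_set_mult[OF P.subgroup_axioms Q(1,3)]
      subset_set_mult_left[OF P.subgroup_axioms Q(1)]
    by (intro minimal)
  then have "P <#> Q \<subseteq> centralizer G (P <#> Q)"
    using subgroup.subset[OF subgroup_set_mult[OF P.subgroup_axioms Q(1,3)]]
    by (intro subset_centralizer_if_abelian)
  then show ?thesis
    using subset_set_mult_left[OF P.subgroup_axioms Q(1)]
      subset_set_mult_right[OF P.subgroup_axioms Q(1)]
      centralizer_antimono[of P "P <#> Q"] by blast
qed

lemma invariant_sylow_subgroup_exists:
  assumes W: "perfect_subgroup G W" "W \<subseteq> L" "L \<subseteq> normalizer G W" and "P \<noteq> L"
    and r: "Factorial_Ring.prime r"
  obtains Q where "sylow_subgroup G r Q W" "P \<subseteq> normalizer G Q"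
proof -
  have "P \<subset> L" using sylow_subgroupD(3)[OF sylow_P] \<open>P \<noteq> L\<close> by blast
  have subgroup_W: "subgroup W G" using W(1) by (rule perfect_subgroupD)
  obtain Q where Q: "sylow_subgroup G r Q W" using sylow_subgroup_exists[OF subgroup_W r] .
  have subgroup_inter_P: "subgroup (W \<inter> P) G"
    using subgroup_W P.subgroup_axioms by (rule subgroups_Inter_pair)
  have subgroup_inter_N: "subgroup (W \<inter> normalizer G Q) G"
    using subgroup_W subgroup_normalizer[OF sylow_subgroupD(1)[OF Q]] by (rule subgroups_Inter_pair)
  have "W \<inter> P \<subseteq> centralizer G L"
    using perfect_inter_proper_overgroup_central[OF W(1,2) P.subgroup_axioms _ \<open>P \<subset> L\<close>] by simp
  also have "\<dots> \<subseteq> centralizer G Q"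
    using sylow_subgroupD(3)[OF Q] W(2) by (intro centralizer_antimono) simp
  also have "\<dots> \<subseteq> normalizer G Q"
    using subgroup.subset[OF sylow_subgroupD(1)[OF Q]] by (rule centralizer_subset_normalizer)
  finally have "card W div card (W \<inter> normalizer G Q) dvd card W div card (W \<inter> P)"
    by (intro index_dvd_index[OF subgroup_inter_P subgroup_inter_N subgroup_W]) auto
  moreover have "\<not> p dvd card W div card (W \<inter> P)"
    using sylow_subgroup_inter_normal[OF sylow_P subgroup_L subgroup_W W(2,3) prime_p]
    by (simp add: sylow_subgroup_def)
  ultimately have "\<not> p dvd card W div card (W \<inter> normalizer G Q)" by (metis dvd_trans)
  moreover have "P \<subseteq> normalizer G W" using \<open>P \<subset> L\<close> W(3) by blast
  ultimately show thesis
    using sylow_subgroup_invariant_exists[OF sylow_subgroupD(2)[OF sylow_P] _ prime_p subgroup_W Q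
      r] that by blast
qed

lemma perfect_normal_commutes:
  assumes W: "perfect_subgroup G W" "W \<subseteq> L" "L \<subseteq> normalizer G W"
  shows "W \<subseteq> centralizer G P"
proof (cases "W = {\<one>}")
  case True
  then show ?thesis using subgroup.one_closed[OF subgroup_centralizer[OF P.subset]] by simp
next
  case False
  have subgroup_W: "subgroup W G" using W(1) by (rule perfect_subgroupD)
  have "P \<noteq> L" using perfect_subset_solvable_trivial[OF W(1) solvable_P] W(2) False by blast
  let ?C = "W \<inter> centralizer G P"
  have "subgroup ?C G"
    using subgroup_W P.subset by (intro subgroups_Inter_pair subgroup_centralizer)
  then have "?C = W"
  proof (rule subgroup_eq_if_contains_sylows[OF subgroup_W])
    fix r :: nat assume r: "Factorial_Ring.prime r"
    obtain Q where Q: "sylow_subgroup G r Q W" "P \<subseteq> normalizer G Q"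
      using invariant_sylow_subgroup_exists[OF W \<open>P \<noteq> L\<close> r] .
    note Q_subgroup = sylow_subgroupD[OF Q(1)]
    have "P <#> Q \<noteq> L"
    proof
      assume "P <#> Q = L"
      then have "W \<subseteq> Q"
        using perfect_subset_if_solvable_mod[OF W(1) solvable_P Q_subgroup(1) Q(2)] W(2) by simp
      then show False
        using perfect_subset_solvable_trivial[OF W(1) p_subgroup_solvable[OF Q_subgroup(2) r]] False
        by simp
    qed
    then have "Q \<subseteq> centralizer G P" using proper_product_commutes Q_subgroup Q(2) W(2) by blast
    then show "\<exists>R. sylow_subgroup G r R W \<and> R \<subseteq> ?C" using Q(1) Q_subgroup(3) by blast
  qed simp
  then show ?thesis by blast
qed

lemma perfect_normal_trivial:
  assumes W: "perfect_subgroup G W" "W \<subseteq> L" "L \<subseteq> normalizer G W"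
  shows "W = {\<one>}"
proof (rule ccontr)
  assume "W \<noteq> {\<one>}"
  have subgroup_W: "subgroup W G" using W(1) by (rule perfect_subgroupD)
  have "W \<subseteq> centralizer G L"
  proof
    fix x assume "x \<in> W"
    then have cyc_W: "cyc x \<subseteq> W" by (rule cyc_subset[OF subgroup_W])
    have x: "x \<in> carrier G" using \<open>x \<in> W\<close> W(2) by auto
    note subgroup_cyc_x = subgroup_cyc[OF x]
    have "x \<in> centralizer G P" using perfect_normal_commutes[OF W] \<open>x \<in> W\<close> by blast
    then have normalizes: "P \<subseteq> normalizer G (cyc x)"
      by (rule subset_normalizer_cyc_if_centralizing[OF P.subset])
    let ?K = "P <#> cyc x"
    have "?K \<noteq> L"
    proof
      assume "?K = L"
      then have "W \<subseteq> cyc x"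
        using perfect_subset_if_solvable_mod[OF W(1) solvable_P subgroup_cyc_x normalizes] W(2)
        by simp
      then show False
        using perfect_abelian_trivial[OF W(1)] cyc_abelian[OF x] non_abelian_mono \<open>W \<noteq> {\<one>}\<close> by blast
    qed
    moreover have "?K \<subseteq> L"
      using set_mult_least[OF subgroup_L sylow_subgroupD(3)[OF sylow_P]] cyc_W W(2) by blast
    ultimately have "W \<inter> ?K \<subseteq> centralizer G L"
      using subgroup_set_mult[OF P.subgroup_axioms subgroup_cyc_x normalizes]
        subset_set_mult_left[OF P.subgroup_axioms subgroup_cyc_x]
      by (intro perfect_inter_proper_overgroup_central[OF W(1,2)]) auto
    then show "x \<in> centralizer G L"
      using \<open>x \<in> W\<close> subset_set_mult_right[OF P.subgroup_axioms subgroup_cyc_x] mem_cyc by blast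
  qed
  then have "W \<subseteq> centralizer G W" using centralizer_antimono[OF W(2)] by blast
  then have "\<not> non_abelian W G" by (auto simp: non_abelian_def centralizer_def)
  then show False using perfect_abelian_trivial[OF W(1)] \<open>W \<noteq> {\<one>}\<close> by simp
qed

text \<open>An abelian maximal subgroup of \<open>L\<close> containing \<open>P\<close> meets its other conjugates in the centre of
  \<open>L\<close>, so by transfer it meets a perfect normal subgroup \<open>W\<close> in the centre of \<open>L\<close>. Hence \<open>P\<close>
  normalizes a Sylow subgroup of \<open>W\<close> for every prime; by minimality it centralizes all of them.
  Then every element of \<open>W\<close> lies in a proper overgroup of \<open>P\<close>, so that \<open>W\<close> is central.\<close>
theorem solvable_L: "solvable_seq G L"
proof (rule solvable_or_perfect_subgroup[OF subgroup_L])
  fix W assume "perfect_subgroup G W" "W \<subseteq> L" "W \<noteq> {\<one>}" "normalizer G L \<subseteq> normalizer G W"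
  then show ?thesis using perfect_normal_trivial subgroup_subset_normalizer[OF subgroup_L] by blast
qed

end

section \<open>TI-subgroups and subnormal subgroups\<close>

context group
begin

lemma eq_carrier_if_malnormal_contains_subnormal:
  assumes "subnormal G S" "subgroup S G" "S \<noteq> {\<one>}" "S \<subseteq> M"
    and M: "malnormal_in G M (carrier G)" "M \<subseteq> carrier G"
  shows "M = carrier G"
  using assms(1-4)
proof (induction rule: subnormal.induct)
  case top
  then show ?case using M(2) by blast
next
  case (step K H)
  have H: "H \<subseteq> K" "K \<subseteq> normalizer G H"
    using step.hyps(3) by (simp_all add: normal_in_subgroup_iff[OF step.hyps(2)])
  obtain h where h: "h \<in> H" "h \<noteq> \<one>" using step.prems nontrivial_subgroupE by blast
  have "K \<subseteq> M"
  proof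
    fix k assume "k \<in> K"
    then have "conj_by G k h \<in> H" "k \<in> carrier G"
      using normalizerD[OF step.prems(1)] h(1) H(2) subgroup.mem_carrier[OF step.hyps(2)] by auto
    then show "k \<in> M" using malnormal_inD[OF M(1) _ _ h(2)] h(1) step.prems(3) by blast
  qed
  moreover have "K \<noteq> {\<one>}" using h H(1) by blast
  ultimately show ?case using step.IH step.hyps(2) by blast
qed

end

context finite_group
begin

lemma TI_subgroup_iff:
  "TI_subgroup H G \<longleftrightarrow> subgroup H G \<and>
    (\<forall>g \<in> carrier G. \<forall>h \<in> H. h \<noteq> \<one> \<longrightarrow> conj_by G g h \<in> H \<longrightarrow> g \<in> normalizer G H)"
proof (intro iffI conjI ballI impI)
  assume TI: "TI_subgroup H G"
  then show "subgroup H G" by (simp add: TI_subgroup_def)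
  then interpret H: subgroup H G .
  fix g h assume g: "g \<in> carrier G" and h: "h \<in> H" "h \<noteq> \<one>" "conj_by G g h \<in> H"
  have "conj_by G g ` H \<inter> H = {\<one>} \<or> conj_by G g ` H \<inter> H = H"
    using TI g conj_sub_eq_image[of "inv g" H] by (metis TI_subgroup_def inv_closed inv_inv)
  moreover have "conj_by G g h \<in> conj_by G g ` H \<inter> H" "conj_by G g h \<noteq> \<one>" using g h by auto
  ultimately have "H \<subseteq> conj_by G g ` H" by blast
  then have "conj_by G g ` H = H"
    using g finite_subgroup[OF \<open>subgroup H G\<close>]
    by (intro card_subset_eq[symmetric]) (simp_all add: card_conj_by_image H.subset)
  then show "g \<in> normalizer G H" using g by (simp add: mem_normalizer_iff H.subset)
next
  assume H: "subgroup H G \<and>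
    (\<forall>g \<in> carrier G. \<forall>h \<in> H. h \<noteq> \<one> \<longrightarrow> conj_by G g h \<in> H \<longrightarrow> g \<in> normalizer G H)"
  then interpret H: subgroup H G by simp
  have "conj_by G (inv g) ` H \<inter> H = {\<one>} \<or> conj_by G (inv g) ` H \<inter> H = H" if g: "g \<in> carrier G" for g
  proof (cases "\<exists>h \<in> H. h \<noteq> \<one> \<and> conj_by G (inv g) h \<in> H")
    case True
    then have "inv g \<in> normalizer G H" using H g by blast
    then show ?thesis using H normalizer_image_eq by simp
  next
    case False
    then have "conj_by G (inv g) ` H \<inter> H \<subseteq> {\<one>}" using g by auto
    moreover have "\<one> \<in> conj_by G (inv g) ` H \<inter> H" using g by (auto intro: image_eqI[of _ _ \<one>])
    ultimately show ?thesis by blast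
  qed
  then show "TI_subgroup H G" using H by (simp add: TI_subgroup_def conj_sub_eq_image)
qed

lemma TI_subgroupD:
  "TI_subgroup H G \<Longrightarrow> g \<in> carrier G \<Longrightarrow> h \<in> H \<Longrightarrow> h \<noteq> \<one> \<Longrightarrow> conj_by G g h \<in> H \<Longrightarrow>
    g \<in> normalizer G H"
  unfolding TI_subgroup_iff by blast

lemma TI_subgroup_descend:
  assumes "TI_subgroup K G" "subgroup H G" "H \<subseteq> K" "normalizer G K \<subseteq> normalizer G H"
  shows "TI_subgroup H G"
  using assms unfolding TI_subgroup_iff by (meson subsetD)

lemma sylow_subgroup_normal_if_subnormal_between:
  assumes "subnormal G S" "Q \<subseteq> S" "S \<subseteq> normalizer G Q"
    and D: "D \<lhd> G" and Q: "sylow_subgroup G q Q D" and q: "Factorial_Ring.prime q"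
  shows "Q \<lhd> G"
proof -
  have subgroup_D: "subgroup D G" and D_normal: "carrier G \<subseteq> normalizer G D"
    using D by (simp_all add: normal_iff_normalizer)
  note Q_subgroup = sylow_subgroupD[OF Q]
  have "carrier G \<subseteq> normalizer G Q"
    using assms(1-3)
  proof (induction rule: subnormal.induct)
    case (step K H)
    have H: "subgroup H G" "H \<subseteq> K" "K \<subseteq> normalizer G H"
      using step.hyps(3) by (simp_all add: normal_in_subgroup_iff[OF step.hyps(2)])
    have subgroup_HD: "subgroup (H \<inter> D) G" using H(1) subgroup_D by (rule subgroups_Inter_pair)
    have "K \<subseteq> normalizer G Q"
    proof
      fix k assume k: "k \<in> K"
      then have k_carrier: "k \<in> carrier G" using subgroup.mem_carrier[OF step.hyps(2)] by blast
      have sylow: "sylow_subgroup G q (conj_by G k ` Q) D"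
        using sylow_subgroup_conj_by_image[OF Q subgroup_D] D_normal k_carrier by blast
      have "conj_by G k ` Q \<subseteq> H" using normalizerD[OF H(1)] H(3) k step.prems(1) by blast
      then have "sylow_subgroup G q (conj_by G k ` Q) (H \<inter> D)"
        using sylow_subgroup_intermediate[OF sylow subgroup_D subgroup_HD]
          sylow_subgroupD(3)[OF sylow] by simp
      moreover have "sylow_subgroup G q Q (H \<inter> D)"
        using sylow_subgroup_intermediate[OF Q subgroup_D subgroup_HD] step.prems(1) Q_subgroup(3)
        by simp
      ultimately obtain s where s: "s \<in> H \<inter> D" "conj_by G k ` Q = conj_by G s ` Q"
        using sylow_subgroups_conjugate[OF _ _ subgroup_HD q] by blast
      then have "conj_by G k ` Q = Q"
        using normalizer_image_eq[OF Q_subgroup(1)] step.prems(2) by auto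
      then show "k \<in> normalizer G Q"
        using k_carrier subgroup.subset[OF Q_subgroup(1)] by (simp add: mem_normalizer_iff)
    qed
    then show ?case using step.IH step.prems(1) H(2) by blast
  qed simp
  then show ?thesis using Q_subgroup(1) by (simp add: normal_iff_normalizer)
qed

end

definition times_centralizer :: "('a, 'b) monoid_scheme \<Rightarrow> 'a set \<Rightarrow> 'a set" where
  "times_centralizer G L = L <#>\<^bsub>G\<^esub> centralizer G L"

context group
begin

lemma subgroup_times_centralizer: "subgroup L G \<Longrightarrow> subgroup (times_centralizer G L) G"
  unfolding times_centralizer_def
  by (simp add: subgroup_set_mult subgroup_centralizer subgroup.subset
    subgroup_subset_normalizer_centralizer)

lemma subset_times_centralizer: "subgroup L G \<Longrightarrow> L \<subseteq> times_centralizer G L"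
  unfolding times_centralizer_def
  by (simp add: subset_set_mult_left subgroup_centralizer subgroup.subset)

lemma centralizer_subset_times_centralizer: "subgroup L G \<Longrightarrow> centralizer G L \<subseteq> times_centralizer G L"
  unfolding times_centralizer_def
  by (simp add: subset_set_mult_right subgroup_centralizer subgroup.subset)

lemma times_centralizer_least:
  "subgroup K G \<Longrightarrow> L \<subseteq> K \<Longrightarrow> centralizer G L \<subseteq> K \<Longrightarrow> times_centralizer G L \<subseteq> K"
  unfolding times_centralizer_def by (rule set_mult_least)

lemma times_centralizer_subset_normalizer: "subgroup L G \<Longrightarrow> times_centralizer G L \<subseteq> normalizer G L"
  by (simp add: times_centralizer_least subgroup_normalizer subgroup_subset_normalizer
      centralizer_subset_normalizer subgroup.subset)

lemma self_centralizing_times_centralizer: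
  assumes "subgroup L G"
  shows "self_centralizing (times_centralizer G L) G"
  using subgroup_times_centralizer[OF assms] centralizer_subset_times_centralizer[OF assms]
    centralizer_antimono[OF subset_times_centralizer[OF assms]]
  unfolding self_centralizing_def by blast

lemma times_centralizer_subset_centralizer:
  assumes "subgroup L G" "y \<in> L" "y \<in> centralizer G L"
  shows "times_centralizer G L \<subseteq> centralizer G {y}"
proof (rule times_centralizer_least)
  interpret L: subgroup L G by fact
  show "subgroup (centralizer G {y}) G" using assms(2) by (simp add: subgroup_centralizer)
  show "L \<subseteq> centralizer G {y}" using assms by (auto simp: centralizer_def)
  show "centralizer G L \<subseteq> centralizer G {y}" using assms(2) by (simp add: centralizer_antimono)
qed

lemma subgroup_mult_cyc_if_centralizing:
  assumes L: "subgroup L G" and y: "y \<in> centralizer G L"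
  shows "subgroup (L <#> cyc y) G" "y \<in> centralizer G (L <#> cyc y)"
proof -
  interpret L: subgroup L G by fact
  have y_carrier: "y \<in> carrier G" using y centralizer_subset by blast
  then have centralizer_y: "subgroup (centralizer G {y}) G" by (simp add: subgroup_centralizer)
  show "subgroup (L <#> cyc y) G"
    using subgroup_set_mult[OF L subgroup_cyc[OF y_carrier]
      subset_normalizer_cyc_if_centralizing[OF L.subset y]] .
  have "L \<subseteq> centralizer G {y}" using y by (auto simp: centralizer_def)
  moreover have "cyc y \<subseteq> centralizer G {y}"
    using y_carrier by (intro cyc_subset[OF centralizer_y]) (simp add: centralizer_def)
  ultimately have "L <#> cyc y \<subseteq> centralizer G {y}" by (rule set_mult_least[OF centralizer_y])
  then show "y \<in> centralizer G (L <#> cyc y)" using y_carrier by (auto simp: centralizer_def)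
qed

lemma self_centralizing_mono:
  "self_centralizing J G \<Longrightarrow> subgroup K G \<Longrightarrow> J \<subseteq> K \<Longrightarrow> self_centralizing K G"
  using centralizer_antimono[of J K] unfolding self_centralizing_def by blast

end

section \<open>Fixed-point-free action and malnormal subgroups\<close>

definition fixed_point_free :: "('a, 'b) monoid_scheme \<Rightarrow> 'a set \<Rightarrow> 'a set \<Rightarrow> bool" where
  "fixed_point_free G K A \<longleftrightarrow>
    (\<forall>k \<in> K. \<forall>a \<in> A. k \<noteq> \<one>\<^bsub>G\<^esub> \<longrightarrow> k \<otimes>\<^bsub>G\<^esub> a = a \<otimes>\<^bsub>G\<^esub> k \<longrightarrow> a = \<one>\<^bsub>G\<^esub>)"

context group
begin

lemma fixed_point_freeD:
  "fixed_point_free G K A \<Longrightarrow> k \<in> K \<Longrightarrow> k \<noteq> \<one> \<Longrightarrow> a \<in> A \<Longrightarrow> k \<otimes> a = a \<otimes> k \<Longrightarrow> a = \<one>"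
  by (auto simp: fixed_point_free_def)

lemma fixed_point_free_if_malnormal:
  assumes "malnormal_in G B (carrier G)" "subgroup B G" "K \<subseteq> B" "A \<subseteq> carrier G" "A \<inter> B = {\<one>}"
  shows "fixed_point_free G K A"
  unfolding fixed_point_free_def
proof (intro ballI impI)
  fix k a assume "k \<in> K" "a \<in> A" "k \<noteq> \<one>" "k \<otimes> a = a \<otimes> k"
  then have "a \<in> B"
    using assms malnormal_commuting_mem[OF assms(1) subgroup.subset[OF assms(2)], of k a] by auto
  then show "a = \<one>" using \<open>a \<in> A\<close> assms(5) by blast
qed

lemma malnormal_product_self_centralizing:
  assumes B: "malnormal_in G B (carrier G)" "subgroup B G"
    and P: "subgroup P G" "P \<subseteq> B" "P \<noteq> {\<one>}"
    and Q: "subgroup Q G" "Q \<inter> B = {\<one>}" "Q \<noteq> {\<one>}" "P \<subseteq> normalizer G Q"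
  shows "self_centralizing (P <#> Q) G" "non_abelian (P <#> Q) G"
proof -
  interpret B: subgroup B G by fact
  interpret Q: subgroup Q G by fact
  obtain z where z: "z \<in> P" "z \<noteq> \<one>" using P(1,3) by (rule nontrivial_subgroupE)
  obtain x where x: "x \<in> Q" "x \<noteq> \<one>" using Q(1,3) by (rule nontrivial_subgroupE)
  have zB: "z \<in> B" using z(1) P(2) by blast
  have xB: "x \<notin> B" using x Q(2) by blast
  have mem: "z \<in> P <#> Q" "x \<in> P <#> Q"
    using z(1) x(1) subset_set_mult_left[OF P(1) Q(1)] subset_set_mult_right[OF P(1) Q(1)] by auto
  have "x \<otimes> z \<noteq> z \<otimes> x"
    using malnormal_commuting_mem[OF B(1) B.subset zB z(2), of x] x(1) xB by auto
  then show "non_abelian (P <#> Q) G" using mem unfolding non_abelian_def by blast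
  have "centralizer G (P <#> Q) \<subseteq> {\<one>}"
  proof
    fix c assume "c \<in> centralizer G (P <#> Q)"
    then have c: "c \<in> carrier G" "c \<otimes> z = z \<otimes> c" "c \<otimes> x = x \<otimes> c"
      using mem by (auto simp: centralizer_def)
    then have "c \<in> B" using malnormal_commuting_mem[OF B(1) B.subset zB z(2)] by blast
    then show "c \<in> {\<one>}"
      using malnormal_commuting_mem[OF B(1) B.subset, of c x] c(3) x(1) xB by auto
  qed
  then show "self_centralizing (P <#> Q) G"
    using subgroup_set_mult[OF P(1) Q(1,4)] subgroup.one_closed
    by (auto simp: self_centralizing_def)
qed

lemma inter_normalizer_trivial_if_fixed_point_free:
  assumes P: "subgroup P G" "P \<noteq> {\<one>}" and D: "D \<lhd> G" "D \<inter> P = {\<one>}" "fixed_point_free G P D"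
  shows "D \<inter> normalizer G P = {\<one>}"
proof -
  have subgroup_D: "subgroup D G" and D_normal: "carrier G \<subseteq> normalizer G D"
    using D(1) by (simp_all add: normal_iff_normalizer)
  interpret D: subgroup D G by fact
  interpret P: subgroup P G by fact
  obtain z where z: "z \<in> P" "z \<noteq> \<one>" using P by (rule nontrivial_subgroupE)
  have "m = \<one>" if m: "m \<in> D" "m \<in> normalizer G P" for m
  proof -
    have "commutator G m z \<in> D \<inter> P"
      using commutator_mem_left[OF subgroup_D m(1) subsetD[OF D_normal]]
        commutator_mem_right[OF P(1) m(2) z(1)] z(1)
      by simp
    then have "z \<otimes> m = m \<otimes> z" using D(2) m(1) z(1) by (simp add: commutator_eq_one_iff)
    then show ?thesis using fixed_point_freeD[OF D(3) z m(1)] by simp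
  qed
  then show ?thesis using subgroup.one_closed[OF subgroup_normalizer[OF P(1)]] by auto
qed

lemma malnormal_inter_abelian_normal_trivial:
  assumes M: "subgroup M G" "malnormal_in G M (carrier G)" "M \<noteq> carrier G"
    and A: "A \<lhd> G" "\<not> non_abelian A G"
  shows "A \<inter> M = {\<one>}"
proof -
  have subgroup_A: "subgroup A G" and A_normal: "carrier G \<subseteq> normalizer G A"
    using A(1) by (simp_all add: normal_iff_normalizer)
  interpret A: subgroup A G by fact
  interpret M: subgroup M G by fact
  have "a = \<one>" if a: "a \<in> A" "a \<in> M" for a
  proof (rule ccontr)
    assume "a \<noteq> \<one>"
    have "A \<subseteq> M"
    proof
      fix b assume b: "b \<in> A"
      then have "b \<otimes> a = a \<otimes> b" using A(2) a(1) by (auto simp: non_abelian_def)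
      then show "b \<in> M"
        using malnormal_commuting_mem[OF M(2) M.subset a(2) \<open>a \<noteq> \<one>\<close>] b by simp
    qed
    have "g \<in> M" if "g \<in> carrier G" for g
    proof -
      have "conj_by G g a \<in> M"
        using normalizerD[OF subgroup_A _ a(1)] A_normal that \<open>A \<subseteq> M\<close> by blast
      then show ?thesis by (rule malnormal_inD[OF M(2) that a(2) \<open>a \<noteq> \<one>\<close>])
    qed
    then show False using M(3) M.subset by blast
  qed
  then show ?thesis by auto
qed

lemma abelian_normal_subgroup_exists_if_solvable:
  assumes S: "S \<lhd> G" "solvable_seq G S" "S \<noteq> {\<one>}"
  shows "\<exists>A. A \<lhd> G \<and> A \<noteq> {\<one>} \<and> \<not> non_abelian A G"
proof -
  obtain A where "subgroup A G" "A \<noteq> {\<one>}" "\<not> non_abelian A G" "normalizer G S \<subseteq> normalizer G A"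
    using solvable_abelian_subgroup_exists[OF S(2,3)] .
  then show ?thesis using S(1) unfolding normal_iff_normalizer by blast
qed

end

context finite_group
begin

lemma malnormal_in_if_TI_product:
  assumes P: "sylow_subgroup G p P (carrier G)" "P \<noteq> {\<one>}" and p: "Factorial_Ring.prime p"
    and D: "D \<lhd> G" "D \<inter> P = {\<one>}" "fixed_point_free G P D"
    and Q: "subgroup Q G" "Q \<subseteq> D" "P \<subseteq> normalizer G Q" and TI: "TI_subgroup (P <#> Q) G"
  shows "malnormal_in G Q D"
  unfolding malnormal_in_def
proof (intro ballI impI)
  interpret D: subgroup D G using D(1) by (rule normal_imp_subgroup)
  interpret Q: subgroup Q G by fact
  note P_subgroup = sylow_subgroupD[OF P(1)]
  have normalizer_disjoint: "D \<inter> normalizer G P = {\<one>}"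
    using inter_normalizer_trivial_if_fixed_point_free[OF P_subgroup(1) P(2) D] .
  let ?K = "P <#> Q"
  have subgroup_K: "subgroup ?K G" using subgroup_set_mult[OF P_subgroup(1) Q(1,3)] .
  fix d y assume d: "d \<in> D" and y: "y \<in> Q" "y \<noteq> \<one>" "conj_by G d y \<in> Q"
  have "Q \<subseteq> ?K" using subset_set_mult_right[OF P_subgroup(1) Q(1)] .
  then have "d \<in> normalizer G ?K" using TI_subgroupD[OF TI D.mem_carrier[OF d] _ y(2)] y by blast
  moreover have "sylow_subgroup G p P ?K"
    using sylow_subgroup_intermediate[OF P(1) subgroup_self subgroup_K]
      subset_set_mult_left[OF P_subgroup(1) Q(1)] subgroup.subset[OF subgroup_K] by blast
  ultimately have "d \<in> ?K <#> normalizer G P" using frattini_argument[OF subgroup_K _ p] by blast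
  then obtain k n where d_factors: "k \<in> Q <#> P" "n \<in> normalizer G P" "d = k \<otimes> n"
    using set_mult_commute[OF P_subgroup(1) Q(1,3)] by (metis set_multE)
  then obtain v u where k_factors: "v \<in> Q" "u \<in> P" "k = v \<otimes> u" by (metis set_multE)
  have "u \<otimes> n \<in> normalizer G P"
    using k_factors(2) d_factors(2) subgroup_subset_normalizer[OF P_subgroup(1)]
      subgroup.m_closed[OF subgroup_normalizer[OF P_subgroup(1)]] by blast
  moreover have "u \<otimes> n = inv v \<otimes> d"
    using d_factors k_factors P_subgroup(3) normalizer_subset[of P]
    by (simp add: m_assoc subset_iff)
  then have "u \<otimes> n \<in> D" using k_factors(1) Q(2) d by auto
  ultimately have "u \<otimes> n = \<one>" using normalizer_disjoint by blast
  then show "d \<in> Q"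
    using d_factors(2,3) k_factors P_subgroup(3) normalizer_subset[of P]
    by (simp add: m_assoc subset_iff)
qed

lemma solvable_trivial_if_TI_product:
  assumes P: "sylow_subgroup G p P (carrier G)" "P \<noteq> {\<one>}" and p: "Factorial_Ring.prime p"
    and D: "perfect_subgroup G D" "D \<lhd> G" "D \<inter> P = {\<one>}" "fixed_point_free G P D"
    and Q: "solvable_seq G Q" "Q \<subseteq> D" "P \<subseteq> normalizer G Q" and TI: "TI_subgroup (P <#> Q) G"
  shows "Q = {\<one>}"
proof -
  have subgroup_Q: "subgroup Q G" using Q(1) by (rule solvable_imp_subgroup)
  have "malnormal_in G Q D"
    using P p D(2-4) subgroup_Q Q(2,3) TI by (rule malnormal_in_if_TI_product)
  then have "perfect_subgroup G Q"
    using perfect_subgroup_if_malnormal[OF D(1) subgroup_Q Q(2)] by simp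
  then show ?thesis using Q(1) by (rule perfect_subset_solvable_trivial) simp
qed

lemma sylow_subgroup_if_malnormal:
  assumes M: "subgroup M G" "malnormal_in G M (carrier G)" and p: "Factorial_Ring.prime p"
    and P: "sylow_subgroup G p P M" "P \<noteq> {\<one>}"
  shows "sylow_subgroup G p P (carrier G)"
proof -
  note P_subgroup = sylow_subgroupD[OF P(1)]
  obtain Q where Q: "sylow_subgroup G p Q (carrier G)"
    using sylow_subgroup_exists[OF subgroup_self p] .
  obtain g where g: "g \<in> carrier G" "P \<subseteq> conj_by G g ` Q"
    using p_subgroup_subset_sylow_conjugate[OF Q P_subgroup(2) subgroup.subset[OF P_subgroup(1)]
      subgroup_self p]
    by blast
  let ?S = "conj_by G g ` Q"
  have S: "sylow_subgroup G p ?S (carrier G)"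
    using sylow_subgroup_conj_by_image[OF Q subgroup_self] g(1)
      subgroup_subset_normalizer[OF subgroup_self] by blast
  note S_subgroup = sylow_subgroupD[OF S]
  have "P = ?S"
  proof (rule ccontr)
    assume "P \<noteq> ?S"
    then have "P \<subset> ?S" using g(2) by blast
    then obtain s where s: "s \<in> ?S" "s \<notin> P" "s \<in> normalizer G P"
      by (rule p_subgroup_normalizer_grows[OF S_subgroup(2) p P_subgroup(1)])
    obtain y where y: "y \<in> P" "y \<noteq> \<one>" using P_subgroup(1) P(2) by (rule nontrivial_subgroupE)
    have "s \<in> M"
      using malnormal_inD[OF M(2) _ _ y(2)] s(1,3) y(1) P_subgroup(3) S_subgroup(3)
        normalizerD[OF P_subgroup(1)]
      by blast
    have subgroup_inter: "subgroup (?S \<inter> M) G"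
      using S_subgroup(1) M(1) by (rule subgroups_Inter_pair)
    have "card (?S \<inter> M) \<le> card P"
      using card_p_subgroup_le_sylow[OF P(1) p_subgroup_subset[OF S_subgroup(2) subgroup_inter _ p]
        _ M(1) p] by simp
    then have "P = ?S \<inter> M"
      using finite_subgroup[OF subgroup_inter] g(2) P_subgroup(3) by (intro card_seteq) auto
    then show False using s(1,2) \<open>s \<in> M\<close> by blast
  qed
  then show ?thesis using S by simp
qed

end

section \<open>Existence of an abelian normal subgroup\<close>

locale malnormal_sylow = finite_group +
  fixes p :: nat and M P :: "'a set"
  assumes prime_p: "Factorial_Ring.prime p"
    and subgroup_M: "subgroup M G" and M_proper: "M \<noteq> carrier G"
    and M_malnormal: "malnormal_in G M (carrier G)" and M_non_abelian: "non_abelian M G"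
    and sylow_P: "sylow_subgroup G p P (carrier G)" and P_subset_M: "P \<subseteq> M"
    and P_nontrivial: "P \<noteq> {\<one>}"
    and TI_or_subnormal: "\<And>L. self_centralizing L G \<Longrightarrow> non_abelian L G \<Longrightarrow> P \<subseteq> L \<Longrightarrow>
      TI_subgroup L G \<or> subnormal G L"
begin

sublocale M: subgroup M G by (rule subgroup_M)
sublocale P: subgroup P G using sylow_P by (rule sylow_subgroupD)

lemma P_nontrivial_element: obtains z where "z \<in> P" "z \<noteq> \<one>"
  using P.subgroup_axioms P_nontrivial by (rule nontrivial_subgroupE)

lemma normalizer_P_subset_M: "normalizer G P \<subseteq> M"
proof
  fix g assume g: "g \<in> normalizer G P"
  obtain z where z: "z \<in> P" "z \<noteq> \<one>" by (rule P_nontrivial_element)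
  have "conj_by G g z \<in> M" using normalizerD[OF P.subgroup_axioms g z(1)] P_subset_M by blast
  then show "g \<in> M"
    using malnormal_inD[OF M_malnormal _ _ z(2)] g z(1) P_subset_M normalizer_subset by blast
qed

lemma centralizer_subset_normalizer_P: "P \<subseteq> L \<Longrightarrow> centralizer G L \<subseteq> normalizer G P"
  using centralizer_antimono centralizer_subset_normalizer[OF P.subset] by blast

lemma sylow_P_in: "subgroup K G \<Longrightarrow> P \<subseteq> K \<Longrightarrow> sylow_subgroup G p P K"
  using sylow_subgroup_intermediate[OF sylow_P subgroup_self] subgroup.subset by blast

lemma normalizer_subset_mult_normalizer_P:
  "subgroup K G \<Longrightarrow> P \<subseteq> K \<Longrightarrow> normalizer G K \<subseteq> K <#> normalizer G P"
  using frattini_argument[OF _ sylow_P_in prime_p] .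

lemma TI_if_self_centralizing:
  assumes L: "self_centralizing L G" "non_abelian L G" "P \<subseteq> L" "L \<subseteq> M"
  shows "TI_subgroup L G"
proof -
  have "subgroup L G" using L(1) by (simp add: self_centralizing_def)
  moreover have "L \<noteq> {\<one>}" using P_nontrivial L(3) P.one_closed by blast
  ultimately have "\<not> subnormal G L"
    using eq_carrier_if_malnormal_contains_subnormal[OF _ _ _ L(4) M_malnormal M.subset] M_proper
    by blast
  then show ?thesis using TI_or_subnormal[OF L(1-3)] by blast
qed

lemma normalizer_P_subset_normalizer:
  assumes "self_centralizing L G" "non_abelian L G" "P \<subseteq> L" "L \<subseteq> M"
  shows "normalizer G P \<subseteq> normalizer G L"
proof
  fix g assume g: "g \<in> normalizer G P"
  obtain z where z: "z \<in> P" "z \<noteq> \<one>" by (rule P_nontrivial_element)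
  have "conj_by G g z \<in> L" using normalizerD[OF P.subgroup_axioms g z(1)] assms(3) by blast
  then show "g \<in> normalizer G L"
    using TI_subgroupD[OF TI_if_self_centralizing[OF assms] _ _ z(2)] g z(1) assms(3)
      normalizer_subset by blast
qed

lemma normalizer_self_centralizing:
  assumes J: "self_centralizing J G" "non_abelian J G" "P \<subseteq> J" "J \<subseteq> M"
  shows "normalizer G J \<subseteq> M" "malnormal_in G (normalizer G J) (carrier G)"
proof -
  let ?B = "normalizer G J"
  have subgroup_J: "subgroup J G" using J(1) by (simp add: self_centralizing_def)
  have subgroup_B: "subgroup ?B G" using subgroup_J by (rule subgroup_normalizer)
  have JB: "J \<subseteq> ?B" using subgroup_J by (rule subgroup_subset_normalizer)
  have PB: "P \<subseteq> ?B" using J(3) JB by blast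
  have "?B \<subseteq> J <#> normalizer G P"
    using subgroup_J J(3) by (rule normalizer_subset_mult_normalizer_P)
  also have "\<dots> \<subseteq> M" using subgroup_M J(4) normalizer_P_subset_M by (rule set_mult_least)
  finally show BM: "?B \<subseteq> M" .
  have "self_centralizing ?B G" using J(1) subgroup_B JB by (rule self_centralizing_mono)
  then have TI: "TI_subgroup ?B G"
    using TI_if_self_centralizing non_abelian_mono[OF J(2) JB] PB BM by blast
  have "normalizer G ?B \<subseteq> ?B <#> normalizer G P"
    using subgroup_B PB by (rule normalizer_subset_mult_normalizer_P)
  also have "\<dots> \<subseteq> ?B"
    using normalizer_P_subset_normalizer[OF J] by (intro set_mult_least[OF subgroup_B]) auto
  finally show "malnormal_in G ?B (carrier G)"
    unfolding malnormal_in_def using TI_subgroupD[OF TI] by blast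
qed

lemma normalizer_conj_mem_cyc_mult:
  assumes J: "self_centralizing J G" "non_abelian J G" "P \<subseteq> J" "J \<subseteq> M"
    and x: "x \<in> normalizer G J" and g: "g \<in> normalizer G J"
  shows "conj_by G g x \<in> cyc x <#> J"
proof -
  have subgroup_J: "subgroup J G" using J(1) by (simp add: self_centralizing_def)
  have x_carrier: "x \<in> carrier G" using x normalizer_subset by blast
  have cyc_x: "subgroup (cyc x) G" "cyc x \<subseteq> normalizer G J"
    using x_carrier subgroup_cyc cyc_subset[OF subgroup_normalizer[OF subgroup_J] x] by auto
  let ?K = "cyc x <#> J"
  have subgroup_K: "subgroup ?K G" using cyc_x(1) subgroup_J cyc_x(2) by (rule subgroup_set_mult)
  have JK: "J \<subseteq> ?K" using cyc_x(1) subgroup_J by (rule subset_set_mult_right)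
  have "cyc x \<subseteq> M" using cyc_x(2) normalizer_self_centralizing(1)[OF J] by blast
  then have "?K \<subseteq> M" using subgroup_M J(4) by (simp add: set_mult_least)
  then have "normalizer G P \<subseteq> normalizer G ?K"
    using self_centralizing_mono[OF J(1) subgroup_K JK] non_abelian_mono[OF J(2) JK] J(3) JK
    by (intro normalizer_P_subset_normalizer) auto
  moreover have "J \<subseteq> normalizer G ?K" using JK subgroup_subset_normalizer[OF subgroup_K] by blast
  ultimately have "J <#> normalizer G P \<subseteq> normalizer G ?K"
    by (intro set_mult_least[OF subgroup_normalizer[OF subgroup_K]])
  then have "g \<in> normalizer G ?K"
    using g normalizer_subset_mult_normalizer_P[OF subgroup_J J(3)] by blast
  moreover have "x \<in> ?K" using subset_set_mult_left[OF cyc_x(1) subgroup_J] mem_cyc by blast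
  ultimately show ?thesis by (rule normalizerD[OF subgroup_K])
qed

lemma perfect_in_normalizer_subset:
  assumes J: "self_centralizing J G" "non_abelian J G" "P \<subseteq> J" "J \<subseteq> M"
    and Z: "perfect_subgroup G Z" "Z \<subseteq> normalizer G J"
  shows "Z \<subseteq> J"
proof -
  have subgroup_J: "subgroup J G" using J(1) by (simp add: self_centralizing_def)
  interpret J: subgroup J G by fact
  show ?thesis
  proof (rule perfect_subset_if_commuting_conjugates[OF Z(1) subgroup_J Z(2)])
    fix x g assume "x \<in> Z" "g \<in> Z"
    then have x: "x \<in> normalizer G J" and g: "g \<in> normalizer G J" using Z(2) by auto
    then have x_carrier: "x \<in> carrier G" using normalizer_subset by blast
    obtain y j where y: "y \<in> cyc x" and j: "j \<in> J" and conj: "conj_by G g x = y \<otimes> j"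
      using normalizer_conj_mem_cyc_mult[OF J x g] by (rule set_multE)
    have y_normalizer: "y \<in> normalizer G J"
      using y cyc_subset[OF subgroup_normalizer[OF subgroup_J] x] by blast
    have y_carrier: "y \<in> carrier G" using y_normalizer normalizer_subset by blast
    have "x \<otimes> y = y \<otimes> x" using cyc_abelian[OF x_carrier] y mem_cyc by (auto simp: non_abelian_def)
    then have "commutator G x (conj_by G g x) = conj_by G y (commutator G x j)"
      using x_carrier y_carrier j commutator_eq_one_iff[of x y]
      by (simp add: conj commutator_mult_right)
    then show "commutator G x (conj_by G g x) \<in> J"
      using commutator_mem_right[OF subgroup_J x j] normalizerD[OF subgroup_J y_normalizer] by simp
  qed
qed

lemma times_centralizer_overgroup:
  assumes L: "subgroup L G" "non_abelian L G" "P \<subseteq> L" "L \<subseteq> M"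
  shows "self_centralizing (times_centralizer G L) G" "non_abelian (times_centralizer G L) G"
    "P \<subseteq> times_centralizer G L" "times_centralizer G L \<subseteq> M"
proof -
  have L_subset: "L \<subseteq> times_centralizer G L" using L(1) by (rule subset_times_centralizer)
  show "self_centralizing (times_centralizer G L) G"
    using L(1) by (rule self_centralizing_times_centralizer)
  show "non_abelian (times_centralizer G L) G" using L(2) L_subset by (rule non_abelian_mono)
  show "P \<subseteq> times_centralizer G L" using L(3) L_subset by blast
  have "centralizer G L \<subseteq> M"
    using centralizer_subset_normalizer_P[OF L(3)] normalizer_P_subset_M by blast
  then show "times_centralizer G L \<subseteq> M" using subgroup_M L(4) by (simp add: times_centralizer_least)
qed

lemma centralizing_commutes_with_conjugates:
  assumes L: "subgroup L G" "non_abelian L G" "P \<subseteq> L" "L \<subseteq> M"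
    and y: "y \<in> centralizer G L" and g: "g \<in> centralizer G L"
  shows "y \<otimes> conj_by G g y = conj_by G g y \<otimes> y"
proof -
  let ?L = "L <#> cyc y"
  have y_carrier: "y \<in> carrier G" using y centralizer_subset by blast
  note product = subgroup_mult_cyc_if_centralizing[OF L(1) y]
  have L_subset: "L \<subseteq> ?L" using L(1) subgroup_cyc[OF y_carrier] by (rule subset_set_mult_left)
  have y_mem: "y \<in> ?L"
    using subset_set_mult_right[OF L(1) subgroup_cyc[OF y_carrier]] mem_cyc by blast
  have "y \<in> M" using y centralizer_subset_normalizer_P[OF L(3)] normalizer_P_subset_M by blast
  then have "?L \<subseteq> M" using subgroup_M L(4) by (simp add: set_mult_least cyc_subset)
  then have overgroup: "self_centralizing (times_centralizer G ?L) G"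
      "non_abelian (times_centralizer G ?L) G"
    "P \<subseteq> times_centralizer G ?L" "times_centralizer G ?L \<subseteq> M"
    using L(3) L_subset non_abelian_mono[OF L(2) L_subset] product(1)
    by (intro times_centralizer_overgroup; auto)+
  have "g \<in> normalizer G (times_centralizer G ?L)"
    using g centralizer_subset_normalizer_P[OF L(3)] normalizer_P_subset_normalizer[OF overgroup]
    by blast
  then have "conj_by G g y \<in> times_centralizer G ?L"
    using normalizerD[OF subgroup_times_centralizer[OF product(1)]] y_mem
      subset_times_centralizer[OF product(1)]
    by blast
  then have "conj_by G g y \<in> centralizer G {y}"
    using times_centralizer_subset_centralizer[OF product(1) y_mem product(2)] by blast
  then show ?thesis by (simp add: centralizer_def)
qed

lemma perfect_centralizing_trivial:
  assumes L: "subgroup L G" "non_abelian L G" "P \<subseteq> L" "L \<subseteq> M"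
    and Z: "perfect_subgroup G Z" "Z \<subseteq> centralizer G L"
  shows "Z = {\<one>}"
proof -
  interpret Z: subgroup Z G using Z(1) by (rule perfect_subgroupD)
  have "Z \<subseteq> {\<one>}"
  proof (rule perfect_subset_if_commuting_conjugates[OF Z(1) triv_subgroup])
    show "Z \<subseteq> normalizer G {\<one>}" by (auto simp: mem_normalizer_iff)
    show "commutator G y (conj_by G g y) \<in> {\<one>}" if "y \<in> Z" "g \<in> Z" for y g
      using centralizing_commutes_with_conjugates[OF L, of y g] that Z(2)
      by (auto simp: commutator_eq_one_iff)
  qed
  then show ?thesis using Z.one_closed by blast
qed

lemma minimal_non_abelian_overgroup_exists:
  obtains L where "subgroup L G" "non_abelian L G" "P \<subseteq> L" "L \<subseteq> M" "solvable_seq G L"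
proof -
  let ?candidates = "{L. subgroup L G \<and> P \<subseteq> L \<and> L \<subseteq> M \<and> non_abelian L G}"
  have "finite ?candidates"
    using finite_subgroup[OF subgroup_M] by (auto intro: finite_subset[of _ "Pow M"])
  moreover have "M \<in> ?candidates" using subgroup_M P_subset_M M_non_abelian by simp
  ultimately have "\<exists>L \<in> ?candidates. L \<subseteq> M \<and> (\<forall>K \<in> ?candidates. K \<subseteq> L \<longrightarrow> L = K)"
    by (rule finite_has_minimal2)
  then obtain L where L: "L \<in> ?candidates" "\<forall>K \<in> ?candidates. K \<subseteq> L \<longrightarrow> L = K" by blast
  interpret minimal_non_abelian_over_sylow G p L P
  proof (intro minimal_non_abelian_over_sylow.intro minimal_non_abelian_over_sylow_axioms.intro
      finite_group_axioms prime_p)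
    show "sylow_subgroup G p P L" using L(1) by (simp add: sylow_P_in)
    show "\<not> non_abelian K G" if "subgroup K G" "P \<subseteq> K" "K \<subset> L" for K
    proof
      assume "non_abelian K G"
      then have "K \<in> ?candidates" using that L(1) by auto
      then show False using L(2) that(3) by blast
    qed
  qed (use L(1) in simp)
  show thesis using that L(1) solvable_L by blast
qed

theorem malnormal_avoiding_perfect_normal:
  assumes D: "perfect_subgroup G D" "D \<lhd> G"
  obtains B where "subgroup B G" "P \<subseteq> B" "malnormal_in G B (carrier G)" "D \<inter> B = {\<one>}"
proof -
  obtain L where L: "subgroup L G" "non_abelian L G" "P \<subseteq> L" "L \<subseteq> M" "solvable_seq G L"
    by (rule minimal_non_abelian_overgroup_exists)
  let ?J = "times_centralizer G L"
  note J = times_centralizer_overgroup[OF L(1-4)]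
  let ?B = "normalizer G ?J"
  have subgroup_J: "subgroup ?J G" using L(1) by (rule subgroup_times_centralizer)
  have subgroup_B: "subgroup ?B G" using subgroup_J by (rule subgroup_normalizer)
  have B_malnormal: "malnormal_in G ?B (carrier G)" using J by (rule normalizer_self_centralizing)
  have subgroup_D: "subgroup D G" using D(1) by (rule perfect_subgroupD)
  have "subgroup (D \<inter> ?B) G" using subgroup_D subgroup_B by (rule subgroups_Inter_pair)
  moreover have "malnormal_in G (D \<inter> ?B) D"
    using B_malnormal subgroup.subset[OF subgroup_D] by (rule malnormal_in_inter)
  ultimately have perfect: "perfect_subgroup G (D \<inter> ?B)"
    using perfect_subgroup_if_malnormal[OF D(1)] by simp
  have "D \<inter> ?B \<subseteq> ?J" using perfect_in_normalizer_subset[OF J perfect] by simp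
  then have "D \<inter> ?B \<subseteq> centralizer G L"
    using perfect_subset_if_solvable_mod[OF perfect L(5)
      subgroup_centralizer[OF subgroup.subset[OF L(1)]]
        subgroup_subset_normalizer_centralizer[OF L(1)]]
    by (simp add: times_centralizer_def)
  then have "D \<inter> ?B = {\<one>}" using perfect_centralizing_trivial[OF L(1-4) perfect] by simp
  moreover have "P \<subseteq> ?B" using J(3) subgroup_subset_normalizer[OF subgroup_J] by blast
  ultimately show thesis using that[OF subgroup_B _ B_malnormal] by simp
qed

lemma normal_sylow_of_perfect_normal:
  assumes D: "perfect_subgroup G D" "D \<lhd> G" and q: "Factorial_Ring.prime q" "q dvd card D"
  obtains Q where "sylow_subgroup G q Q D" "Q \<lhd> G"
proof -
  obtain B where B: "subgroup B G" "P \<subseteq> B" "malnormal_in G B (carrier G)" "D \<inter> B = {\<one>}"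
    using D by (rule malnormal_avoiding_perfect_normal)
  have subgroup_D: "subgroup D G" and D_normal: "carrier G \<subseteq> normalizer G D"
    using D(2) by (simp_all add: normal_iff_normalizer)
  interpret D: subgroup D G by fact
  have DP: "D \<inter> P = {\<one>}" using B(2,4) P.one_closed by auto
  have "sylow_subgroup G p (D \<inter> P) D"
    using
      sylow_subgroup_inter_normal[OF sylow_P subgroup_self subgroup_D D.subset D_normal prime_p] .
  then have "\<not> p dvd card D" by (simp add: DP sylow_subgroup_def)
  then obtain Q where Q: "sylow_subgroup G q Q D" "P \<subseteq> normalizer G Q"
    using sylow_subgroup_invariant_exists_coprime[OF sylow_subgroupD(2)[OF sylow_P] _ prime_p
      subgroup_D _ q(1)]
      D_normal P.subset by blast
  note Q_subgroup = sylow_subgroupD[OF Q(1)]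
  have Q_nontrivial: "Q \<noteq> {\<one>}" using Q(1) q(2) by (rule sylow_subgroup_nontrivial)
  have "Q \<inter> B = {\<one>}" using B(4) Q_subgroup(3) subgroup.one_closed[OF Q_subgroup(1)] by blast
  then have "TI_subgroup (P <#> Q) G \<or> subnormal G (P <#> Q)"
    using malnormal_product_self_centralizing[OF B(3,1) P.subgroup_axioms B(2) P_nontrivial
      Q_subgroup(1) _
        Q_nontrivial Q(2)] subset_set_mult_left[OF P.subgroup_axioms Q_subgroup(1)]
    by (intro TI_or_subnormal)
  then show thesis
  proof
    assume "TI_subgroup (P <#> Q) G"
    moreover have "fixed_point_free G P D"
      using B(3,1,2) D.subset B(4) by (rule fixed_point_free_if_malnormal)
    ultimately have "Q = {\<one>}"
      using solvable_trivial_if_TI_product[OF sylow_P P_nontrivial prime_p D DP _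
          p_subgroup_solvable[OF Q_subgroup(2) q(1)] Q_subgroup(3) Q(2)] by simp
    then show thesis using Q_nontrivial by simp
  next
    assume subnormal: "subnormal G (P <#> Q)"
    have "P <#> Q \<subseteq> normalizer G Q"
      using subgroup_normalizer[OF Q_subgroup(1)] Q(2) subgroup_subset_normalizer[OF Q_subgroup(1)]
      by (rule set_mult_least)
    then have "Q \<lhd> G"
      using sylow_subgroup_normal_if_subnormal_between[OF subnormal _ _ D(2) Q(1) q(1)]
        subset_set_mult_right[OF P.subgroup_axioms Q_subgroup(1)] by simp
    then show thesis using that Q(1) by blast
  qed
qed

theorem abelian_normal_subgroup_exists: "\<exists>A. A \<lhd> G \<and> A \<noteq> {\<one>} \<and> \<not> non_abelian A G"
proof (rule solvable_or_perfect_subgroup[OF subgroup_self])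
  assume "solvable_seq G (carrier G)"
  moreover have "carrier G \<noteq> {\<one>}" using P_nontrivial P.subset P.one_closed by blast
  ultimately show ?thesis using abelian_normal_subgroup_exists_if_solvable[OF normal_self] by simp
next
  fix D assume D: "perfect_subgroup G D" "D \<noteq> {\<one>}" "normalizer G (carrier G) \<subseteq> normalizer G D"
  have subgroup_D: "subgroup D G" using D(1) by (rule perfect_subgroupD)
  have "D \<lhd> G"
    using subgroup_D D(3) subgroup_subset_normalizer[OF subgroup_self]
    by (auto simp: normal_iff_normalizer)
  obtain q where q: "Factorial_Ring.prime q" "q dvd card D"
    using D(2) card_subgroup_eq_one_iff[OF subgroup_D] prime_factor_nat by blast
  obtain Q where Q: "sylow_subgroup G q Q D" "Q \<lhd> G"
    using D(1) \<open>D \<lhd> G\<close> q by (rule normal_sylow_of_perfect_normal)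
  then show ?thesis
    using abelian_normal_subgroup_exists_if_solvable[OF Q(2) p_subgroup_solvable[OF _ q(1)]]
      sylow_subgroupD(2) sylow_subgroup_nontrivial q(2) by blast
qed

end

section \<open>Fixed-point-free action on an abelian group\<close>

lemma (in comm_monoid) finprod_swap:
  assumes "\<And>i j. i \<in> I \<Longrightarrow> j \<in> J \<Longrightarrow> f i j \<in> carrier G"
  shows "(\<Otimes>i\<in>I. \<Otimes>j\<in>J. f i j) = (\<Otimes>j\<in>J. \<Otimes>i\<in>I. f i j)"
  using assms
proof (induction I rule: infinite_finite_induct)
  case (insert i I)
  then have "(\<Otimes>k\<in>insert i I. \<Otimes>j\<in>J. f k j) = (\<Otimes>j\<in>J. f i j) \<otimes> (\<Otimes>j\<in>J. \<Otimes>k\<in>I. f k j)"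
    by (simp add: Pi_iff)
  also have "\<dots> = (\<Otimes>j\<in>J. f i j \<otimes> (\<Otimes>k\<in>I. f k j))"
    using insert.prems by (intro finprod_multf[symmetric]) auto
  also have "\<dots> = (\<Otimes>j\<in>J. \<Otimes>k\<in>insert i I. f k j)"
    using insert by (intro finprod_cong') (auto simp: Pi_iff)
  finally show ?case .
qed simp_all

lemma (in comm_group) hom_finprod:
  assumes "comm_group H" "h \<in> hom G H" "f \<in> S \<rightarrow> carrier G"
  shows "h (finprod G f S) = finprod H (\<lambda>i. h (f i)) S"
proof -
  interpret H: comm_group H by fact
  interpret group_hom G H h using assms(2) by unfold_locales
  show ?thesis using assms(3) by (induction S rule: infinite_finite_induct) (simp_all add: Pi_iff)
qed

lemma (in comm_group) finprod_lessThan_shift: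
  assumes "f \<in> {..n} \<rightarrow> carrier G" "f n = f 0"
  shows "(\<Otimes>i\<in>{..<n}. f (Suc i)) = (\<Otimes>i\<in>{..<n}. f i)"
proof (cases n)
  case (Suc m)
  have "(\<Otimes>i\<in>{..m}. f (Suc i)) \<otimes> f 0 = f (Suc m) \<otimes> (\<Otimes>i\<in>{..m}. f i)"
    using assms(1) finprod_Suc[of f m] finprod_Suc2[of f m] by (simp add: Suc)
  moreover have "(\<Otimes>i\<in>{..m}. f (Suc i)) \<in> carrier G" "(\<Otimes>i\<in>{..m}. f i) \<in> carrier G" "f 0 \<in> carrier G"
    using assms(1) by (auto simp: Suc Pi_iff)
  ultimately show ?thesis
    using assms(2) m_comm by (simp add: Suc lessThan_Suc_atMost)
qed simp

definition conj_norm :: "('a, 'b) monoid_scheme \<Rightarrow> 'a set \<Rightarrow> nat \<Rightarrow> 'a \<Rightarrow> 'a \<Rightarrow> 'a" where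
  "conj_norm G A n w a = finprod (G\<lparr>carrier := A\<rparr>) (\<lambda>i. conj_by G (w [^]\<^bsub>G\<^esub> i) a) {..<n}"

definition rank_le_one_at :: "('a, 'b) monoid_scheme \<Rightarrow> nat \<Rightarrow> 'a set \<Rightarrow> bool" where
  "rank_le_one_at G r K \<longleftrightarrow> (\<forall>u \<in> K. \<forall>v \<in> K. u \<otimes>\<^bsub>G\<^esub> v = v \<otimes>\<^bsub>G\<^esub> u \<longrightarrow>
    u [^]\<^bsub>G\<^esub> r = \<one>\<^bsub>G\<^esub> \<longrightarrow> v [^]\<^bsub>G\<^esub> r = \<one>\<^bsub>G\<^esub> \<longrightarrow> v \<noteq> \<one>\<^bsub>G\<^esub> \<longrightarrow> u \<in> generate G {v})"

context group
begin

lemma hom_conj_by_restrict: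
  assumes "subgroup A G" "g \<in> normalizer G A"
  shows "conj_by G g \<in> hom (G\<lparr>carrier := A\<rparr>) (G\<lparr>carrier := A\<rparr>)"
  using assms normalizerD[OF assms] normalizer_subset[of A] subgroup.mem_carrier[OF assms(1)]
  by (auto simp: hom_def conj_by_mult)

lemma ord_eq_prime:
  "x \<in> carrier G \<Longrightarrow> x [^] (r::nat) = \<one> \<Longrightarrow> x \<noteq> \<one> \<Longrightarrow> Factorial_Ring.prime r \<Longrightarrow> ord x = r"
  by (metis ord_eq_1 pow_eq_id prime_nat_iff)

lemma pow_mult_pow_if_commuting:
  assumes "u \<in> carrier G" "v \<in> carrier G" "u \<otimes> v = v \<otimes> u"
  shows "(u \<otimes> v [^] (j::nat)) [^] (i::nat) = u [^] i \<otimes> (v [^] i) [^] j"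
proof -
  have "u \<otimes> v [^] j = v [^] j \<otimes> u"
    using group_commutes_pow[OF assms(3)[symmetric] assms(2,1)] by simp
  then have "(u \<otimes> v [^] j) [^] i = u [^] i \<otimes> (v [^] j) [^] i"
    using assms(1,2) by (intro pow_mult_distrib) auto
  then show ?thesis using assms(2) by (simp add: nat_pow_pow mult.commute)
qed

lemma mem_conj_norm:
  assumes "subgroup A G" "\<not> non_abelian A G" "w \<in> normalizer G A" "a \<in> A"
  shows "conj_by G (w [^] (i::nat)) a \<in> A" "conj_norm G A n w a \<in> A"
proof -
  interpret group_A: comm_group "G\<lparr>carrier := A\<rparr>" using assms(1,2) by (rule comm_group_if_abelian)
  show mem: "conj_by G (w [^] i) a \<in> A" for i :: nat
    using normalizerD[OF assms(1) subgroup_pow_closed[OF subgroup_normalizer[OF assms(1)] assms(3)]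
      assms(4)] .
  show "conj_norm G A n w a \<in> A"
    unfolding conj_norm_def using group_A.finprod_closed[of _ "{..<n}"] mem by simp
qed

lemma conj_by_conj_norm:
  assumes "subgroup A G" "\<not> non_abelian A G" "w \<in> normalizer G A" "a \<in> A" "g \<in> normalizer G A"
  shows "conj_by G g (conj_norm G A n w a) =
    finprod (G\<lparr>carrier := A\<rparr>) (\<lambda>i. conj_by G g (conj_by G (w [^] i) a)) {..<n}"
proof -
  interpret group_A: comm_group "G\<lparr>carrier := A\<rparr>" using assms(1,2) by (rule comm_group_if_abelian)
  show ?thesis
    unfolding conj_norm_def using mem_conj_norm(1)[OF assms(1-4)]
    by (intro group_A.hom_finprod group_A.comm_group_axioms hom_conj_by_restrict assms) simp
qed

lemma conj_norm_one:
  assumes "subgroup A G" "\<not> non_abelian A G" "a \<in> A"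
  shows "conj_norm G A n \<one> a = a [^] n"
proof -
  interpret group_A: comm_group "G\<lparr>carrier := A\<rparr>" using assms(1,2) by (rule comm_group_if_abelian)
  show ?thesis
    using assms(3) subgroup.mem_carrier[OF assms(1,3)] group_A.finprod_const[of a "{..<n}"]
    by (simp add: conj_norm_def nat_pow_consistent[symmetric])
qed

lemma conj_norm_eq_one:
  assumes A: "subgroup A G" "\<not> non_abelian A G" "w \<in> normalizer G A" "a \<in> A"
    and w: "w [^] n = \<one>" "\<And>b. b \<in> A \<Longrightarrow> w \<otimes> b = b \<otimes> w \<Longrightarrow> b = \<one>"
  shows "conj_norm G A n w a = \<one>"
proof -
  interpret A: subgroup A G by fact
  interpret group_A: comm_group "G\<lparr>carrier := A\<rparr>" using A(1,2) by (rule comm_group_if_abelian)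
  have w_carrier: "w \<in> carrier G" using A(3) normalizer_subset by blast
  have "conj_by G w (conj_norm G A n w a) =
      finprod (G\<lparr>carrier := A\<rparr>) (\<lambda>i. conj_by G (w [^] Suc i) a) {..<n}"
    unfolding conj_by_conj_norm[OF A A(3)] using w_carrier A(4)
    by (simp add: conj_by_conj_by nat_pow_Suc2[symmetric] del: nat_pow_Suc)
  also have "\<dots> = conj_norm G A n w a"
    unfolding conj_norm_def using mem_conj_norm(1)[OF A] w(1)
    by (intro group_A.finprod_lessThan_shift) (simp_all del: nat_pow_Suc)
  finally have "conj_by G w (conj_norm G A n w a) = conj_norm G A n w a" .
  then show ?thesis
    using mem_conj_norm(2)[OF A] w(2) w_carrier by (simp add: conj_by_eq_self_iff)
qed

lemma finprod_conj_norm_mult_pow: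
  assumes A: "subgroup A G" "\<not> non_abelian A G" "a \<in> A"
    and uv: "u \<in> normalizer G A" "v \<in> normalizer G A" "u \<otimes> v = v \<otimes> u"
  shows "finprod (G\<lparr>carrier := A\<rparr>) (\<lambda>j. conj_norm G A n (u \<otimes> v [^] j) a) {..<n} =
    finprod (G\<lparr>carrier := A\<rparr>) (\<lambda>i. conj_by G (u [^] i) (conj_norm G A n (v [^] i) a)) {..<n}"
proof -
  let ?A = "G\<lparr>carrier := A\<rparr>"
  interpret group_A: comm_group ?A using A(1,2) by (rule comm_group_if_abelian)
  interpret N: subgroup "normalizer G A" G using A(1) by (rule subgroup_normalizer)
  have pow_N: "w [^] i \<in> normalizer G A" if "w \<in> normalizer G A" for w and i :: nat
    using subgroup_pow_closed[OF N.subgroup_axioms that] .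
  have conj_eq: "conj_by G ((u \<otimes> v [^] j) [^] i) a =
      conj_by G (u [^] i) (conj_by G ((v [^] i) [^] j) a)" for i j :: nat
    using pow_mult_pow_if_commuting[OF _ _ uv(3)] uv(1,2) A(3) subgroup.mem_carrier[OF A(1)]
    by (simp add: conj_by_conj_by)
  have "finprod ?A (\<lambda>j. conj_norm G A n (u \<otimes> v [^] j) a) {..<n} =
      finprod ?A (\<lambda>i. finprod ?A (\<lambda>j. conj_by G ((u \<otimes> v [^] j) [^] i) a) {..<n}) {..<n}"
    unfolding conj_norm_def using mem_conj_norm(1)[OF A(1,2) _ A(3)] uv(1) pow_N[OF uv(2)]
    by (intro group_A.finprod_swap) simp
  also have "\<dots> = finprod ?A (\<lambda>i. conj_by G (u [^] i) (conj_norm G A n (v [^] i) a)) {..<n}"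
    unfolding conj_eq using conj_by_conj_norm[OF A(1,2) _ A(3)] pow_N uv(1,2) by simp
  finally show ?thesis .
qed

text \<open>All the norms over the subgroups generated by an element \<open>u \<otimes> v [^] j\<close> or by a power of \<open>v\<close>
  are trivial, except for the norm over the trivial subgroup, which is \<open>a [^] r\<close>.\<close>
lemma pow_prime_eq_one_if_fixed_point_free:
  fixes r :: nat
  assumes A: "subgroup A G" "\<not> non_abelian A G" "a \<in> A"
    and K: "subgroup K G" "K \<subseteq> normalizer G A" "fixed_point_free G K A"
    and r: "Factorial_Ring.prime r"
    and u: "u \<in> K" "u [^] r = \<one>" and v: "v \<in> K" "v [^] r = \<one>" "v \<noteq> \<one>"
    and uv: "u \<otimes> v = v \<otimes> u" "u \<notin> cyc v"
  shows "a [^] r = \<one>"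
proof -
  let ?A = "G\<lparr>carrier := A\<rparr>"
  interpret A: subgroup A G by fact
  interpret K: subgroup K G by fact
  interpret group_A: comm_group ?A using A(1,2) by (rule comm_group_if_abelian)
  have pow_K: "x [^] i \<in> K" if "x \<in> K" for x and i :: nat
    using K(1) that by (rule subgroup_pow_closed)
  have norm_trivial: "conj_norm G A r w a = \<one>" if "w \<in> K" "w [^] r = \<one>" "w \<noteq> \<one>" for w
    using conj_norm_eq_one[OF A(1,2) _ A(3) that(2)] that K(2,3)
    by (auto simp: fixed_point_free_def)
  have norm_uv: "conj_norm G A r (u \<otimes> v [^] j) a = \<one>" for j :: nat
  proof (rule norm_trivial)
    show "u \<otimes> v [^] j \<in> K" using u(1) pow_K[OF v(1)] by simp
    show "(u \<otimes> v [^] j) [^] r = \<one>"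
      using pow_mult_pow_if_commuting[OF _ _ uv(1), of j r] u v by simp
    show "u \<otimes> v [^] j \<noteq> \<one>"
    proof
      assume "u \<otimes> v [^] j = \<one>"
      then have "u = inv (v [^] j)" using u(1) v(1) by (simp add: inv_equality)
      moreover have "inv (v [^] j) \<in> cyc v"
        using v(1) subgroup_cyc[of v] subgroup_pow_closed[OF _ mem_cyc]
        by (simp add: subgroup.m_inv_closed)
      ultimately show False using uv(2) by simp
    qed
  qed
  have norm_v: "conj_norm G A r (v [^] i) a = \<one>" if "0 < i" "i < r" for i :: nat
  proof (rule norm_trivial[OF pow_K[OF v(1)]])
    show "(v [^] i) [^] r = \<one>" using v by (metis K.mem_carrier mult.commute nat_pow_one nat_pow_pow)
    show "v [^] i \<noteq> \<one>"
      using that v ord_eq_prime[OF _ v(2,3) r] pow_eq_id[of v i] by (auto dest: dvd_imp_le)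
  qed
  have "\<one> = finprod ?A (\<lambda>i. conj_by G (u [^] i) (conj_norm G A r (v [^] i) a)) {..<r}"
    using finprod_conj_norm_mult_pow[OF A _ _ uv(1), of r] u(1) v(1) K(2)
      group_A.finprod_one[of "{..<r}"]
    by (simp add: norm_uv subset_iff)
  also have "\<dots> = finprod ?A (\<lambda>i. if 0 = i then a [^] r else \<one>\<^bsub>?A\<^esub>) {..<r}"
    using u(1) norm_v A(3) subgroup_pow_closed[OF A(1,3)]
    by (intro group_A.finprod_cong') (auto simp: conj_norm_one[OF A(1,2)])
  also have "\<dots> = a [^] r"
    using group_A.finprod_singleton[of 0 "{..<r}" "\<lambda>_. a [^] r"] subgroup_pow_closed[OF A(1,3)]
      prime_gt_0_nat[OF r]
    by simp
  finally show ?thesis by simp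
qed

end

context finite_group
begin

lemma card_mod_eq_one_if_fixed_point_free:
  assumes P: "p_subgroup G p P" "P \<noteq> {\<one>}" and p: "Factorial_Ring.prime p"
    and A: "subgroup A G" "P \<subseteq> normalizer G A" "fixed_point_free G P A"
  shows "card A mod p = 1"
proof -
  have subgroup_P: "subgroup P G" using P(1) by (rule p_subgroup_imp_subgroup)
  interpret P: subgroup P G by fact
  interpret A: subgroup A G by fact
  obtain u where u: "u \<in> P" "u \<noteq> \<one>" using subgroup_P P(2) by (rule nontrivial_subgroupE)
  have "card A mod p = card {a \<in> A. \<forall>g \<in> P. conj_by G g a = a} mod p"
    using normalizerD[OF A(1) subsetD[OF A(2)]]
    by (intro p_subgroup_card_mod_eq_card_fixed_mod[OF P(1) p finite_subgroup[OF A(1)]])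
      (auto simp: conj_by_conj_by)
  also have "{a \<in> A. \<forall>g \<in> P. conj_by G g a = a} = {\<one>}"
    using u fixed_point_freeD[OF A(3) u] by (auto simp: conj_by_eq_self_iff)
  finally show ?thesis using prime_gt_1_nat[OF p] by simp
qed

theorem rank_le_one_if_fixed_point_free:
  fixes r :: nat
  assumes A: "subgroup A G" "\<not> non_abelian A G" "A \<noteq> {\<one>}"
    and K: "subgroup K G" "K \<subseteq> normalizer G A" "fixed_point_free G K A"
    and r: "Factorial_Ring.prime r"
  shows "rank_le_one_at G r K"
  unfolding rank_le_one_at_def
proof (intro ballI impI, rule ccontr)
  fix u v assume u: "u \<in> K" "u [^] r = \<one>" and v: "v \<in> K" "v [^] r = \<one>" "v \<noteq> \<one>"
    and uv: "u \<otimes> v = v \<otimes> u" "u \<notin> cyc v"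
  interpret K: subgroup K G by fact
  interpret A: subgroup A G by fact
  obtain a where a: "a \<in> A" "a \<noteq> \<one>" using A(1,3) by (rule nontrivial_subgroupE)
  have "a [^] r = \<one>" using A(1,2) a(1) K r u v uv by (rule pow_prime_eq_one_if_fixed_point_free)
  then have "card (cyc a) = r" using a r by (simp add: generate_pow_card[symmetric] ord_eq_prime)
  then have "r dvd card A"
    using card_subgroup_dvd[OF subgroup_cyc A(1) cyc_subset[OF A(1) a(1)]] a(1) by simp
  moreover have "card A mod r = 1"
  proof (rule card_mod_eq_one_if_fixed_point_free[OF _ _ r A(1)])
    have cyc_v: "cyc v \<subseteq> K" "subgroup (cyc v) G"
      using v(1) K(1) by (simp_all add: cyc_subset subgroup_cyc)
    have "card (cyc v) = r ^ 1" using v r by (simp add: generate_pow_card[symmetric] ord_eq_prime)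
    then show "p_subgroup G r (cyc v)" using cyc_v(2) unfolding p_subgroup_def by blast
    show "cyc v \<noteq> {\<one>}" using v(3) mem_cyc by blast
    show "cyc v \<subseteq> normalizer G A" using cyc_v(1) K(2) by blast
    show "fixed_point_free G (cyc v) A" using cyc_v(1) K(3) unfolding fixed_point_free_def by blast
  qed
  ultimately show False by (simp add: dvd_eq_mod_eq_0)
qed

end

section \<open>Central factors of groups without elementary abelian subgroups of rank two\<close>

context group
begin

lemma mem_cyc_if_pow_eq_pow:
  fixes r l :: nat
  assumes K: "subgroup K G" "rank_le_one_at G r K" and r: "Factorial_Ring.prime r"
    and y: "y \<in> K" "ord y = r ^ m" "m \<noteq> 0"
    and x: "x \<in> K" "x \<otimes> y = y \<otimes> x" "x [^] r = (y [^] l) [^] r"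
  shows "x \<in> cyc y"
proof -
  interpret K: subgroup K G by fact
  have carrier: "x \<in> carrier G" "y \<in> carrier G" using x(1) y(1) by auto
  interpret Y: subgroup "cyc y" G using carrier(2) by (rule subgroup_cyc)
  have y_pow: "y [^] i \<in> K" "y [^] i \<in> cyc y" for i :: nat
    using subgroup_pow_closed[OF K(1) y(1)] subgroup_pow_closed[OF Y.subgroup_axioms mem_cyc]
    by auto
  have centralizer_y: "subgroup (centralizer G {y}) G"
    using carrier(2) by (simp add: subgroup_centralizer)
  interpret centralizer: subgroup "centralizer G {y}" G by fact
  define u where "u = x \<otimes> inv (y [^] l)"
  define v where "v = y [^] (r ^ (m - 1))"
  have x_centralizes: "x \<in> centralizer G {y}" and y_centralizes: "y \<in> centralizer G {y}"
    using carrier x(2) by (auto intro: centralizerI)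
  have y_pow_centralizes: "y [^] i \<in> centralizer G {y}" for i :: nat
    using centralizer_y y_centralizes by (rule subgroup_pow_closed)
  have "u \<in> centralizer G {y}"
    unfolding u_def using x_centralizes y_pow_centralizes by simp
  then have "y \<otimes> u = u \<otimes> y" using centralizerD by fastforce
  then have "u \<otimes> v = v \<otimes> u"
    unfolding v_def using group_commutes_pow[of y u] carrier by (simp add: u_def)
  moreover have "u [^] r = \<one>"
  proof -
    have "x \<otimes> y [^] l = y [^] l \<otimes> x"
      using group_commutes_pow[OF x(2)[symmetric] carrier(2,1)] by simp
    then have "x \<otimes> inv (y [^] l) = inv (y [^] l) \<otimes> x"
      using carrier
      by (metis inv_closed inv_solve_left inv_solve_right m_assoc m_closed nat_pow_closed)
    then have "u [^] r = x [^] r \<otimes> inv (y [^] l) [^] r"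
      unfolding u_def using carrier by (intro pow_mult_distrib) auto
    then show ?thesis using x(3) carrier by (simp add: nat_pow_inv)
  qed
  moreover have "r ^ m = r ^ (m - 1) * r" using y(3) by (cases m) auto
  then have "v [^] r = \<one>" "v \<noteq> \<one>"
    using y(2) carrier(2) pow_eq_id[of y "r ^ m"] pow_eq_id[of y "r ^ (m - 1)"] prime_gt_1_nat[OF r]
    by (auto simp: v_def nat_pow_pow dest: dvd_imp_le)
  moreover have "u \<in> K" "v \<in> K" unfolding u_def v_def using x(1) y_pow by auto
  ultimately have "u \<in> cyc v" using K(2) by (auto simp: rank_le_one_at_def)
  moreover have "cyc v \<subseteq> cyc y" unfolding v_def using y_pow by (intro cyc_subset Y.subgroup_axioms)
  moreover have "x = u \<otimes> y [^] l" using carrier by (simp add: u_def m_assoc)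
  ultimately show ?thesis using y_pow(2) by auto
qed

lemma mem_subgroup_if_coprime_powers:
  assumes H: "subgroup H G" and y: "y \<in> carrier G" "y [^] (m::nat) \<in> H" "y [^] (n::nat) \<in> H"
    and coprime: "coprime m n" "m \<noteq> 0"
  shows "y \<in> H"
proof -
  interpret H: subgroup H G by fact
  obtain s t where "m * s = n * t + 1"
    using bezout_nat[OF coprime(2), of n] coprime(1) by (auto simp: coprime_iff_gcd_eq_1)
  then have "y [^] (m * s) = y [^] (n * t) \<otimes> y" using y(1) by (simp add: nat_pow_mult[symmetric])
  then have "y = inv (y [^] (n * t)) \<otimes> y [^] (m * s)" using y(1) by simp
  moreover have "y [^] (n * t) \<in> H" "y [^] (m * s) \<in> H"
    using subgroup_pow_closed[OF H y(3), of t] subgroup_pow_closed[OF H y(2), of s] y(1)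
    by (simp_all add: nat_pow_pow)
  ultimately show ?thesis using H.m_closed[OF H.m_inv_closed] by metis
qed

end

context finite_group
begin

lemma cyc_powE:
  assumes "y \<in> carrier G" "x \<in> cyc y"
  obtains k :: nat where "x = y [^] k"
  using assms generate_pow_on_finite_carrier[OF finite_carrier assms(1)] by blast

lemma mem_cyc_if_rank_le_one:
  fixes r :: nat
  assumes K: "subgroup K G" "rank_le_one_at G r K" and r: "Factorial_Ring.prime r"
    and y: "y \<in> K" "ord y = r ^ m"
    and "n \<le> m" "x \<in> K" "x [^] (r ^ n) = \<one>" "x \<otimes> y = y \<otimes> x"
  shows "x \<in> cyc y"
  using assms(6-9)
proof (induction n arbitrary: x)
  case 0
  then show ?case using subgroup.mem_carrier[OF K(1)] by (simp add: generate.one)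
next
  case (Suc n)
  have carrier: "x \<in> carrier G" "y \<in> carrier G"
    using Suc.prems(2) y(1) subgroup.mem_carrier[OF K(1)] by auto
  have x_pow: "(x [^] r) [^] (r ^ n) = \<one>" using Suc.prems(3) carrier by (simp add: nat_pow_pow)
  have "x [^] r \<otimes> y = y \<otimes> x [^] r" using group_commutes_pow[OF Suc.prems(4) carrier] .
  then have "x [^] r \<in> cyc y"
    using Suc.IH[OF _ _ x_pow] Suc.prems(1) subgroup_pow_closed[OF K(1) Suc.prems(2)] by simp
  then obtain k :: nat where k: "x [^] r = y [^] k" by (rule cyc_powE[OF carrier(2)])
  have "y [^] (k * r ^ n) = \<one>" using x_pow k carrier by (simp add: nat_pow_pow)
  then have "r ^ m dvd k * r ^ n" using y(2) carrier by (simp add: pow_eq_id)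
  then have "r ^ Suc n dvd k * r ^ n" using Suc.prems(1) by (meson dvd_trans le_imp_power_dvd)
  then obtain l where "k = r * l" using prime_gt_0_nat[OF r] by auto
  then have "x [^] r = (y [^] l) [^] r" using k carrier by (simp add: nat_pow_pow mult.commute)
  moreover have "m \<noteq> 0" using Suc.prems(1) by simp
  ultimately show ?case by (intro mem_cyc_if_pow_eq_pow[OF K r y _ Suc.prems(2,4)])
qed

text \<open>Apart from its \<open>r\<close>-part, \<open>c\<close> is a power of \<open>c [^] (r ^ n)\<close>.\<close>
lemma mem_subgroup_if_prime_power_part_mem:
  fixes r :: nat
  assumes H: "subgroup H G" and r: "Factorial_Ring.prime r"
    and c: "c \<in> carrier G" "c [^] (r ^ n) \<in> H"
    and part: "\<And>m k. ord (c [^] (m::nat)) = r ^ k \<Longrightarrow> c [^] m \<in> H"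
  shows "c \<in> H"
proof -
  have "ord c \<noteq> 0" using ord_ge_1[OF finite_carrier c(1)] by simp
  then obtain m where m: "ord c = r ^ multiplicity r (ord c) * m" "\<not> r dvd m"
    using multiplicity_decompose'[of "ord c" r] r by (metis not_prime_unit)
  have "m \<noteq> 0" using m(2) by (metis dvd_0_right)
  moreover from this have "ord (c [^] m) = r ^ multiplicity r (ord c)"
    using ord_pow[OF c(1), of m] m(1) by (metis dvd_triv_right nonzero_mult_div_cancel_right)
  then have "c [^] m \<in> H" by (rule part)
  moreover have "coprime m (r ^ n)"
    using r m(2) by (metis coprime_commute coprime_power_left_iff prime_imp_coprime)
  ultimately show ?thesis using mem_subgroup_if_coprime_powers[OF H c(1) _ c(2)] by blast
qed

lemma mem_if_prime_power_elements_of_centralizer_mem: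
  fixes r :: nat
  assumes H: "subgroup H G" and r: "Factorial_Ring.prime r"
    and y: "y \<in> times_centralizer G H" "y [^] (r ^ n) = \<one>"
    and centralizer: "\<And>c m. c \<in> centralizer G H \<Longrightarrow> ord c = r ^ m \<Longrightarrow> c \<in> H"
  shows "y \<in> H"
proof -
  interpret H: subgroup H G by fact
  have subgroup_C: "subgroup (centralizer G H) G" using H.subset by (rule subgroup_centralizer)
  obtain h c where y_factors: "h \<in> H" "c \<in> centralizer G H" "y = h \<otimes> c"
    using y(1) unfolding times_centralizer_def by (rule set_multE)
  have c_carrier: "c \<in> carrier G" using y_factors(2) centralizer_subset by blast
  have "h \<otimes> c = c \<otimes> h" using centralizerD[OF y_factors(2,1)] by simp
  then have "h [^] (r ^ n) \<otimes> c [^] (r ^ n) = \<one>"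
    using y(2) y_factors(1,3) c_carrier pow_mult_distrib by (metis H.mem_carrier)
  then have "c [^] (r ^ n) = inv (h [^] (r ^ n))"
    using y_factors(1) c_carrier by (metis H.mem_carrier inv_equality inv_comm nat_pow_closed)
  then have "c [^] (r ^ n) \<in> H" using subgroup_pow_closed[OF H y_factors(1)] by simp
  then have "c \<in> H"
    using centralizer[OF subgroup_pow_closed[OF subgroup_C y_factors(2)]]
    by (rule mem_subgroup_if_prime_power_part_mem[OF H r c_carrier])
  then show ?thesis using y_factors by simp
qed

lemma conj_by_mem_central_factor:
  fixes r :: nat
  assumes H: "subgroup H G" and g: "g \<in> normalizer G (times_centralizer G H)"
    and r: "Factorial_Ring.prime r" and rank: "rank_le_one_at G r (times_centralizer G H)"
    and x: "x \<in> H" "ord x = r ^ n"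
  shows "conj_by G g x \<in> H"
proof -
  let ?C = "centralizer G H" and ?K = "times_centralizer G H"
  interpret H: subgroup H G by fact
  have subgroup_C: "subgroup ?C G" using H.subset by (rule subgroup_centralizer)
  have subgroup_K: "subgroup ?K G" using H by (rule subgroup_times_centralizer)
  note mem_cyc = mem_cyc_if_rank_le_one[OF subgroup_K rank r]
  have g_carrier: "g \<in> carrier G" using g normalizer_subset by blast
  have xK: "x \<in> ?K" using x(1) subset_times_centralizer[OF H] by blast
  have x_pow: "x [^] (r ^ n) = \<one>" using x by (metis H.mem_carrier pow_ord_eq_1)
  let ?y = "conj_by G g x"
  have yK: "?y \<in> ?K" using normalizerD[OF subgroup_K g xK] .
  have y_pow: "?y [^] (r ^ n) = \<one>" using x_pow g_carrier x(1) by (simp add: conj_by_pow[symmetric])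
  show ?thesis
  proof (cases "\<exists>c \<in> ?C. c \<notin> H \<and> (\<exists>m. ord c = r ^ m)")
    case True
    then obtain c m where c: "c \<in> ?C" "c \<notin> H" "ord c = r ^ m" by blast
    have c_carrier: "c \<in> carrier G" and cK: "c \<in> ?K" and commutes: "x \<otimes> c = c \<otimes> x"
      using c(1) x(1) centralizer_subset_times_centralizer[OF H] by (auto simp: centralizer_def)
    have "c [^] (r ^ m) = \<one>" using c(3) c_carrier by (metis pow_ord_eq_1)
    moreover have "c \<notin> cyc x" using cyc_subset[OF H x(1)] c(2) by blast
    ultimately have "\<not> m \<le> n" using mem_cyc[OF xK x(2) _ cK] commutes by auto
    then have "x \<in> cyc c" using mem_cyc[OF cK c(3) _ xK x_pow commutes] by simp
    then have "x \<in> ?C" using cyc_subset[OF subgroup_C c(1)] by blast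
    then have "?y \<otimes> x = x \<otimes> ?y"
      using times_centralizer_subset_centralizer[OF H x(1)] yK centralizerD[of ?y "{x}" x] by blast
    then have "?y \<in> cyc x" using mem_cyc[OF xK x(2) le_refl yK y_pow] by simp
    then show ?thesis using cyc_subset[OF H x(1)] by blast
  next
    case False
    then show ?thesis
      using mem_if_prime_power_elements_of_centralizer_mem[OF H r yK y_pow] by blast
  qed
qed

theorem normalizer_times_centralizer_subset:
  assumes H: "subgroup H G"
    and rank: "\<And>r. Factorial_Ring.prime r \<Longrightarrow> rank_le_one_at G r (times_centralizer G H)"
  shows "normalizer G (times_centralizer G H) \<subseteq> normalizer G H"
proof
  interpret H: subgroup H G by fact
  fix g assume g: "g \<in> normalizer G (times_centralizer G H)"
  then have g_carrier: "g \<in> carrier G" using normalizer_subset by blast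
  let ?S = "{x \<in> H. conj_by G g x \<in> H}"
  have "subgroup ?S G"
    using g_carrier by (intro subgroup_if_mult_closed) (auto simp: conj_by_mult)
  then have "?S = H"
  proof (rule subgroup_eq_if_contains_sylows[OF H])
    fix r :: nat assume r: "Factorial_Ring.prime r"
    obtain R where R: "sylow_subgroup G r R H" using sylow_subgroup_exists[OF H r] .
    note R_subgroup = sylow_subgroupD[OF R]
    obtain k where k: "card R = r ^ k" using R_subgroup(2) by (auto simp: p_subgroup_def)
    have "conj_by G g x \<in> H" if "x \<in> R" for x
    proof -
      have x: "x \<in> H" "x \<in> carrier G" using that R_subgroup(3) by auto
      have "ord x dvd r ^ k"
        using card_subgroup_dvd[OF subgroup_cyc[OF x(2)] R_subgroup(1)
          cyc_subset[OF R_subgroup(1) that]] k x(2)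
        by (simp add: generate_pow_card[symmetric])
      then obtain n where "ord x = r ^ n" using divides_primepow_nat[OF r] by blast
      then show ?thesis using conj_by_mem_central_factor[OF H g r rank[OF r] x(1)] by simp
    qed
    then show "\<exists>R. sylow_subgroup G r R H \<and> R \<subseteq> ?S" using R R_subgroup(3) by blast
  qed simp
  then show "g \<in> normalizer G H" using g_carrier H.subset by (intro mem_normalizerI) auto
qed

end

section \<open>Reduction to self-centralizing subgroups\<close>

context finite_group
begin

text \<open>A conjugate of \<open>K\<close> under the normalizer of the normalizer of \<open>K\<close> that differs from \<open>K\<close> meets
  \<open>K\<close> trivially, and the two normalize each other, so the conjugate would centralize \<open>K\<close>.\<close>
lemma normalizer_normalizer_subset_if_TI:
  assumes K: "self_centralizing K G" "K \<noteq> {\<one>}" "TI_subgroup K G"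
  shows "normalizer G (normalizer G K) \<subseteq> normalizer G K"
proof (rule subsetI, rule ccontr)
  have subgroup_K: "subgroup K G" using K(1) by (simp add: self_centralizing_def)
  interpret K: subgroup K G by fact
  let ?N = "normalizer G K"
  have subgroup_N: "subgroup ?N G" using subgroup_K by (rule subgroup_normalizer)
  have KN: "K \<subseteq> ?N" using subgroup_K by (rule subgroup_subset_normalizer)
  fix x assume x: "x \<in> normalizer G ?N" "x \<notin> ?N"
  then have x_carrier: "x \<in> carrier G" using normalizer_subset by blast
  let ?Kx = "conj_by G x ` K"
  have subgroup_Kx: "subgroup ?Kx G" using subgroup_K x_carrier by (rule subgroup_conj_by_image)
  have disjoint: "?Kx \<inter> K = {\<one>}"
  proof -
    have "conj_by G x l = \<one>" if "l \<in> K" "conj_by G x l \<in> K" for l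
      using TI_subgroupD[OF K(3) x_carrier that(1) _ that(2)] x(2) x_carrier that(1) by auto
    then have "?Kx \<inter> K \<subseteq> {\<one>}" by blast
    then show ?thesis using subgroup.one_closed[OF subgroup_Kx] K.one_closed by blast
  qed
  have N_eq: "conj_by G x ` ?N = ?N" using subgroup_N x(1) by (rule normalizer_image_eq)
  then have "?Kx \<subseteq> ?N" using KN by blast
  moreover have "K \<subseteq> normalizer G ?Kx"
    using KN N_eq conj_by_image_normalizer_subset[OF subgroup_K x_carrier] by blast
  ultimately have "?Kx \<subseteq> centralizer G K"
    using normalizing_disjoint_commute[OF subgroup_Kx subgroup_K] disjoint by simp
  then have "?Kx \<subseteq> {\<one>}" using K(1) disjoint by (auto simp: self_centralizing_def)
  then have "K \<subseteq> {\<one>}" using x_carrier by auto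
  then show False using K(2) K.one_closed by blast
qed

lemma malnormal_in_normalizer_if_TI:
  assumes "self_centralizing K G" "K \<noteq> {\<one>}" "TI_subgroup K G" "TI_subgroup (normalizer G K) G"
  shows "malnormal_in G (normalizer G K) (carrier G)"
  using TI_subgroupD[OF assms(4)] normalizer_normalizer_subset_if_TI[OF assms(1-3)]
  unfolding malnormal_in_def by blast

lemma abelian_normal_subgroup_exists_if_malnormal:
  assumes M: "subgroup M G" "M \<noteq> carrier G" "malnormal_in G M (carrier G)" "non_abelian M G"
    and p: "Factorial_Ring.prime p" "p dvd card M"
    and TI_or_subnormal: "\<And>L. self_centralizing L G \<Longrightarrow> non_abelian L G \<Longrightarrow> p dvd card L \<Longrightarrow>
      TI_subgroup L G \<or> subnormal G L"
  shows "\<exists>A. A \<lhd> G \<and> A \<noteq> {\<one>} \<and> \<not> non_abelian A G"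
proof -
  obtain P where P: "sylow_subgroup G p P M" using sylow_subgroup_exists[OF M(1) p(1)] .
  note P_subgroup = sylow_subgroupD[OF P]
  have P_nontrivial: "P \<noteq> {\<one>}" using P p(2) by (rule sylow_subgroup_nontrivial)
  obtain k where "card P = p ^ k" using P_subgroup(2) by (auto simp: p_subgroup_def)
  then have "p dvd card P"
    using P_nontrivial card_subgroup_eq_one_iff[OF P_subgroup(1)] by (cases k) auto
  interpret malnormal_sylow G p M P
  proof (intro malnormal_sylow.intro malnormal_sylow_axioms.intro finite_group_axioms p(1) M
      P_subgroup(3)
      P_nontrivial)
    show "sylow_subgroup G p P (carrier G)"
      using M(1,3) p(1) P P_nontrivial by (rule sylow_subgroup_if_malnormal)
    fix L assume L: "self_centralizing L G" "non_abelian L G" "P \<subseteq> L"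
    then have "p dvd card L"
      using \<open>p dvd card P\<close> card_subgroup_dvd[OF P_subgroup(1)]
      by (meson dvd_trans self_centralizing_def)
    then show "TI_subgroup L G \<or> subnormal G L" using TI_or_subnormal[OF L(1,2)] by simp
  qed
  show ?thesis by (rule abelian_normal_subgroup_exists)
qed

lemma normalizer_times_centralizer_subset_if_malnormal:
  assumes H: "subgroup H G" and M: "subgroup M G" "malnormal_in G M (carrier G)" "M \<noteq> carrier G"
    and "times_centralizer G H \<subseteq> M" and A: "A \<lhd> G" "\<not> non_abelian A G" "A \<noteq> {\<one>}"
  shows "normalizer G (times_centralizer G H) \<subseteq> normalizer G H"
proof (rule normalizer_times_centralizer_subset[OF H])
  let ?K = "times_centralizer G H"
  have subgroup_K: "subgroup ?K G" using H by (rule subgroup_times_centralizer)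
  have subgroup_A: "subgroup A G" and A_normal: "carrier G \<subseteq> normalizer G A"
    using A(1) by (simp_all add: normal_iff_normalizer)
  have "A \<inter> M = {\<one>}" using M A(1,2) by (rule malnormal_inter_abelian_normal_trivial)
  with M(2,1) \<open>?K \<subseteq> M\<close> subgroup.subset[OF subgroup_A] have "fixed_point_free G ?K A"
    by (rule fixed_point_free_if_malnormal)
  moreover have "?K \<subseteq> normalizer G A" using A_normal subgroup.subset[OF subgroup_K] by blast
  ultimately show "rank_le_one_at G r ?K" if "Factorial_Ring.prime r" for r
    using rank_le_one_if_fixed_point_free[OF subgroup_A A(2,3) subgroup_K _ _ that] by simp
qed

theorem TI_or_subnormal_if_self_centralizing_TI_or_subnormal:
  assumes p: "Factorial_Ring.prime p"
    and TI_or_subnormal: "\<And>L. self_centralizing L G \<Longrightarrow> non_abelian L G \<Longrightarrow> p dvd card L \<Longrightarrow>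
      TI_subgroup L G \<or> subnormal G L"
    and H: "subgroup H G" "non_abelian H G" "p dvd card H"
  shows "TI_subgroup H G \<or> subnormal G H"
proof (rule disjCI)
  assume H_not_subnormal: "\<not> subnormal G H"
  let ?K = "times_centralizer G H"
  let ?M = "normalizer G ?K"
  have HK: "H \<subseteq> ?K" using H(1) by (rule subset_times_centralizer)
  have subgroup_K: "subgroup ?K G" using H(1) by (rule subgroup_times_centralizer)
  have K: "self_centralizing ?K G" "non_abelian ?K G" "p dvd card ?K"
    using self_centralizing_times_centralizer[OF H(1)] non_abelian_mono[OF H(2) HK]
      dvd_trans[OF H(3) card_subgroup_dvd[OF H(1) subgroup_K HK]] by auto
  have "\<not> subnormal G ?K"
    using H_not_subnormal subnormal.step[OF _ subgroup_K, of H] HK H(1)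
      times_centralizer_subset_normalizer[OF H(1)]
    by (auto simp: normal_in_subgroup_iff[OF subgroup_K])
  then have K_TI: "TI_subgroup ?K G" using TI_or_subnormal[OF K] by blast
  have KM: "?K \<subseteq> ?M" using subgroup_K by (rule subgroup_subset_normalizer)
  have subgroup_M: "subgroup ?M G" using subgroup_K by (rule subgroup_normalizer)
  have M: "self_centralizing ?M G" "non_abelian ?M G" "p dvd card ?M"
    using self_centralizing_mono[OF K(1) subgroup_M KM] non_abelian_mono[OF K(2) KM]
      dvd_trans[OF K(3) card_subgroup_dvd[OF subgroup_K subgroup_M KM]] by auto
  have M_not_subnormal: "\<not> subnormal G ?M"
    using \<open>\<not> subnormal G ?K\<close> subnormal.step[OF _ subgroup_M, of ?K] subgroup_K KM
    by (auto simp: normal_in_subgroup_iff[OF subgroup_M])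
  then have "TI_subgroup ?M G" using TI_or_subnormal[OF M] by blast
  moreover have "?K \<noteq> {\<one>}" using K(2) by (auto simp: non_abelian_def)
  ultimately have M_malnormal: "malnormal_in G ?M (carrier G)"
    using malnormal_in_normalizer_if_TI[OF K(1) _ K_TI] by blast
  have M_proper: "?M \<noteq> carrier G" using M_not_subnormal subnormal.top by metis
  obtain A where A: "A \<lhd> G" "A \<noteq> {\<one>}" "\<not> non_abelian A G"
    using
      abelian_normal_subgroup_exists_if_malnormal[OF subgroup_M M_proper M_malnormal M(2) p M(3)]
      TI_or_subnormal by blast
  have "normalizer G ?K \<subseteq> normalizer G H"
    using H(1) subgroup_M M_malnormal M_proper KM A(1,3,2)
    by (rule normalizer_times_centralizer_subset_if_malnormal)
  then show "TI_subgroup H G" by (rule TI_subgroup_descend[OF K_TI H(1) HK])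
qed

end

theorem theorem1p7:
  fixes G :: "('a, 'b) monoid_scheme" and p :: nat
  assumes "group G" and "finite (carrier G)" and "Factorial_Ring.prime p" and "p dvd order G"
  shows "(\<forall>H. subgroup H G \<and> self_centralizing H G \<and> non_abelian H G \<longrightarrow>
             TI_subgroup H G \<or> subnormal G H \<or> p'_order p H)
     \<longleftrightarrow> (\<forall>H. subgroup H G \<and> non_abelian H G \<longrightarrow>
             TI_subgroup H G \<or> subnormal G H \<or> p'_order p H)"
proof
  interpret finite_group G using assms by (simp add: finite_group_def finite_group_axioms_def)
  assume self_centralizing: "\<forall>H. subgroup H G \<and> self_centralizing H G \<and> non_abelian H G \<longrightarrow>
      TI_subgroup H G \<or> subnormal G H \<or> p'_order p H"
  have "TI_subgroup L G \<or> subnormal G L"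
    if "self_centralizing L G" "non_abelian L G" "p dvd card L" for L
    using self_centralizing that unfolding p'_order_def self_centralizing_def by blast
  then show "\<forall>H. subgroup H G \<and> non_abelian H G \<longrightarrow> TI_subgroup H G \<or> subnormal G H \<or> p'_order p H"
    using TI_or_subnormal_if_self_centralizing_TI_or_subnormal[OF assms(3)]
    unfolding p'_order_def by blast
qed blast

end
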